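(* Suppose there is no transitive model of $ZFC^-+\text{``}\kappa(\omega)\text{ exists''}$. Then $\mathrm{Graphs}\leq_{a\Delta^1_2}\mathrm{TFAG}$.
   Context: $ZFC^-$ is $ZFC$ without the power set axiom, with replacement strengthened to collection and choice strengthened to the well-ordering principle. $\kappa(\omega)$ is the least cardinal $\kappa$ with $\kappa\to(\omega)^{<\omega}_2$. For a sentence $\Phi$ of $\mathcal{L}_{\omega_1\omega}$, $\mathrm{Mod}(\Phi)$ is the standard Borel space of models of $\Phi$ with universe $\mathbb{N}$. $\mathrm{Graphs}$ is the theory of graphs, $\mathrm{TFAG}$ the theory of torsion-free abelian groups. $\Phi\leq_{a\Delta^1_2}\Psi$ means: there is a function $f:\mathrm{Mod}(\Phi)\to\mathrm{Mod}(\Psi)$ whose graph is $\Delta^1_2$, defined by a $\Pi^1_2$ formula $\sigma(x,y)$ and a $\Sigma^1_2$ formula $\tau(x,y)$, with $M\cong N\iff f(M)\cong f(N)$ for all $M,N\in\mathrm{Mod}(\Phi)$, and such that in every forcing extension $V[G]$, $\sigma$ and $\tau$ still coincide on $\mathrm{Mod}(\Phi)^{V[G]}\times\mathrm{Mod}(\Psi)^{V[G]}$ and define the graph of a function $f^{V[G]}$ with $M\cong N\iff f^{V[G]}(M)\cong f^{V[G]}(N)$ for all $M,N\in\mathrm{Mod}(\Phi)^{V[G]}$. *)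

theory Defs
  imports Main "HOL-Library.Nat_Bijection"
begin

section \<open>Structures for the language of set theory\<close>

text \<open>Formulas of set theory, with named variables; they are needed for the axiom schemes.\<close>

datatype setfm =
    SMem nat nat
  | SEq nat nat
  | SNeg setfm
  | SAnd setfm setfm
  | SAll nat setfm

primrec ssat :: "'v set \<Rightarrow> ('v \<Rightarrow> 'v \<Rightarrow> bool) \<Rightarrow> (nat \<Rightarrow> 'v) \<Rightarrow> setfm \<Rightarrow> bool" where
  "ssat D E e (SMem i j) = E (e i) (e j)"
| "ssat D E e (SEq i j) = (e i = e j)"
| "ssat D E e (SNeg \<phi>) = (\<not> ssat D E e \<phi>)"
| "ssat D E e (SAnd \<phi> \<psi>) = (ssat D E e \<phi> \<and> ssat D E e \<psi>)"
| "ssat D E e (SAll i \<phi>) = (\<forall>x\<in>D. ssat D E (e(i := x)) \<phi>)"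

text \<open>All notions in this locale are first-order over the structure (D, E): every quantifier
  ranges over D. For D the set of members of a transitive set M they say what M satisfies.\<close>

locale epsilon_structure =
  fixes D :: "'v set" and E :: "'v \<Rightarrow> 'v \<Rightarrow> bool"
begin

definition empty where "empty x \<longleftrightarrow> (\<forall>z\<in>D. \<not> E z x)"

definition subset where "subset x y \<longleftrightarrow> (\<forall>z\<in>D. E z x \<longrightarrow> E z y)"

definition successor where
  "successor x y \<longleftrightarrow> (\<forall>z\<in>D. E z y \<longleftrightarrow> E z x \<or> z = x)"

definition upair where
  "upair x y p \<longleftrightarrow> (\<forall>z\<in>D. E z p \<longleftrightarrow> z = x \<or> z = y)"

definition opair where
  "opair x y p \<longleftrightarrow> (\<exists>a\<in>D. \<exists>b\<in>D. upair x x a \<and> upair x y b \<and> upair a b p)"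

definition related where
  "related r x y \<longleftrightarrow> (\<exists>p\<in>D. opair x y p \<and> E p r)"

definition mapping where
  "mapping f a b \<longleftrightarrow>
     (\<forall>p\<in>D. E p f \<longrightarrow> (\<exists>x\<in>D. \<exists>y\<in>D. E x a \<and> E y b \<and> opair x y p)) \<and>
     (\<forall>x\<in>D. E x a \<longrightarrow> (\<exists>!y. y \<in> D \<and> related f x y))"

definition bijection where
  "bijection f a b \<longleftrightarrow> mapping f a b \<and>
     (\<forall>y\<in>D. E y b \<longrightarrow> (\<exists>!x. x \<in> D \<and> related f x y))"

definition equinumerous where
  "equinumerous a b \<longleftrightarrow> (\<exists>f\<in>D. bijection f a b)"

definition transitive where
  "transitive x \<longleftrightarrow> (\<forall>y\<in>D. E y x \<longrightarrow> subset y x)"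

definition ordinal where
  "ordinal x \<longleftrightarrow> transitive x \<and> (\<forall>y\<in>D. E y x \<longrightarrow> transitive y)"

definition limit_ordinal where
  "limit_ordinal x \<longleftrightarrow> ordinal x \<and> \<not> empty x \<and> (\<forall>y\<in>D. E y x \<longrightarrow> (\<exists>z\<in>D. E z x \<and> E y z))"

definition omega where
  "omega w \<longleftrightarrow> limit_ordinal w \<and> (\<forall>x\<in>D. E x w \<longrightarrow> \<not> limit_ordinal x)"

definition natural where
  "natural n \<longleftrightarrow> (\<exists>w\<in>D. omega w \<and> E n w)"

definition cardinal where
  "cardinal k \<longleftrightarrow> ordinal k \<and> (\<forall>x\<in>D. E x k \<longrightarrow> \<not> equinumerous x k)"

definition finite_set where
  "finite_set x \<longleftrightarrow> (\<exists>n\<in>D. natural n \<and> equinumerous x n)"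

definition two where
  "two t \<longleftrightarrow> (\<forall>x\<in>D. E x t \<longleftrightarrow> empty x \<or> (\<exists>z\<in>D. empty z \<and> upair z z x))"

definition well_orders where
  "well_orders r x \<longleftrightarrow>
     (\<forall>a\<in>D. E a x \<longrightarrow> \<not> related r a a) \<and>
     (\<forall>a\<in>D. \<forall>b\<in>D. \<forall>c\<in>D. E a x \<and> E b x \<and> E c x \<and> related r a b \<and> related r b c
        \<longrightarrow> related r a c) \<and>
     (\<forall>a\<in>D. \<forall>b\<in>D. E a x \<and> E b x \<longrightarrow> a = b \<or> related r a b \<or> related r b a) \<and>
     (\<forall>y\<in>D. subset y x \<and> \<not> empty y \<longrightarrow>
        (\<exists>a\<in>D. E a y \<and> (\<forall>b\<in>D. E b y \<and> b \<noteq> a \<longrightarrow> related r a b)))"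

subsection \<open>Axioms\<close>

definition extensionality where
  "extensionality \<longleftrightarrow> (\<forall>x\<in>D. \<forall>y\<in>D. (\<forall>z\<in>D. E z x \<longleftrightarrow> E z y) \<longrightarrow> x = y)"

definition foundation where
  "foundation \<longleftrightarrow> (\<forall>x\<in>D. \<not> empty x \<longrightarrow> (\<exists>y\<in>D. E y x \<and> \<not> (\<exists>z\<in>D. E z x \<and> E z y)))"

definition pairing where
  "pairing \<longleftrightarrow> (\<forall>x\<in>D. \<forall>y\<in>D. \<exists>p\<in>D. upair x y p)"

definition union where
  "union \<longleftrightarrow> (\<forall>x\<in>D. \<exists>u\<in>D. \<forall>z\<in>D. E z u \<longleftrightarrow> (\<exists>y\<in>D. E y x \<and> E z y))"

definition power_set where
  "power_set \<longleftrightarrow> (\<forall>x\<in>D. \<exists>p\<in>D. \<forall>z\<in>D. E z p \<longleftrightarrow> subset z x)"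

definition infinity where
  "infinity \<longleftrightarrow> (\<exists>x\<in>D. (\<exists>y\<in>D. E y x \<and> empty y) \<and>
     (\<forall>y\<in>D. E y x \<longrightarrow> (\<exists>z\<in>D. E z x \<and> successor y z)))"

definition well_ordering_principle where
  "well_ordering_principle \<longleftrightarrow> (\<forall>x\<in>D. \<exists>r\<in>D. well_orders r x)"

definition separation_scheme where
  "separation_scheme \<longleftrightarrow> (\<forall>\<phi> e. range e \<subseteq> D \<longrightarrow>
     (\<forall>a\<in>D. \<exists>b\<in>D. \<forall>x\<in>D. E x b \<longleftrightarrow> E x a \<and> ssat D E (e(0 := x)) \<phi>))"

definition collection_scheme where
  "collection_scheme \<longleftrightarrow> (\<forall>\<phi> e. range e \<subseteq> D \<longrightarrow>
     (\<forall>a\<in>D. (\<forall>x\<in>D. E x a \<longrightarrow> (\<exists>y\<in>D. ssat D E (e(0 := x, 1 := y)) \<phi>)) \<longrightarrow>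
        (\<exists>b\<in>D. \<forall>x\<in>D. E x a \<longrightarrow> (\<exists>y\<in>D. E y b \<and> ssat D E (e(0 := x, 1 := y)) \<phi>))))"

definition ZFC_minus where
  "ZFC_minus \<longleftrightarrow> extensionality \<and> foundation \<and> pairing \<and> union \<and> infinity \<and>
     separation_scheme \<and> collection_scheme \<and> well_ordering_principle"

subsection \<open>The cardinal $\kappa(\omega)$\<close>

definition finite_subsets where
  "finite_subsets k s \<longleftrightarrow> (\<forall>u\<in>D. E u s \<longleftrightarrow> subset u k \<and> finite_set u)"

definition order_type_omega where
  "order_type_omega h \<longleftrightarrow> (\<exists>w\<in>D. \<exists>g\<in>D. omega w \<and> bijection g w h \<and>
     (\<forall>m\<in>D. \<forall>n\<in>D. \<forall>a\<in>D. \<forall>b\<in>D.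
        E m w \<and> E n w \<and> E m n \<and> related g m a \<and> related g n b \<longrightarrow> E a b))"

text \<open>The colouring f is constant on the n-element subsets of h, for each natural number n.\<close>

definition homogeneous where
  "homogeneous f h \<longleftrightarrow> (\<forall>n\<in>D. natural n \<longrightarrow>
     (\<forall>u\<in>D. \<forall>v\<in>D. \<forall>a\<in>D. \<forall>b\<in>D.
        subset u h \<and> equinumerous u n \<and> subset v h \<and> equinumerous v n \<and>
        related f u a \<and> related f v b \<longrightarrow> a = b))"

text \<open>$k \to (\omega)^{<\omega}_2$\<close>

definition partition_omega where
  "partition_omega k \<longleftrightarrow> (\<forall>s\<in>D. \<forall>t\<in>D. \<forall>f\<in>D.
     finite_subsets k s \<and> two t \<and> mapping f s t \<longrightarrow>
       (\<exists>h\<in>D. subset h k \<and> order_type_omega h \<and> homogeneous f h))"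

definition kappa_omega where
  "kappa_omega k \<longleftrightarrow> cardinal k \<and> partition_omega k \<and>
     (\<forall>m\<in>D. E m k \<and> cardinal m \<longrightarrow> \<not> partition_omega m)"

definition kappa_omega_exists where
  "kappa_omega_exists \<longleftrightarrow> (\<exists>k\<in>D. kappa_omega k)"

end

text \<open>The universe V of sets is a type with a membership relation satisfying ZFC. Its classes are
  the predicates and functions of HOL, so separation and replacement are stated for these. In
  particular every subset of (and every relation on) a set of V is again in V, whence the reals of V
  may be identified with the objects of type nat set.\<close>

definition zfc_universe :: "('v \<Rightarrow> 'v \<Rightarrow> bool) \<Rightarrow> bool" where
  "zfc_universe E \<longleftrightarrow>
     epsilon_structure.extensionality UNIV E \<and>
     epsilon_structure.foundation UNIV E \<and>
     epsilon_structure.pairing UNIV E \<and>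
     epsilon_structure.union UNIV E \<and>
     epsilon_structure.power_set UNIV E \<and>
     epsilon_structure.infinity UNIV E \<and>
     epsilon_structure.well_ordering_principle UNIV E \<and>
     (\<forall>A a. \<exists>b. \<forall>x. E x b \<longleftrightarrow> E x a \<and> A x) \<and>
     (\<forall>F a. \<exists>b. \<forall>y. E y b \<longleftrightarrow> (\<exists>x. E x a \<and> y = F x))"

definition members :: "('v \<Rightarrow> 'v \<Rightarrow> bool) \<Rightarrow> 'v \<Rightarrow> 'v set" where
  "members E M = {x. E x M}"

definition transitive_model_kappa_omega :: "('v \<Rightarrow> 'v \<Rightarrow> bool) \<Rightarrow> 'v \<Rightarrow> bool" where
  "transitive_model_kappa_omega E M \<longleftrightarrow>
     epsilon_structure.transitive UNIV E M \<and>
     epsilon_structure.ZFC_minus (members E M) E \<and>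
     epsilon_structure.kappa_omega_exists (members E M) E"

section \<open>Second-order arithmetic\<close>

text \<open>Number variables and set variables are named by natural numbers. The pairing function of
  the term language is arithmetically definable and serves to code tuples; BigAnd, a
  countable conjunction, serves to express satisfaction of a fixed sentence of
  $\mathcal{L}_{\omega_1\omega}$. It does not occur in arithmetical formulas.\<close>

datatype tm =
    NVar nat
  | Zero
  | Succ tm
  | Plus tm tm
  | Times tm tm
  | PairT tm tm

datatype fm =
    Mem tm nat
  | Equal tm tm
  | Neg fm
  | And fm fm
  | BigAnd "nat \<Rightarrow> fm"
  | AllN nat fm
  | AllS nat fm

definition Imp where "Imp \<phi> \<psi> = Neg (And \<phi> (Neg \<psi>))"
definition Iff where "Iff \<phi> \<psi> = And (Imp \<phi> \<psi>) (Imp \<psi> \<phi>)"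
definition ExN where "ExN i \<phi> = Neg (AllN i (Neg \<phi>))"
definition ExS where "ExS i \<phi> = Neg (AllS i (Neg \<phi>))"
definition Truth where "Truth = Equal Zero Zero"

primrec tval :: "(nat \<Rightarrow> nat) \<Rightarrow> tm \<Rightarrow> nat" where
  "tval e (NVar i) = e i"
| "tval e Zero = 0"
| "tval e (Succ t) = Suc (tval e t)"
| "tval e (Plus s t) = tval e s + tval e t"
| "tval e (Times s t) = tval e s * tval e t"
| "tval e (PairT s t) = prod_encode (tval e s, tval e t)"

primrec sat :: "(nat \<Rightarrow> nat) \<Rightarrow> (nat \<Rightarrow> nat set) \<Rightarrow> fm \<Rightarrow> bool" where
  "sat e X (Mem t i) = (tval e t \<in> X i)"
| "sat e X (Equal s t) = (tval e s = tval e t)"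
| "sat e X (Neg \<phi>) = (\<not> sat e X \<phi>)"
| "sat e X (And \<phi> \<psi>) = (sat e X \<phi> \<and> sat e X \<psi>)"
| "sat e X (BigAnd \<Phi>) = (\<forall>m. sat e X (\<Phi> m))"
| "sat e X (AllN i \<phi>) = (\<forall>n. sat (e(i := n)) X \<phi>)"
| "sat e X (AllS i \<phi>) = (\<forall>A. sat e (X(i := A)) \<phi>)"

lemma sat_connectives [simp]:
  "sat e X (Imp \<phi> \<psi>) \<longleftrightarrow> (sat e X \<phi> \<longrightarrow> sat e X \<psi>)"
  "sat e X (Iff \<phi> \<psi>) \<longleftrightarrow> (sat e X \<phi> \<longleftrightarrow> sat e X \<psi>)"
  "sat e X (ExN i \<phi>) \<longleftrightarrow> (\<exists>n. sat (e(i := n)) X \<phi>)"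
  "sat e X (ExS i \<phi>) \<longleftrightarrow> (\<exists>A. sat e (X(i := A)) \<phi>)"
  "sat e X Truth"
  by (auto simp: Imp_def Iff_def ExN_def ExS_def Truth_def)

primrec arithmetical :: "fm \<Rightarrow> bool" where
  "arithmetical (Mem t i) = True"
| "arithmetical (Equal s t) = True"
| "arithmetical (Neg \<phi>) = arithmetical \<phi>"
| "arithmetical (And \<phi> \<psi>) = (arithmetical \<phi> \<and> arithmetical \<psi>)"
| "arithmetical (BigAnd \<Phi>) = False"
| "arithmetical (AllN i \<phi>) = arithmetical \<phi>"
| "arithmetical (AllS i \<phi>) = False"

primrec tvars :: "tm \<Rightarrow> nat set" where
  "tvars (NVar i) = {i}"
| "tvars Zero = {}"
| "tvars (Succ t) = tvars t"
| "tvars (Plus s t) = tvars s \<union> tvars t"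
| "tvars (Times s t) = tvars s \<union> tvars t"
| "tvars (PairT s t) = tvars s \<union> tvars t"

primrec free_num :: "fm \<Rightarrow> nat set" where
  "free_num (Mem t i) = tvars t"
| "free_num (Equal s t) = tvars s \<union> tvars t"
| "free_num (Neg \<phi>) = free_num \<phi>"
| "free_num (And \<phi> \<psi>) = free_num \<phi> \<union> free_num \<psi>"
| "free_num (BigAnd \<Phi>) = (\<Union>m. free_num (\<Phi> m))"
| "free_num (AllN i \<phi>) = free_num \<phi> - {i}"
| "free_num (AllS i \<phi>) = free_num \<phi>"

primrec free_set :: "fm \<Rightarrow> nat set" where
  "free_set (Mem t i) = {i}"
| "free_set (Equal s t) = {}"
| "free_set (Neg \<phi>) = free_set \<phi>"
| "free_set (And \<phi> \<psi>) = free_set \<phi> \<union> free_set \<psi>"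
| "free_set (BigAnd \<Phi>) = (\<Union>m. free_set (\<Phi> m))"
| "free_set (AllN i \<phi>) = free_set \<phi>"
| "free_set (AllS i \<phi>) = free_set \<phi> - {i}"

text \<open>Formulas $\sigma(x, y)$ without parameters: the set variables 0 and 1 stand for x and y.\<close>

definition formula_in_x_y :: "fm \<Rightarrow> bool" where
  "formula_in_x_y \<phi> \<longleftrightarrow> free_num \<phi> = {} \<and> free_set \<phi> \<subseteq> {0, 1}"

definition Sigma12 :: "fm \<Rightarrow> bool" where
  "Sigma12 \<phi> \<longleftrightarrow> (\<exists>i j \<psi>. arithmetical \<psi> \<and> \<phi> = ExS i (AllS j \<psi>))"

definition Pi12 :: "fm \<Rightarrow> bool" where
  "Pi12 \<phi> \<longleftrightarrow> (\<exists>i j \<psi>. arithmetical \<psi> \<and> \<phi> = AllS i (ExS j \<psi>))"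

definition sat2 :: "fm \<Rightarrow> nat set \<Rightarrow> nat set \<Rightarrow> bool" where
  "sat2 \<phi> x y \<longleftrightarrow> sat (\<lambda>_. 0) ((\<lambda>_. {})(0 := x, 1 := y)) \<phi>"

text \<open>Replacing x and y in $\sigma(x, y)$ by other set variables. All set variables, bound ones
  included, are renamed injectively, so nothing is captured.\<close>

primrec rename :: "(nat \<Rightarrow> nat) \<Rightarrow> fm \<Rightarrow> fm" where
  "rename f (Mem t i) = Mem t (f i)"
| "rename f (Equal s t) = Equal s t"
| "rename f (Neg \<phi>) = Neg (rename f \<phi>)"
| "rename f (And \<phi> \<psi>) = And (rename f \<phi>) (rename f \<psi>)"
| "rename f (BigAnd \<Phi>) = BigAnd (\<lambda>m. rename f (\<Phi> m))"
| "rename f (AllN i \<phi>) = AllN i (rename f \<phi>)"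
| "rename f (AllS i \<phi>) = AllS (f i) (rename f \<phi>)"

definition at_xy :: "fm \<Rightarrow> nat \<Rightarrow> nat \<Rightarrow> fm" where
  "at_xy \<phi> i j = rename (\<lambda>n. if n = 0 then i else if n = 1 then j else n + i + j) \<phi>"

section \<open>Countable structures and $\mathcal{L}_{\omega_1\omega}$\<close>

text \<open>A (countable, relational) language is a set of pairs of a relation symbol and an arity. A
  structure with universe the natural numbers is a real, namely the set of the codes of its atomic
  facts.\<close>

type_synonym language = "(nat \<times> nat) set"

definition fact_code :: "nat \<Rightarrow> nat list \<Rightarrow> nat" where
  "fact_code r xs = prod_encode (r, list_encode xs)"

definition fact_codes :: "language \<Rightarrow> nat set" where
  "fact_codes L = {fact_code r xs | r xs. (r, length xs) \<in> L}"

datatype lfm =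
    LRel nat "nat list"
  | LEq nat nat
  | LNeg lfm
  | LConj "nat \<Rightarrow> lfm"
  | LAll nat lfm

primrec lsat :: "nat set \<Rightarrow> (nat \<Rightarrow> nat) \<Rightarrow> lfm \<Rightarrow> bool" where
  "lsat M e (LRel r vs) = (fact_code r (map e vs) \<in> M)"
| "lsat M e (LEq i j) = (e i = e j)"
| "lsat M e (LNeg \<phi>) = (\<not> lsat M e \<phi>)"
| "lsat M e (LConj \<Phi>) = (\<forall>m. lsat M e (\<Phi> m))"
| "lsat M e (LAll i \<phi>) = (\<forall>a. lsat M (e(i := a)) \<phi>)"

definition LAnd where "LAnd \<phi> \<psi> = LConj (\<lambda>m. if m = 0 then \<phi> else \<psi>)"
definition LImp where "LImp \<phi> \<psi> = LNeg (LAnd \<phi> (LNeg \<psi>))"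
definition LEx where "LEx i \<phi> = LNeg (LAll i (LNeg \<phi>))"

lemma lsat_connectives [simp]:
  "lsat M e (LAnd \<phi> \<psi>) \<longleftrightarrow> lsat M e \<phi> \<and> lsat M e \<psi>"
  "lsat M e (LImp \<phi> \<psi>) \<longleftrightarrow> (lsat M e \<phi> \<longrightarrow> lsat M e \<psi>)"
  "lsat M e (LEx i \<phi>) \<longleftrightarrow> (\<exists>a. lsat M (e(i := a)) \<phi>)"
  by (auto simp: LAnd_def LImp_def LEx_def)

type_synonym theory_sentence = "language \<times> lfm"

definition Mod :: "theory_sentence \<Rightarrow> nat set set" where
  "Mod T = {M. M \<subseteq> fact_codes (fst T) \<and> lsat M (\<lambda>_. 0) (snd T)}"

definition isomorphic :: "language \<Rightarrow> nat set \<Rightarrow> nat set \<Rightarrow> bool" where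
  "isomorphic L M N \<longleftrightarrow> (\<exists>\<pi>. bij \<pi> \<and>
     (\<forall>r xs. (r, length xs) \<in> L \<longrightarrow> (fact_code r xs \<in> M \<longleftrightarrow> fact_code r (map \<pi> xs) \<in> N)))"

subsection \<open>Graphs\<close>

definition Graphs :: theory_sentence where
  "Graphs = ({(0, 2)},
     LAnd (LAll 0 (LNeg (LRel 0 [0, 0])))
          (LAll 0 (LAll 1 (LImp (LRel 0 [0, 1]) (LRel 0 [1, 0])))))"

subsection \<open>Torsion-free abelian groups\<close>

text \<open>The language has the graph of addition as its only relation.\<close>

definition Sum :: "nat \<Rightarrow> nat \<Rightarrow> nat \<Rightarrow> lfm" where
  "Sum i j k = LRel 0 [i, j, k]"

definition IsZero :: "nat \<Rightarrow> lfm" where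
  "IsZero i = LAll (Suc i) (Sum i (Suc i) (Suc i))"

text \<open>$n \cdot v_0 = v_j$, for $j \ge 1$\<close>

primrec Multiple :: "nat \<Rightarrow> nat \<Rightarrow> lfm" where
  "Multiple 0 j = IsZero j"
| "Multiple (Suc n) j = LEx (Suc j) (LAnd (Multiple n (Suc j)) (Sum (Suc j) 0 j))"

definition TFAG :: theory_sentence where
  "TFAG = ({(0, 3)},
     LAnd (LAll 0 (LAll 1 (LEx 2 (Sum 0 1 2))))
    (LAnd (LAll 0 (LAll 1 (LAll 2 (LAll 3
            (LImp (LAnd (Sum 0 1 2) (Sum 0 1 3)) (LEq 2 3))))))
    (LAnd (LAll 0 (LAll 1 (LAll 2 (LAll 3 (LAll 4 (LAll 5
            (LImp (LAnd (Sum 0 1 3) (LAnd (Sum 3 2 4) (Sum 1 2 5))) (Sum 0 5 4))))))))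
    (LAnd (LAll 0 (LAll 1 (LAll 2 (LImp (Sum 0 1 2) (Sum 1 0 2)))))
    (LAnd (LEx 0 (LAnd (IsZero 0) (LAll 1 (LEx 2 (Sum 1 2 0)))))
          (LConj (\<lambda>n. LAll 0 (LAll 1
            (LImp (LAnd (IsZero 1) (Multiple (Suc n) 1)) (LEq 0 1))))))))))"

subsection \<open>Models and isomorphism in second-order arithmetic\<close>

primrec numeral_tm :: "nat \<Rightarrow> tm" where
  "numeral_tm 0 = Zero"
| "numeral_tm (Suc n) = Succ (numeral_tm n)"

primrec list_tm :: "tm list \<Rightarrow> tm" where
  "list_tm [] = Zero"
| "list_tm (t # ts) = Succ (PairT t (list_tm ts))"

definition fact_tm :: "nat \<Rightarrow> nat list \<Rightarrow> tm" where
  "fact_tm r vs = PairT (numeral_tm r) (list_tm (map NVar vs))"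

primrec lfm_fm :: "nat \<Rightarrow> lfm \<Rightarrow> fm" where
  "lfm_fm s (LRel r vs) = Mem (fact_tm r vs) s"
| "lfm_fm s (LEq i j) = Equal (NVar i) (NVar j)"
| "lfm_fm s (LNeg \<phi>) = Neg (lfm_fm s \<phi>)"
| "lfm_fm s (LConj \<Phi>) = BigAnd (\<lambda>m. lfm_fm s (\<Phi> m))"
| "lfm_fm s (LAll i \<phi>) = AllN i (lfm_fm s \<phi>)"

definition Mod_fm :: "theory_sentence \<Rightarrow> nat \<Rightarrow> fm" where
  "Mod_fm T s = And
     (BigAnd (\<lambda>m. if m \<in> fact_codes (fst T) then Truth else Neg (Mem (numeral_tm m) s)))
     (lfm_fm s (snd T))"

definition bij_fm :: "nat \<Rightarrow> fm" where
  "bij_fm z = (let R = (\<lambda>i j. Mem (PairT (NVar i) (NVar j)) z) in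
     And (AllN 0 (ExN 1 (R 0 1)))
    (And (AllN 0 (AllN 1 (AllN 2 (Imp (And (R 0 1) (R 0 2)) (Equal (NVar 1) (NVar 2))))))
    (And (AllN 1 (ExN 0 (R 0 1)))
         (AllN 0 (AllN 1 (AllN 2 (Imp (And (R 0 2) (R 1 2)) (Equal (NVar 0) (NVar 1)))))))))"

text \<open>The number variables 0, ..., k - 1 stand for a tuple and k, ..., 2k - 1 for its image under the
  bijection with graph z.\<close>

definition preserve_fm :: "nat \<Rightarrow> nat \<Rightarrow> nat \<Rightarrow> nat \<Rightarrow> nat \<Rightarrow> fm" where
  "preserve_fm r k s t z = foldr AllN [0..<2 * k]
     (Imp (foldr (\<lambda>i. And (Mem (PairT (NVar i) (NVar (k + i))) z)) [0..<k] Truth)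
          (Iff (Mem (fact_tm r [0..<k]) s) (Mem (fact_tm r [k..<2 * k]) t)))"

definition iso_fm :: "language \<Rightarrow> nat \<Rightarrow> nat \<Rightarrow> fm" where
  "iso_fm L s t = (let z = s + t + 1 in ExS z (And (bij_fm z)
     (BigAnd (\<lambda>m. case prod_decode m of (r, k) \<Rightarrow>
        if (r, k) \<in> L then preserve_fm r k s t z else Truth))))"

definition same_set_fm :: "nat \<Rightarrow> nat \<Rightarrow> fm" where
  "same_set_fm s t = AllN 0 (Iff (Mem (NVar 0) s) (Mem (NVar 0) t))"

text \<open>The sentence of second-order arithmetic saying that $\sigma$ and $\tau$ coincide on
  $\mathrm{Mod}(\Phi) \times \mathrm{Mod}(\Psi)$ and define there the graph of a function which
  preserves and reflects isomorphism. Set variables: x = 0, y = 1, x' = 2, y' = 3.\<close>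

definition reduction_fm :: "theory_sentence \<Rightarrow> theory_sentence \<Rightarrow> fm \<Rightarrow> fm \<Rightarrow> fm" where
  "reduction_fm \<Phi> \<Psi> \<sigma> \<tau> =
     And (AllS 0 (AllS 1 (Imp (And (Mod_fm \<Phi> 0) (Mod_fm \<Psi> 1)) (Iff (at_xy \<sigma> 0 1) (at_xy \<tau> 0 1)))))
    (And (AllS 0 (Imp (Mod_fm \<Phi> 0) (ExS 1 (And (Mod_fm \<Psi> 1) (at_xy \<sigma> 0 1)))))
    (And (AllS 0 (AllS 1 (AllS 3 (Imp
            (And (Mod_fm \<Phi> 0) (And (And (Mod_fm \<Psi> 1) (at_xy \<sigma> 0 1)) (And (Mod_fm \<Psi> 3) (at_xy \<sigma> 0 3))))
            (same_set_fm 1 3)))))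
         (AllS 0 (AllS 2 (AllS 1 (AllS 3 (Imp
            (And (And (Mod_fm \<Phi> 0) (And (Mod_fm \<Psi> 1) (at_xy \<sigma> 0 1)))
                 (And (Mod_fm \<Phi> 2) (And (Mod_fm \<Psi> 3) (at_xy \<sigma> 2 3))))
            (Iff (iso_fm (fst \<Phi>) 0 2) (iso_fm (fst \<Psi>) 1 3)))))))))"

section \<open>Forcing\<close>

text \<open>A forcing notion is a nonempty preordered set, smaller conditions being stronger. Every set of
  natural numbers in the forcing extension is the value of a nice name: a family assigning to each n
  a set of conditions, with n in the value for the generic filter G iff G meets the n-th set. For
  nice names, the following is the usual definition of the forcing relation, so that the set
  quantifiers of second-order arithmetic range over all reals of V[G].\<close>

definition forcing_notion :: "'p set \<Rightarrow> ('p \<Rightarrow> 'p \<Rightarrow> bool) \<Rightarrow> bool" where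
  "forcing_notion P le \<longleftrightarrow> P \<noteq> {} \<and> (\<forall>p\<in>P. le p p) \<and>
     (\<forall>p\<in>P. \<forall>q\<in>P. \<forall>r\<in>P. le p q \<and> le q r \<longrightarrow> le p r)"

type_synonym 'p nice_name = "nat \<Rightarrow> 'p set"

primrec forces :: "'p set \<Rightarrow> ('p \<Rightarrow> 'p \<Rightarrow> bool) \<Rightarrow> 'p \<Rightarrow>
    (nat \<Rightarrow> nat) \<Rightarrow> (nat \<Rightarrow> 'p nice_name) \<Rightarrow> fm \<Rightarrow> bool" where
  "forces P le p e X (Mem t i) = (\<forall>q\<in>P. le q p \<longrightarrow>
     (\<exists>r\<in>P. le r q \<and> (\<exists>s\<in>X i (tval e t). le r s)))"
| "forces P le p e X (Equal s t) = (tval e s = tval e t)"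
| "forces P le p e X (Neg \<phi>) = (\<forall>q\<in>P. le q p \<longrightarrow> \<not> forces P le q e X \<phi>)"
| "forces P le p e X (And \<phi> \<psi>) = (forces P le p e X \<phi> \<and> forces P le p e X \<psi>)"
| "forces P le p e X (BigAnd \<Phi>) = (\<forall>m. forces P le p e X (\<Phi> m))"
| "forces P le p e X (AllN i \<phi>) = (\<forall>n. forces P le p (e(i := n)) X \<phi>)"
| "forces P le p e X (AllS i \<phi>) =
     (\<forall>A. (\<forall>n. A n \<subseteq> P) \<longrightarrow> forces P le p e (X(i := A)) \<phi>)"

text \<open>Truth of a sentence in every extension by the forcing notion.\<close>

definition forced :: "'p set \<Rightarrow> ('p \<Rightarrow> 'p \<Rightarrow> bool) \<Rightarrow> fm \<Rightarrow> bool" where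
  "forced P le \<phi> \<longleftrightarrow> (\<forall>p\<in>P. forces P le p (\<lambda>_. 0) (\<lambda>_ _. {}) \<phi>)"

section \<open>Absolute $\Delta^1_2$ reducibility\<close>

definition aDelta12_reducible ::
  "('v \<Rightarrow> 'v \<Rightarrow> bool) \<Rightarrow> theory_sentence \<Rightarrow> theory_sentence \<Rightarrow> bool" where
  "aDelta12_reducible E \<Phi> \<Psi> \<longleftrightarrow> (\<exists>\<sigma> \<tau>.
     Pi12 \<sigma> \<and> formula_in_x_y \<sigma> \<and> Sigma12 \<tau> \<and> formula_in_x_y \<tau> \<and>
     (\<exists>f. (\<forall>M\<in>Mod \<Phi>. f M \<in> Mod \<Psi>) \<and>
        (\<forall>M\<in>Mod \<Phi>. \<forall>N\<in>Mod \<Psi>. (f M = N \<longleftrightarrow> sat2 \<sigma> M N) \<and> (f M = N \<longleftrightarrow> sat2 \<tau> M N)) \<and>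
        (\<forall>M\<in>Mod \<Phi>. \<forall>N\<in>Mod \<Phi>.
           isomorphic (fst \<Phi>) M N \<longleftrightarrow> isomorphic (fst \<Psi>) (f M) (f N))) \<and>
     (\<forall>P le. forcing_notion (members E P) le \<longrightarrow>
        forced (members E P) le (reduction_fm \<Phi> \<Psi> \<sigma> \<tau>)))"

section \<open>Adequacy of the encodings\<close>

text \<open>Read in V, the formulas that are forced above have their intended meaning (theorem
  sat_reduction_fm), and the models of the two theories are the graphs and the torsion-free abelian
  groups with universe the natural numbers.\<close>


lemma tval_numeral [simp]: "tval e (numeral_tm n) = n"
  by (induction n) auto

lemma tval_list [simp]: "tval e (list_tm ts) = list_encode (map (tval e) ts)"
  by (induction ts) auto

lemma tval_fact [simp]: "tval e (fact_tm r vs) = fact_code r (map e vs)"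
  by (simp add: fact_tm_def fact_code_def comp_def)

lemma sat_lfm_fm [simp]: "sat e X (lfm_fm s \<phi>) \<longleftrightarrow> lsat (X s) e \<phi>"
  by (induction \<phi> arbitrary: e) auto

primrec lfree :: "lfm \<Rightarrow> nat set" where
  "lfree (LRel r vs) = set vs"
| "lfree (LEq i j) = {i, j}"
| "lfree (LNeg \<phi>) = lfree \<phi>"
| "lfree (LConj \<Phi>) = (\<Union>m. lfree (\<Phi> m))"
| "lfree (LAll i \<phi>) = lfree \<phi> - {i}"

lemma lsat_cong: "(\<And>i. i \<in> lfree \<phi> \<Longrightarrow> e i = e' i) \<Longrightarrow> lsat M e \<phi> = lsat M e' \<phi>"
proof (induction \<phi> arbitrary: e e')
  case (LRel r vs)
  then have "map e vs = map e' vs" by auto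
  then show ?case by (simp only: lsat.simps)
next
  case (LAll i \<phi>)
  have "lsat M (e(i := a)) \<phi> = lsat M (e'(i := a)) \<phi>" for a
    using LAll.prems by (intro LAll.IH) auto
  then show ?case by simp
next
  case (LConj \<Phi>)
  have "lsat M e (\<Phi> m) = lsat M e' (\<Phi> m)" for m
    using LConj.prems by (intro LConj.IH) auto
  then show ?case by simp
next
  case (LNeg \<phi>)
  then show ?case by (metis lfree.simps(3) lsat.simps(3))
qed auto

lemma lfree_conn [simp]: "lfree (LAnd \<phi> \<psi>) = lfree \<phi> \<union> lfree \<psi>" "lfree (LImp \<phi> \<psi>) = lfree \<phi> \<union> lfree \<psi>" 
  "lfree (LEx i \<phi>) = lfree \<phi> - {i}"
proof -
  show "lfree (LAnd \<phi> \<psi>) = lfree \<phi> \<union> lfree \<psi>" for \<phi> \<psi> by (auto simp: LAnd_def split: if_splits)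
  then show "lfree (LImp \<phi> \<psi>) = lfree \<phi> \<union> lfree \<psi>" by (simp add: LImp_def)
qed (auto simp: LEx_def)

lemma lfree_zero: "lfree (IsZero i) = {i}" by (auto simp: IsZero_def Sum_def)

lemma lfree_mult: "j \<ge> 1 \<Longrightarrow> lfree (Multiple n j) \<subseteq> {0, j}"
proof (induction n arbitrary: j)
  case (Suc n)
  then have "lfree (Multiple n (Suc j)) \<subseteq> {0, Suc j}" by simp
  then show ?case by (auto simp: Sum_def)
qed (simp add: lfree_zero)

lemma lfree_TFAG: "lfree (snd TFAG) = {}"
proof -
  have "lfree (Multiple (Suc n) 1) \<subseteq> {0,1}" for n by (rule lfree_mult) simp
  then have "lfree (Multiple n 2) \<subseteq> {0,2}" for n by (metis lfree_mult one_le_numeral)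
  then show ?thesis by (fastforce simp: TFAG_def lfree_zero Sum_def numeral_eq_Suc)
qed

lemma lfree_Graphs: "lfree (snd Graphs) = {}" by (auto simp: Graphs_def)

lemma sat_Mod_fm:
  assumes "lfree (snd T) = {}"
  shows "sat e X (Mod_fm T s) \<longleftrightarrow> X s \<in> Mod T"
proof -
  have "lsat (X s) e (snd T) = lsat (X s) (\<lambda>_. 0) (snd T)" using assms by (intro lsat_cong) auto
  moreover have "(\<forall>m. sat e X (if m \<in> fact_codes (fst T) then Truth else Neg (Mem (numeral_tm m) s))) \<longleftrightarrow> X s \<subseteq> fact_codes (fst T)"
    by (auto split: if_splits)
  ultimately show ?thesis by (simp add: Mod_fm_def Mod_def)
qed

lemma sat_foldr_AllN:
  "sat e X (foldr AllN vs \<phi>) \<longleftrightarrow> (\<forall>e'. (\<forall>i. i \<notin> set vs \<longrightarrow> e' i = e i) \<longrightarrow> sat e' X \<phi>)"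
proof (induction vs arbitrary: e)
  case Nil
  have "e' = e" if "\<forall>i. e' i = e i" for e' using that by auto
  then show ?case by auto
next
  case (Cons v vs)
  show ?case
  proof
    assume L: "sat e X (foldr AllN (v # vs) \<phi>)"
    show "\<forall>e'. (\<forall>i. i \<notin> set (v # vs) \<longrightarrow> e' i = e i) \<longrightarrow> sat e' X \<phi>"
    proof (intro allI impI)
      fix e' assume a: "\<forall>i. i \<notin> set (v # vs) \<longrightarrow> e' i = e i"
      have "sat (e(v := e' v)) X (foldr AllN vs \<phi>)" using L by simp
      then show "sat e' X \<phi>" unfolding Cons.IH using a by auto
    qed
  next
    assume "\<forall>e'. (\<forall>i. i \<notin> set (v # vs) \<longrightarrow> e' i = e i) \<longrightarrow> sat e' X \<phi>"
    then show "sat e X (foldr AllN (v # vs) \<phi>)" by (auto simp: Cons.IH)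
  qed
qed

lemma sat_foldr_And:
  "sat e X (foldr (\<lambda>i. And (f i)) vs Truth) \<longleftrightarrow> (\<forall>i\<in>set vs. sat e X (f i))"
  by (induction vs) auto

lemma sat_preserve:
  fixes X :: "nat \<Rightarrow> nat set" shows
  "sat e X (preserve_fm r k s t z) \<longleftrightarrow>
    (\<forall>(xs::nat list) (ys::nat list). length xs = k \<and> length ys = k \<and> (\<forall>i<k. prod_encode (xs!i, ys!i) \<in> X z) \<longrightarrow>
     (fact_code r xs \<in> X s \<longleftrightarrow> fact_code r ys \<in> X t))" (is "?L \<longleftrightarrow> ?R")
proof
  assume L: ?L
  show ?R
  proof (intro allI impI, elim conjE)
    fix xs ys :: "nat list" assume l: "length xs = k" "length ys = k" "\<forall>i<k. prod_encode (xs!i, ys!i) \<in> X z"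
    define e' where "e' i = (if i < 2*k then (xs@ys) ! i else e i)" for i
    have m: "map e' [0..<k] = xs" "map e' [k..<2*k] = ys"
      using l by (auto intro!: nth_equalityI simp: e'_def nth_append)
    have a: "e' i = xs ! i" "e' (k+i) = ys ! i" if "i < k" for i using that l by (auto simp: e'_def nth_append)
    have "\<forall>i. i \<notin> set [0..<2*k] \<longrightarrow> e' i = e i" by (auto simp: e'_def)
    with L have "sat e' X (Imp (foldr (\<lambda>i. And (Mem (PairT (NVar i) (NVar (k + i))) z)) [0..<k] Truth)
          (Iff (Mem (fact_tm r [0..<k]) s) (Mem (fact_tm r [k..<2 * k]) t)))"
      unfolding preserve_fm_def sat_foldr_AllN by blast
    then show "fact_code r xs \<in> X s \<longleftrightarrow> fact_code r ys \<in> X t"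
      unfolding sat_connectives sat_foldr_And sat.simps tval_fact m using l(3) a by simp
  qed
next
  assume R: ?R
  show ?L unfolding preserve_fm_def sat_foldr_AllN
  proof (intro allI impI)
    fix e' :: "nat \<Rightarrow> nat"
    have m: "map e' [0..<k] ! i = e' i" "map e' [k..<2*k] ! i = e' (k+i)" if "i < k" for i using that by auto
    show "sat e' X (Imp (foldr (\<lambda>i. And (Mem (PairT (NVar i) (NVar (k + i))) z)) [0..<k] Truth)
          (Iff (Mem (fact_tm r [0..<k]) s) (Mem (fact_tm r [k..<2 * k]) t)))"
      unfolding sat_connectives sat_foldr_And sat.simps tval_fact tval.simps
    proof
      assume h: "\<forall>i\<in>set [0..<k]. prod_encode (e' i, e' (k + i)) \<in> X z"
      show "(fact_code r (map e' [0..<k]) \<in> X s) = (fact_code r (map e' [k..<2 * k]) \<in> X t)"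
        by (rule R[rule_format]) (use h m in \<open>auto simp del: nth_map nth_map_upt\<close>)
    qed
  qed
qed

lemma sat_bij: "sat e X (bij_fm z) \<longleftrightarrow> (\<exists>\<pi>. bij \<pi> \<and> (\<forall>a b. prod_encode (a,b) \<in> X z \<longleftrightarrow> b = \<pi> a))"
proof
  assume "sat e X (bij_fm z)"
  then have 1: "\<forall>a. \<exists>b. prod_encode (a,b) \<in> X z" and 2: "\<forall>a b c. prod_encode (a,b) \<in> X z \<and> prod_encode (a,c) \<in> X z \<longrightarrow> b = c"
   and 3: "\<forall>b. \<exists>a. prod_encode (a,b) \<in> X z" and 4: "\<forall>a b c. prod_encode (a,c) \<in> X z \<and> prod_encode (b,c) \<in> X z \<longrightarrow> a = b"
    by (simp_all add: bij_fm_def Let_def)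
  from 1 obtain \<pi> where pi: "\<forall>a. prod_encode (a, \<pi> a) \<in> X z" by metis
  have "bij \<pi>" by (metis 2 3 4 pi bij_def injI surjI surj_def)
  with pi 2 show "\<exists>\<pi>. bij \<pi> \<and> (\<forall>a b. prod_encode (a,b) \<in> X z \<longleftrightarrow> b = \<pi> a)" by blast
next
  assume "\<exists>\<pi>. bij \<pi> \<and> (\<forall>a b. prod_encode (a,b) \<in> X z \<longleftrightarrow> b = \<pi> a)"
  then show "sat e X (bij_fm z)" unfolding bij_fm_def Let_def by (simp add: bij_def inj_def surj_def) metis
qed

lemma sat_iso: "sat e X (iso_fm L s t) \<longleftrightarrow> isomorphic L (X s) (X t)"
proof -
  define z where "z = s + t + 1"
  have z: "z \<noteq> s" "z \<noteq> t" by (auto simp: z_def)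
  have big: "sat e (X(z:=A)) (BigAnd (\<lambda>m. case prod_decode m of (r, k) \<Rightarrow>
        if (r, k) \<in> L then preserve_fm r k s t z else Truth)) \<longleftrightarrow>
      (\<forall>r k. (r,k) \<in> L \<longrightarrow> sat e (X(z:=A)) (preserve_fm r k s t z))" for A
  proof -
    have "(\<forall>m. P (prod_decode m)) \<longleftrightarrow> (\<forall>p. P p)" for P by (metis prod_encode_inverse)
    note this[of "\<lambda>p. sat e (X(z:=A)) (case p of (r, k) \<Rightarrow>
        if (r, k) \<in> L then preserve_fm r k s t z else Truth)"]
    then show ?thesis by simp
  qed
  show ?thesis
  proof
    assume "sat e X (iso_fm L s t)"
    then obtain A where B: "sat e (X(z:=A)) (bij_fm z)" and C: "\<forall>r k. (r,k) \<in> L \<longrightarrow> sat e (X(z:=A)) (preserve_fm r k s t z)"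
      unfolding iso_fm_def Let_def z_def[symmetric] sat_connectives sat.simps(4) big by blast
    from B obtain \<pi> where p: "bij \<pi>" "\<forall>a b. prod_encode (a,b) \<in> A \<longleftrightarrow> b = \<pi> a" by (auto simp: sat_bij)
    have "\<forall>r k. (r,k) \<in> L \<longrightarrow> (\<forall>xs. length xs = k \<longrightarrow> (fact_code r xs \<in> X s \<longleftrightarrow> fact_code r (map \<pi> xs) \<in> X t))"
    proof (intro allI impI)
      fix r k and xs :: "nat list" assume rk: "(r,k) \<in> L" "length xs = (k::nat)"
      have "sat e (X(z:=A)) (preserve_fm r k s t z)" using C rk by blast
      from this[unfolded sat_preserve fun_upd_same p(2)[rule_format], rule_format, of xs "map \<pi> xs"] rk z
      show "fact_code r xs \<in> X s \<longleftrightarrow> fact_code r (map \<pi> xs) \<in> X t" by simp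
    qed
    with p(1) show "isomorphic L (X s) (X t)" by (auto simp: isomorphic_def)
  next
    assume "isomorphic L (X s) (X t)"
    then obtain \<pi> where p: "bij \<pi>" and q: "\<forall>r xs. (r, length xs) \<in> L \<longrightarrow> (fact_code r xs \<in> X s \<longleftrightarrow> fact_code r (map \<pi> xs) \<in> X t)"
      by (auto simp: isomorphic_def)
    define A where "A = {prod_encode (a, \<pi> a) | a. True}"
    have a: "prod_encode (a,b) \<in> A \<longleftrightarrow> b = \<pi> a" for a b by (auto simp: A_def)
    have "\<forall>r k. (r,k) \<in> L \<longrightarrow> sat e (X(z:=A)) (preserve_fm r k s t z)"
    proof (intro allI impI)
      fix r k assume rk: "(r,k) \<in> L"
      show "sat e (X(z:=A)) (preserve_fm r k s t z)" unfolding sat_preserve fun_upd_same a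
      proof (intro allI impI)
        fix xs ys :: "nat list" assume l: "length xs = k \<and> length ys = k \<and> (\<forall>i<k. ys!i = \<pi> (xs!i))"
        then have "ys = map \<pi> xs" by (auto intro: nth_equalityI)
        then show "(fact_code r xs \<in> (X(z:=A)) s) = (fact_code r ys \<in> (X(z:=A)) t)" using z q rk l by auto
      qed
    qed
    moreover have "sat e (X(z:=A)) (bij_fm z)" using p a by (auto simp: sat_bij)
    ultimately show "sat e X (iso_fm L s t)" 
      unfolding iso_fm_def Let_def z_def[symmetric] sat_connectives sat.simps(4) big by blast
  qed
qed

lemma sat_rename: "inj f \<Longrightarrow> sat e X (rename f \<phi>) \<longleftrightarrow> sat e (X \<circ> f) \<phi>"
proof (induction \<phi> arbitrary: e X)
  case (AllS i \<phi>)
  have "X(f i := A) \<circ> f = (X \<circ> f)(i := A)" for A using AllS.prems by (auto simp: inj_def fun_eq_iff)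
  with AllS show ?case by (simp only: rename.simps sat.simps)
qed auto

lemma tval_cong: "(\<And>i. i \<in> tvars t \<Longrightarrow> e i = e' i) \<Longrightarrow> tval e t = tval e' t"
  by (induction t) auto

lemma sat_cong: "(\<And>i. i \<in> free_num \<phi> \<Longrightarrow> e i = e' i) \<Longrightarrow> (\<And>i. i \<in> free_set \<phi> \<Longrightarrow> X i = X' i) \<Longrightarrow> sat e X \<phi> = sat e' X' \<phi>"
proof (induction \<phi> arbitrary: e e' X X')
  case (Mem t i) then show ?case using tval_cong[of t e e'] by simp
next
  case (Equal s t) then show ?case using tval_cong[of t e e'] tval_cong[of s e e'] by simp
next
  case (Neg \<phi>) then show ?case by (metis free_num.simps(3) free_set.simps(3) sat.simps(3))
next
  case (And \<phi> \<psi>)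
  have "sat e X \<phi> = sat e' X' \<phi>" "sat e X \<psi> = sat e' X' \<psi>"
    using And.prems by (auto intro!: And.IH)
  then show ?case by simp
next
  case (BigAnd \<Phi>)
  have "sat e X (\<Phi> m) = sat e' X' (\<Phi> m)" for m
    using BigAnd.prems by (intro BigAnd.IH) auto
  then show ?case by simp
next
  case (AllN i \<phi>)
  have "sat (e(i := a)) X \<phi> = sat (e'(i := a)) X' \<phi>" for a
    using AllN.prems by (intro AllN.IH) auto
  then show ?case by simp
next
  case (AllS i \<phi>)
  have "sat e (X(i := a)) \<phi> = sat e' (X'(i := a)) \<phi>" for a
    using AllS.prems by (intro AllS.IH) auto
  then show ?case by simp
qed

lemma sat_at_xy:
  assumes "formula_in_x_y \<phi>" "i \<noteq> j"
  shows "sat e X (at_xy \<phi> i j) \<longleftrightarrow> sat2 \<phi> (X i) (X j)"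
proof -
  have "inj (\<lambda>n. if n = 0 then i else if n = 1 then j else n + i + j)"
    using assms(2) by (auto simp: inj_def)
  then show ?thesis unfolding at_xy_def sat2_def using assms(1)
    by (subst sat_rename, simp) (rule sat_cong, auto simp: formula_in_x_y_def)
qed

theorem sat_reduction_fm:
  assumes "formula_in_x_y \<sigma>" "formula_in_x_y \<tau>" "lfree (snd \<Phi>) = {}" "lfree (snd \<Psi>) = {}"
  shows "sat e X (reduction_fm \<Phi> \<Psi> \<sigma> \<tau>) \<longleftrightarrow>
   (\<exists>f. (\<forall>M\<in>Mod \<Phi>. f M \<in> Mod \<Psi>) \<and>
        (\<forall>M\<in>Mod \<Phi>. \<forall>N\<in>Mod \<Psi>. (f M = N \<longleftrightarrow> sat2 \<sigma> M N) \<and> (f M = N \<longleftrightarrow> sat2 \<tau> M N)) \<and>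
        (\<forall>M\<in>Mod \<Phi>. \<forall>N\<in>Mod \<Phi>.
           isomorphic (fst \<Phi>) M N \<longleftrightarrow> isomorphic (fst \<Psi>) (f M) (f N)))" (is "_ \<longleftrightarrow> ?R")
proof -
  have ss: "(\<forall>n. n \<in> A \<longleftrightarrow> n \<in> B) \<longleftrightarrow> A = B" for A B :: "nat set" by auto
  have "sat e X (reduction_fm \<Phi> \<Psi> \<sigma> \<tau>) \<longleftrightarrow>
    (\<forall>x y. x \<in> Mod \<Phi> \<and> y \<in> Mod \<Psi> \<longrightarrow> (sat2 \<sigma> x y \<longleftrightarrow> sat2 \<tau> x y)) \<and>
    (\<forall>x. x \<in> Mod \<Phi> \<longrightarrow> (\<exists>y. y \<in> Mod \<Psi> \<and> sat2 \<sigma> x y)) \<and>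
    (\<forall>x y y'. x \<in> Mod \<Phi> \<and> (y \<in> Mod \<Psi> \<and> sat2 \<sigma> x y) \<and> y' \<in> Mod \<Psi> \<and> sat2 \<sigma> x y' \<longrightarrow> y = y') \<and>
    (\<forall>x x' y y'. (x \<in> Mod \<Phi> \<and> y \<in> Mod \<Psi> \<and> sat2 \<sigma> x y) \<and> (x' \<in> Mod \<Phi> \<and> y' \<in> Mod \<Psi> \<and> sat2 \<sigma> x' y')
        \<longrightarrow> (isomorphic (fst \<Phi>) x x' \<longleftrightarrow> isomorphic (fst \<Psi>) y y'))" (is "_ \<longleftrightarrow> ?S")
    unfolding reduction_fm_def using assms
    by (simp add: sat_at_xy sat_Mod_fm sat_iso same_set_fm_def ss)
  also have "?S \<longleftrightarrow> ?R"
  proof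
    assume S: ?S
    note S1' = conjunct1[OF S] and S2' = conjunct1[OF conjunct2[OF S]] and S3' = conjunct1[OF conjunct2[OF conjunct2[OF S]]]
      and S4' = conjunct2[OF conjunct2[OF conjunct2[OF S]]]
    have S1: "sat2 \<sigma> x y \<longleftrightarrow> sat2 \<tau> x y" if "x \<in> Mod \<Phi>" "y \<in> Mod \<Psi>" for x y using S1' that by simp
    have S3: "y = y'" if "x \<in> Mod \<Phi>" "y \<in> Mod \<Psi>" "sat2 \<sigma> x y" "y' \<in> Mod \<Psi>" "sat2 \<sigma> x y'" for x y y' by (rule S3'[rule_format, of x]) (simp add: that)
    have S4: "isomorphic (fst \<Phi>) x x' \<longleftrightarrow> isomorphic (fst \<Psi>) y y'" if "x \<in> Mod \<Phi>" "y \<in> Mod \<Psi>" "sat2 \<sigma> x y"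
      "x' \<in> Mod \<Phi>" "y' \<in> Mod \<Psi>" "sat2 \<sigma> x' y'" for x x' y y' by (rule S4'[rule_format]) (simp add: that)
    have "\<forall>x. \<exists>y. x \<in> Mod \<Phi> \<longrightarrow> y \<in> Mod \<Psi> \<and> sat2 \<sigma> x y" using S2' by simp
    then obtain f where f: "\<And>x. x \<in> Mod \<Phi> \<Longrightarrow> f x \<in> Mod \<Psi>" "\<And>x. x \<in> Mod \<Phi> \<Longrightarrow> sat2 \<sigma> x (f x)" by metis
    have g: "f x = y \<longleftrightarrow> sat2 \<sigma> x y" if "x \<in> Mod \<Phi>" "y \<in> Mod \<Psi>" for x y
      using S3[OF that(1) f(1)[OF that(1)] f(2)[OF that(1)], of y] f(2)[OF that(1)] that(2) by metis
    have S4f: "\<forall>M\<in>Mod \<Phi>. \<forall>N\<in>Mod \<Phi>. isomorphic (fst \<Phi>) M N \<longleftrightarrow> isomorphic (fst \<Psi>) (f M) (f N)"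
      by (intro ballI S4 f)
    show ?R by (rule exI[of _ f], intro conjI, simp add: f, simp add: f g S1, rule S4f)
  next
    assume ?R
    then obtain f where f: "(\<forall>M\<in>Mod \<Phi>. f M \<in> Mod \<Psi>) \<and>
        (\<forall>M\<in>Mod \<Phi>. \<forall>N\<in>Mod \<Psi>. (f M = N \<longleftrightarrow> sat2 \<sigma> M N) \<and> (f M = N \<longleftrightarrow> sat2 \<tau> M N)) \<and>
        (\<forall>M\<in>Mod \<Phi>. \<forall>N\<in>Mod \<Phi>.
           isomorphic (fst \<Phi>) M N \<longleftrightarrow> isomorphic (fst \<Psi>) (f M) (f N))" ..
    note f1 = conjunct1[OF f] and f2 = conjunct1[OF conjunct2[OF f]] and f3 = conjunct2[OF conjunct2[OF f]]
    have g: "sat2 \<sigma> x y \<longleftrightarrow> y = f x" "sat2 \<tau> x y \<longleftrightarrow> y = f x" if "x \<in> Mod \<Phi>" "y \<in> Mod \<Psi>" for x y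
      using f2 that by auto
    show ?S
    proof (intro conjI allI impI)
      fix x assume "x \<in> Mod \<Phi>" then show "\<exists>y. y \<in> Mod \<Psi> \<and> sat2 \<sigma> x y" using f1 g(1) by auto
    next
      fix x x' y y' assume "(x \<in> Mod \<Phi> \<and> y \<in> Mod \<Psi> \<and> sat2 \<sigma> x y) \<and> x' \<in> Mod \<Phi> \<and> y' \<in> Mod \<Psi> \<and> sat2 \<sigma> x' y'"
      then have "x \<in> Mod \<Phi>" "x' \<in> Mod \<Phi>" "y = f x" "y' = f x'" using g(1)[of x y] g(1)[of x' y'] by blast+
      then show "isomorphic (fst \<Phi>) x x' \<longleftrightarrow> isomorphic (fst \<Psi>) y y'" using f3 by simp
    next
      fix x y y' assume "x \<in> Mod \<Phi> \<and> (y \<in> Mod \<Psi> \<and> sat2 \<sigma> x y) \<and> y' \<in> Mod \<Psi> \<and> sat2 \<sigma> x y'"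
      then have "y = f x" "y' = f x" using g(1)[of x y] g(1)[of x y'] by blast+
      then show "y = y'" by simp
    qed (use g in simp_all)
  qed
  finally show ?thesis .
qed

lemma Graphs_char:
  "M \<in> Mod Graphs \<longleftrightarrow> (\<exists>G. irreflp G \<and> symp G \<and> M = {fact_code 0 [a, b] | a b. G a b})"
proof
  have inj: "fact_code 0 [a,b] = fact_code 0 [c,d] \<longleftrightarrow> a = c \<and> b = d" for a b c d
    by (simp add: fact_code_def)
  assume m: "M \<in> Mod Graphs"
  define G where "G a b \<longleftrightarrow> fact_code 0 [a,b] \<in> M" for a b
  have "irreflp G" "symp G" using m by (auto simp: Mod_def Graphs_def G_def irreflp_def symp_def)
  moreover have "M = {fact_code 0 [a, b] | a b. G a b}"
  proof (intro set_eqI iffI)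
    fix m' assume mm: "m' \<in> M"
    then obtain xs where "m' = fact_code 0 xs" "length xs = 2" using m by (auto simp: Mod_def Graphs_def fact_codes_def)
    then show "m' \<in> {fact_code 0 [a, b] | a b. G a b}" using mm by (auto simp: G_def length_Suc_conv numeral_2_eq_2)
  qed (auto simp: G_def)
  ultimately show "\<exists>G. irreflp G \<and> symp G \<and> M = {fact_code 0 [a, b] | a b. G a b}" by blast
next
  assume "\<exists>G. irreflp G \<and> symp G \<and> M = {fact_code 0 [a, b] | a b. G a b}"
  then obtain G where G: "irreflp G" "symp G" "M = {fact_code 0 [a, b] | a b. G a b}" by blast
  have S: "fact_code 0 [a,b] \<in> M \<longleftrightarrow> G a b" for a b by (auto simp: G(3) fact_code_def)
  have "M \<subseteq> fact_codes (fst Graphs)" by (auto simp: G(3) fact_codes_def Graphs_def)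
  then show "M \<in> Mod Graphs" using G(1,2) by (simp add: Mod_def Graphs_def S irreflp_def symp_def)
qed

lemma TFAG_char:
  "M \<in> Mod TFAG \<longleftrightarrow> (\<exists>add z. 
     (\<forall>a b c. add (add a b) c = add a (add b c)) \<and> (\<forall>a b. add a b = add b a) \<and>
     (\<forall>a. add a z = a) \<and> (\<forall>a. \<exists>b. add a b = z) \<and>
     (\<forall>n a. ((\<lambda>x. add x a) ^^ Suc n) z = z \<longrightarrow> a = z) \<and>
     M = {fact_code 0 [a, b, add a b] | a b. True})" (is "_ \<longleftrightarrow> ?R")
proof -
  let ?S = "\<lambda>a b c. fact_code 0 [a,b,c] \<in> M"
  have inj: "fact_code 0 [a,b,x] = fact_code 0 [c,d,y] \<longleftrightarrow> a = c \<and> b = d \<and> x = y" for a b c d x y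
    by (simp add: fact_code_def)
  have Z: "lsat M e (IsZero i) \<longleftrightarrow> (\<forall>u. ?S (e i) u u)" for e i by (simp add: IsZero_def Sum_def)
  have mult: "lsat M e (Multiple n j) \<longleftrightarrow> e j = ((\<lambda>x. add x (e 0)) ^^ n) z"
    if "\<And>a b c. ?S a b c \<longleftrightarrow> c = add a b" "\<And>y. (\<forall>u. add y u = u) \<longleftrightarrow> y = z" "j \<ge> 1" for add z e n j
    using that(3)
  proof (induction n arbitrary: j e)
    case 0 have "lsat M e (Multiple 0 j) \<longleftrightarrow> (\<forall>u. add (e j) u = u)" by (simp add: Z that(1)) metis
    then show ?case using that(2) by simp
  next
    case (Suc n) then show ?case by (simp add: Sum_def that(1))
  qed
  have expand: "lsat M (\<lambda>_. 0) (snd TFAG) \<longleftrightarrow>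
     (\<forall>a b. \<exists>c. ?S a b c) \<and> (\<forall>a b c d. ?S a b c \<and> ?S a b d \<longrightarrow> c = d) \<and>
     (\<forall>a b c d e f. ?S a b d \<and> ?S d c e \<and> ?S b c f \<longrightarrow> ?S a f e) \<and>
     (\<forall>a b c. ?S a b c \<longrightarrow> ?S b a c) \<and>
     (\<exists>z. (\<forall>u. ?S z u u) \<and> (\<forall>a. \<exists>b. ?S a b z)) \<and>
     (\<forall>n a y. (\<forall>u. ?S y u u) \<and> lsat M ((\<lambda>_. 0)(0 := a, 1 := y)) (Multiple (Suc n) 1) \<longrightarrow> a = y)"
    unfolding TFAG_def snd_conv lsat_connectives lsat.simps
    by (simp add: Sum_def Z del: Multiple.simps One_nat_def)
  have mult': "lsat M ((\<lambda>_. 0)(0 := a, 1 := y)) (Multiple (Suc n) 1) \<longleftrightarrow> y = ((\<lambda>x. add x a) ^^ Suc n) z"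
    if "\<And>a b c. ?S a b c \<longleftrightarrow> c = add a b" "\<And>y. (\<forall>u. add y u = u) \<longleftrightarrow> y = z" for add z a y n
    using mult[OF that, where n = "Suc n" and j = 1 and e = "(\<lambda>_. 0)(0 := a, 1 := y)"] by simp
  show ?thesis
  proof
    assume m: "M \<in> Mod TFAG"
    then have L: "lsat M (\<lambda>_. 0) (snd TFAG)" unfolding Mod_def by blast
    note E = L[unfolded expand]
    note E1 = conjunct1[OF E] and e2 = conjunct2[OF E]
    note E2 = conjunct1[OF e2] and e3 = conjunct2[OF e2]
    note E3 = conjunct1[OF e3] and e4 = conjunct2[OF e3]
    note E4 = conjunct1[OF e4] and e5 = conjunct2[OF e4]
    note E5 = conjunct1[OF e5] and E6 = conjunct2[OF e5]
    define add where "add a b = (SOME c. ?S a b c)" for a b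
    have add1: "?S a b (add a b)" for a b unfolding add_def by (rule someI_ex) (use E1 in blast)
    have fn: "?S a b c \<Longrightarrow> ?S a b d \<Longrightarrow> c = d" for a b c d
      using E2 by blast
    have S: "?S a b c \<longleftrightarrow> c = add a b" for a b c using add1 fn by blast
    have C: "add a b = add b a" for a b using E4[unfolded S] by metis
    have A: "add (add a b) c = add a (add b c)" for a b c using E3[unfolded S] by metis
    from E5[unfolded S] have "\<exists>z. (\<forall>u. u = add z u) \<and> (\<forall>a. \<exists>b. z = add a b)" by blast
    then obtain z where z0: "\<forall>u. u = add z u" "\<forall>a. \<exists>b. z = add a b" by blast
    have z: "add z u = u" "\<exists>b. add a b = z" for u a using z0 by metis+
    have u: "(\<forall>u. add y u = u) \<longleftrightarrow> y = z" for y using z(1) C by metis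
    have T: "a = z" if "((\<lambda>x. add x a) ^^ Suc n) z = z" for n a
    proof -
      have "lsat M ((\<lambda>_. 0)(0 := a, 1 := z)) (Multiple (Suc n) 1)" using that by (simp only: mult'[OF S u])
      moreover have "\<forall>u. ?S z u u" using z S by simp
      ultimately show "a = z" using E6 by blast
    qed
    have Meq: "M = {fact_code 0 [a, b, add a b] | a b. True}"
    proof (intro set_eqI iffI)
      fix m' assume mm: "m' \<in> M"
      then obtain xs where "m' = fact_code 0 xs" "length xs = 3" using m by (auto simp: Mod_def TFAG_def fact_codes_def)
      then obtain a b c where "m' = fact_code 0 [a,b,c]" by (auto simp: length_Suc_conv numeral_3_eq_3)
      then show "m' \<in> {fact_code 0 [a, b, add a b] | a b. True}" using mm S[of a b c] by auto
    qed (use add1 in blast)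
    have Z': "add a z = a" for a using z C by metis
    show ?R by (rule exI[of _ add], rule exI[of _ z], intro conjI allI impI, rule A, rule C, rule Z', rule z, erule T, rule Meq)
  next
    assume ?R
    then obtain add z where R: 
     "\<forall>a b c. add (add a b) c = add a (add b c)" "\<forall>a b. add a b = add b a"
     "\<forall>a. add a z = a" "\<forall>a. \<exists>b. add a b = z"
     "\<forall>n a. ((\<lambda>x. add x a) ^^ Suc n) z = z \<longrightarrow> a = z" and M: "M = {fact_code 0 [a, b, add a b] | a b. True}" by (elim exE conjE) 
    have S: "?S a b c \<longleftrightarrow> c = add a b" for a b c unfolding M by (auto simp: inj)
    have u: "(\<forall>u. add y u = u) \<longleftrightarrow> y = z" for y using R(2,3) by metis
    have F: "M \<subseteq> fact_codes (fst TFAG)" unfolding M by (auto simp: fact_codes_def TFAG_def)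
    have "lsat M (\<lambda>_. 0) (snd TFAG)" unfolding expand
    proof (intro conjI)
      show "\<exists>z. (\<forall>u. ?S z u u) \<and> (\<forall>a. \<exists>b. ?S a b z)"
        unfolding S by (rule exI[of _ z]) (use R(2,3,4) in metis)
      show "\<forall>n a y. (\<forall>u. ?S y u u) \<and> lsat M ((\<lambda>_. 0)(0 := a, 1 := y)) (Multiple (Suc n) 1) \<longrightarrow> a = y"
      proof (intro allI impI, elim conjE)
        fix n a y assume "\<forall>u. ?S y u u" "lsat M ((\<lambda>_. 0)(0 := a, 1 := y)) (Multiple (Suc n) 1)"
        then have "y = z" "y = ((\<lambda>x. add x a) ^^ Suc n) z" using u[of y] by (simp_all only: S mult'[OF S u]; metis)+
        then show "a = y" using R(5) by metis
      qed
    qed (use R(1,2) in \<open>simp_all add: S\<close>)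
    then show "M \<in> Mod TFAG" unfolding Mod_def using F by blast
  qed
qed
end

theory Submission
  imports Defs Complex_Main "HOL-Number_Theory.Cong" "HOL-Computational_Algebra.Primes"
    "HOL-Library.Infinite_Set" "HOL-Library.Countable_Set"
begin

text \<open>A graph x is turned into a subgroup \<open>gr x\<close> of a rational vector space by prescribing, for each
  prime p, the subspace of elements divisible by all powers of p. Let F be the free group on the pairs of
  natural numbers, each generator acting on the natural numbers as the transposition of its pair. For
  every level n the basis contains two copies of F; the divisibility of suitable diagonal subspaces makes an
  isomorphism commute with left translation by F on them. As the group ring of F over the rationals has
  only trivial units (F has unique products), the isomorphism is a multiple of right
  translation by some word \<open>g n\<close>. Further basis elements \<open>Ep a b\<close> carry the edge relation and are
  identified, modulo a divisible subspace depending on n, with the pair (a, b) on which level n acts. Since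
  elements have finite support, \<open>Ep a b\<close> is seen correctly by all but finitely many levels, so the
  permutations induced by the words \<open>g n\<close> converge pointwise to a graph isomorphism. Conversely, words
  approximating a graph isomorphism on longer and longer initial segments induce a group isomorphism.

  The reduction is arithmetical, and both translations of isomorphisms are Borel. Every
  condition lies in a filter that is generic enough to decide countably many formulas without set
  quantifiers, and Borel functions act on names. Hence what holds in V for these formulas is forced.\<close>

text \<open>An isomorphism of the bare groups must respect divisibility by all powers of a prime,
  and different primes make it respect countably many chosen subspaces at once. What commutes with
  left translations is right multiplication by a unit of the group ring, so the acting group needs a
  group ring with trivial units. The finitary permutation group itself would not do: it has torsion,
  and then nontrivial rational units exist. Hence the free group mapped onto it. A word moves only
  finitely many numbers, so one level could never carry an arbitrary graph isomorphism. Infinitely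
  many levels, linked only through the elements \<open>Ep a b\<close>, can: finite support forces
  agreement on late levels, while disagreement on early levels is absorbed by finitely many
  corrections. For forcing, the obstacle is that no filter in V is generic for all formulas, and set
  quantifiers range over all names. The only genuine set quantifiers are those asserting
  isomorphism, and there a witness on one side is computed from a witness on the other by a Borel
  function, so only countably many dense sets matter at a time.\<close>

abbreviation pair :: "nat \<Rightarrow> nat \<Rightarrow> nat" where
  "pair a b \<equiv> prod_encode (a, b)"

section \<open>The free group acting on the natural numbers\<close>

text \<open>Words are written in numbers: the letters \<open>2 * m\<close> and
  \<open>2 * m + 1\<close> are the generator with index m and its inverse.\<close>

definition linv :: "nat \<Rightarrow> nat" where
  "linv l = (if even l then Suc l else l - 1)"

lemma linv_linv [simp]: "linv (linv l) = l"
  by (auto simp: linv_def)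

lemma linv_neq [simp]: "linv l \<noteq> l" "l \<noteq> linv l"
  by (auto simp: linv_def elim: oddE)

lemma linv_div_2 [simp]: "linv l div 2 = l div 2"
  by (auto simp: linv_def elim!: oddE)

definition reduced :: "nat list \<Rightarrow> bool" where
  "reduced w = successively (\<lambda>a b. b \<noteq> linv a) w"

definition lmul :: "nat \<Rightarrow> nat list \<Rightarrow> nat list" where
  "lmul a w = (case w of [] \<Rightarrow> [a] | b # w' \<Rightarrow> if b = linv a then w' else a # w)"

text \<open>The left factor need not be reduced: only reducedness of the right factor matters for
  the result to be reduced. In particular \<open>wmul w []\<close> is the reduced form of an
  arbitrary word.\<close>

definition wmul :: "nat list \<Rightarrow> nat list \<Rightarrow> nat list" where
  "wmul v w = foldr lmul v w"

definition winv :: "nat list \<Rightarrow> nat list" where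
  "winv w = rev (map linv w)"

lemma wmul_simps [simp]: "wmul [] w = w" "wmul (a # v) w = lmul a (wmul v w)"
  by (auto simp: wmul_def)

lemma wmul_append: "wmul (u @ v) w = wmul u (wmul v w)"
  by (simp add: wmul_def)

lemma winv_Nil [simp]: "winv [] = []" and winv_Cons: "winv (a # w) = winv w @ [linv a]"
  by (auto simp: winv_def)

lemma winv_winv [simp]: "winv (winv w) = w"
  by (simp add: winv_def rev_map[symmetric] comp_def)

lemma length_winv [simp]: "length (winv w) = length w"
  by (simp add: winv_def)

lemma reduced_Nil [simp]: "reduced []" and reduced_single [simp]: "reduced [a]"
  by (auto simp: reduced_def)

lemma reduced_Cons: "reduced (a # w) \<longleftrightarrow> reduced w \<and> (\<forall>b w'. w = b # w' \<longrightarrow> b \<noteq> linv a)"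
  by (cases w) (auto simp: reduced_def)

lemma reduced_append:
  "reduced (v @ w) \<longleftrightarrow> reduced v \<and> reduced w \<and> (v \<noteq> [] \<longrightarrow> w \<noteq> [] \<longrightarrow> hd w \<noteq> linv (last v))"
  by (auto simp: reduced_def successively_append_iff)

lemma reduced_winv: "reduced w \<Longrightarrow> reduced (winv w)"
proof (induction w)
  case (Cons a w)
  then have "reduced (winv w)" by (simp add: reduced_Cons)
  moreover have "hd [linv a] \<noteq> linv (last (winv w))" if "winv w \<noteq> []"
    using Cons.prems that by (cases w) (auto simp: winv_def reduced_Cons)
  ultimately show ?case by (auto simp: winv_Cons reduced_append)
qed simp

lemma lmul_Cons [simp]: "reduced (a # w) \<Longrightarrow> lmul a w = a # w"
  by (auto simp: lmul_def reduced_Cons split: list.split)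

lemma reduced_lmul: "reduced w \<Longrightarrow> reduced (lmul a w)"
  by (cases w) (auto simp: lmul_def reduced_Cons)

lemma reduced_wmul: "reduced w \<Longrightarrow> reduced (wmul v w)"
  by (induction v) (auto simp: reduced_lmul)

lemma lmul_linv: "reduced w \<Longrightarrow> lmul a (lmul (linv a) w) = w"
  by (cases w; cases "tl w") (auto simp: lmul_def reduced_Cons)

lemma lmul_linv': "reduced w \<Longrightarrow> lmul (linv a) (lmul a w) = w"
  using lmul_linv[of w "linv a"] by simp

lemma wmul_Nil_right: "reduced w \<Longrightarrow> wmul w [] = w"
  by (induction w) (auto simp: reduced_Cons)

lemma wmul_lmul: 
  assumes "reduced z" shows "wmul (lmul a w) z = lmul a (wmul w z)"
proof (cases "\<exists>w'. w = linv a # w'")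
  case True
  then obtain w' where w: "w = linv a # w'" by blast
  then have "lmul a w = w'" by (simp add: lmul_def)
  then show ?thesis using assms by (simp add: w lmul_linv reduced_wmul)
next
  case False
  then have "lmul a w = a # w" by (auto simp: lmul_def split: list.split)
  then show ?thesis by simp
qed

lemma wmul_assoc: "reduced z \<Longrightarrow> wmul (wmul u v) z = wmul u (wmul v z)"
  by (induction u) (auto simp: wmul_lmul)

lemma wmul_winv: "reduced z \<Longrightarrow> wmul (winv w) (wmul w z) = z"
  by (induction w arbitrary: z) (auto simp: winv_Cons wmul_append lmul_linv' reduced_wmul)

lemma wmul_winv': "reduced z \<Longrightarrow> wmul w (wmul (winv w) z) = z"
  using wmul_winv[of z "winv w"] by simp

lemma wmul_eq_Nil: "reduced v \<Longrightarrow> reduced w \<Longrightarrow> wmul v w = [] \<Longrightarrow> v = winv w"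
  using wmul_winv[of w v] wmul_Nil_right[of "winv v"] reduced_winv[of v] winv_winv[of v] by metis

lemma wmul_winv_self: "reduced w \<Longrightarrow> wmul (winv w) w = []" "reduced w \<Longrightarrow> wmul w (winv w) = []"
  using wmul_winv[of "[]" w] wmul_winv'[of "[]" w] by (simp_all add: wmul_Nil_right reduced_winv)

section \<open>Cancellation and unique products in the free group\<close>

text \<open>Only the end of \<open>c\<close> meets the start of \<open>g\<close>, so letters are
  peeled off the end of \<open>c\<close> until one does not cancel. The cancelled part
  \<open>s\<close> is recorded explicitly, so that lengths and letters can be compared
  afterwards.\<close>

lemma wmul_cancellation:
  assumes "reduced c" "reduced g"
  shows "\<exists>c' s g'. c = c' @ winv s \<and> g = s @ g' \<and> wmul c g = c' @ g'"
  using assms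
proof (induction c arbitrary: g rule: rev_induct)
  case Nil
  show ?case by (rule exI[of _ "[]"], rule exI[of _ "[]"]) auto
next
  case (snoc a c)
  then have c: "reduced c" by (simp add: reduced_append)
  have app: "wmul v w = v @ w" if "reduced (v @ w)" for v w
    using that by (induction v) (auto simp: reduced_Cons reduced_append)
  show ?case
  proof (cases "g \<noteq> [] \<and> hd g = linv a")
    case True
    then obtain g1 where g: "g = linv a # g1" by (cases g) auto
    from snoc.IH[OF c, of g1] snoc.prems(2)
    obtain c' s g' where *: "c = c' @ winv s" "g1 = s @ g'" "wmul c g1 = c' @ g'"
      by (auto simp: g reduced_Cons)
    have "wmul (c @ [a]) g = wmul c g1" by (simp add: wmul_append g lmul_def)
    then show ?thesis using * by (intro exI[of _ c'] exI[of _ "linv a # s"] exI[of _ g']) (auto simp: g winv_Cons)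
  next
    case False
    then have "reduced ((c @ [a]) @ g)"
      using snoc.prems by (cases g) (auto simp: reduced_append reduced_Cons)
    from app[OF this] show ?thesis by (intro exI[of _ "c @ [a]"] exI[of _ "[]"] exI[of _ g]) auto
  qed
qed

text \<open>If neither \<open>c g\<close> nor \<open>c g\<inverse>\<close> is longer than \<open>c\<close>, then each of \<open>g\<close> and \<open>g\<inverse>\<close> loses at least
  half of its letters to the end of \<open>c\<close>, so their first halves agree, which is impossible in the
  middle of \<open>g\<close>.\<close>

lemma length_extremal:
  assumes c: "reduced c" and g: "reduced g"
    and le: "length (wmul c g) \<le> length c" "length (wmul c (winv g)) \<le> length c"
  shows "g = []"
proof (rule ccontr)
  assume "g \<noteq> []"
  obtain c1 s1 g1 where 1: "c = c1 @ winv s1" "g = s1 @ g1" "wmul c g = c1 @ g1"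
    using wmul_cancellation[OF c g] by blast
  obtain c2 s2 g2 where 2: "c = c2 @ winv s2" "winv g = s2 @ g2" "wmul c (winv g) = c2 @ g2"
    using wmul_cancellation[OF c reduced_winv[OF g]] by blast
  define n where "n = length g"
  have "length c = length c1 + length s1" "length c = length c2 + length s2"
    using arg_cong[OF 1(1), of length] arg_cong[OF 2(1), of length] by simp_all
  then have ln: "length g1 \<le> length s1" "length g2 \<le> length s2"
    using le unfolding 1(3) 2(3) by simp_all
  have n1: "n = length s1 + length g1" unfolding n_def 1(2) by simp
  have n2: "n = length s2 + length g2" using arg_cong[OF 2(2), of length] by (simp add: n_def)
  have winv_append: "winv (u @ v) = winv v @ winv u" for u v by (simp add: winv_def)
  have w: "winv c = s1 @ winv c1" "winv c = s2 @ winv c2"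
    using arg_cong[OF 1(1), of winv] arg_cong[OF 2(1), of winv] by (simp_all only: winv_append winv_winv)
  \<comment> \<open>The last position that is certain to be cancelled in both products, as each of
    them cancels at least half of the \<open>n\<close> letters. Its mirror image
    \<open>n - 1 - i\<close> is \<open>Suc i\<close> for even \<open>n\<close> and \<open>i\<close>
    itself for odd \<open>n\<close>.\<close>
  define i where "i = (n - 1) div 2"
  have n0: "n > 0" using \<open>g \<noteq> []\<close> by (simp add: n_def)
  have "2 * i < n" using n0 by (simp add: i_def)
  then have i: "i < length s1" "i < length s2" using ln n1 n2 by linarith+
  have "g ! i = winv c ! i" using i(1) unfolding w(1) by (subst 1(2)) (simp add: nth_append)
  moreover have "winv g ! i = winv c ! i" using i(2) unfolding w(2) by (subst 2(2)) (simp add: nth_append)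
  moreover have "i < n" using i n1 by simp
  moreover have "winv g ! i = linv (g ! (n - 1 - i))"
    using \<open>i < n\<close> by (simp add: winv_def rev_nth n_def)
  ultimately have eq: "g ! i = linv (g ! (n - 1 - i))" by metis
  show False
  proof (cases "even n")
    case True
    then obtain b where "n = 2 * b" by (rule evenE)
    moreover from this obtain b' where "b = Suc b'" using n0 by (cases b) auto
    ultimately have *: "n - 1 - i = Suc i" "Suc i < n" by (simp_all add: i_def)
    have "g ! Suc i \<noteq> linv (g ! i)"
      using g *(2) unfolding reduced_def successively_conv_nth n_def by blast
    moreover have "g ! i = linv (g ! Suc i)" using eq *(1) by metis
    ultimately show False using linv_linv by metis
  next
    case False
    then obtain b where "n = 2 * b + 1" by (rule oddE)
    then have "n - 1 - i = i" by (simp add: i_def)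
    with eq have "g ! i = linv (g ! i)" by metis
    then show False using linv_neq(2) by blast
  qed
qed

text \<open>With \<open>g\<close> the quotient of y' and y, the words x' y and x y' arise from the
  common product by multiplying with \<open>g\<close> and with its inverse. Neither is longer, so
  \<open>length_extremal\<close> gives that \<open>g\<close> is empty. Thus a longest product of
  elements of two finite sets factors in one way only.\<close>

lemma wmul_unique_product:
  assumes red: "reduced x" "reduced y" "reduced x'" "reduced y'"
    and eq: "wmul x y = wmul x' y'"
    and le: "length (wmul x' y) \<le> length (wmul x y)" "length (wmul x y') \<le> length (wmul x y)"
  shows "x = x'" "y = y'"
proof -
  define g where "g = wmul (winv y') y"
  define h where "h = wmul (winv y) y'"
  have g: "reduced g" "reduced h" using red by (auto simp: g_def h_def reduced_wmul)
  have "wmul g h = wmul (winv y') (wmul y h)" unfolding g_def by (rule wmul_assoc[OF g(2)])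
  also have "wmul y h = y'" unfolding h_def by (rule wmul_winv'[OF red(4)])
  also have "wmul (winv y') y' = []" by (rule wmul_winv_self(1)[OF red(4)])
  finally have "wmul g h = []" .
  then have h: "h = winv g" using wmul_eq_Nil[OF g] winv_winv by metis
  have "wmul (wmul x' y') g = wmul x' y"
    using red by (simp add: g(1) wmul_assoc) (simp add: g_def wmul_winv')
  then have "wmul (wmul x y) g = wmul x' y" by (simp only: eq)
  moreover have "wmul (wmul x y) (winv g) = wmul x y'"
    unfolding h[symmetric] using red by (simp add: g(2) wmul_assoc) (simp add: h_def wmul_winv')
  ultimately have "g = []"
    using le by (intro length_extremal[of "wmul x y"]) (simp_all only: reduced_wmul red g)
  have "wmul y' g = y" unfolding g_def by (rule wmul_winv'[OF red(2)])
  then show "y = y'" unfolding \<open>g = []\<close> by (simp add: wmul_Nil_right red)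
  have *: "wmul (wmul u y) (winv y) = u" if "reduced u" for u
    unfolding wmul_assoc[OF reduced_winv[OF red(2)]] wmul_winv_self(2)[OF red(2)]
    by (rule wmul_Nil_right[OF that])
  show "x = x'" using *[OF red(1)] *[OF red(3)] eq \<open>y = y'\<close> by metis
qed

section \<open>The action of words by transpositions\<close>

definition swp :: "nat \<Rightarrow> nat \<Rightarrow> nat" where
  "swp l a = (case prod_decode (l div 2) of (u, v) \<Rightarrow> if a = u then v else if a = v then u else a)"

text \<open>Letters are applied from left to right, so this is a right action: translating a word on
  the right by \<open>g\<close> composes its permutation with that of \<open>g\<close>
  afterwards.\<close>

definition ia :: "nat list \<Rightarrow> nat \<Rightarrow> nat" where
  "ia w a = fold swp w a"

lemma swp_swp [simp]: "swp l (swp l a) = a"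
  by (auto simp: swp_def split: prod.split)

lemma swp_linv [simp]: "swp (linv l) = swp l"
  by (auto simp: swp_def)

lemma ia_simps [simp]: "ia [] a = a" "ia (l # w) a = ia w (swp l a)"
  by (auto simp: ia_def)

lemma ia_append: "ia (v @ w) a = ia w (ia v a)"
  by (simp add: ia_def)

lemma ia_lmul: "ia (lmul l w) a = ia w (swp l a)"
  by (cases w) (auto simp: lmul_def)

lemma ia_wmul: "ia (wmul v w) a = ia w (ia v a)"
  by (induction v arbitrary: a) (auto simp: ia_lmul)

lemma ia_winv [simp]: "ia (winv w) (ia w a) = a" "ia w (ia (winv w) a) = a"
proof -
  show *: "ia (winv w) (ia w a) = a" for w a
    by (induction w arbitrary: a) (auto simp: winv_Cons ia_append)
  show "ia w (ia (winv w) a) = a" using *[of "winv w"] by simp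
qed

lemma ia_eq_iff [simp]: "ia w a = ia w b \<longleftrightarrow> a = b"
  by (metis ia_winv(1))

lemma ia_reduce: "ia (wmul w []) = ia w"
  by (auto simp: ia_wmul)

text \<open>To add a point x, append the transposition of its current image and its target. By
  injectivity the values already arranged are neither of these two numbers, so they stay.\<close>

lemma ia_extend:
  assumes "finite A" "inj_on p A"
  shows "\<exists>w. reduced w \<and> (\<forall>a\<in>A. ia w a = p a)"
proof -
  have "\<exists>w. \<forall>a\<in>A. ia w a = p a"
    using assms
  proof (induction A rule: finite_induct)
    case (insert x A)
    then obtain w where w: "\<forall>a\<in>A. ia w a = p a" by auto
    define l where "l = 2 * pair (ia w x) (p x)"
    have "ia (w @ [l]) a = p a" if "a \<in> insert x A" for a
    proof (cases "a = x")
      case False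
      then have "a \<in> A" using that by simp
      then have "p a \<noteq> p x" "ia w a \<noteq> ia w x"
        using insert.prems insert.hyps False by (auto simp: inj_on_def)
      then show ?thesis using w \<open>a \<in> A\<close> by (auto simp: ia_append swp_def l_def)
    qed (auto simp: ia_append swp_def l_def)
    then show ?case by blast
  qed simp
  then obtain w where "\<forall>a\<in>A. ia w a = p a" by blast
  then show ?thesis by (intro exI[of _ "wmul w []"]) (auto simp: ia_reduce reduced_wmul)
qed

section \<open>Localizations of the integers\<close>

definition zloc :: "nat \<Rightarrow> rat \<Rightarrow> bool" where
  "zloc p q \<longleftrightarrow> (\<exists>k m :: int. \<not> int p dvd k \<and> of_int k * q = of_int m)"

lemma zloc_Ints: "prime p \<Longrightarrow> q \<in> \<int> \<Longrightarrow> zloc p q"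
  unfolding zloc_def by (elim Ints_cases) (metis mult_1 not_prime_unit of_int_1 prime_int_nat_transfer prime_nat_int_transfer)

lemma zloc_add:
  assumes "prime p" "zloc p q" "zloc p r" shows "zloc p (q + r)"
proof -
  obtain k m l n where *: "\<not> int p dvd k" "of_int k * q = of_int m" "\<not> int p dvd l" "of_int l * r = of_int n"
    using assms unfolding zloc_def by blast
  have "of_int (k * l) * (q + r) = of_int l * (of_int k * q) + of_int k * (of_int l * r)"
    by (simp add: algebra_simps)
  also have "\<dots> = of_int (l * m + k * n)" unfolding * by simp
  finally have "of_int (k * l) * (q + r) = of_int (l * m + k * n)" .
  moreover have "\<not> int p dvd k * l"
    using * assms(1) by (simp add: prime_dvd_mult_iff)
  ultimately show ?thesis unfolding zloc_def by blast
qed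

lemma zloc_mult_Ints:
  assumes "zloc p q" "r \<in> \<int>" shows "zloc p (q * r)"
proof -
  obtain k m n where *: "\<not> int p dvd k" "of_int k * q = of_int m" "r = of_int n"
    using assms unfolding zloc_def by (metis Ints_cases)
  then have "of_int k * (q * r) = of_int (m * n)" by (simp add: algebra_simps)
  then show ?thesis using * unfolding zloc_def by blast
qed

lemma zloc_sum: "prime p \<Longrightarrow> (\<And>i. i \<in> A \<Longrightarrow> zloc p (f i)) \<Longrightarrow> zloc p (sum f A)"
  by (induction A rule: infinite_finite_induct) (auto simp: zloc_add zloc_Ints)

lemma zloc_divide_power:
  assumes "prime p" "prime r" "p \<noteq> r" "zloc p q" shows "zloc p (q / of_nat r ^ j)"
proof -
  obtain k m where *: "\<not> int p dvd k" "of_int k * q = of_int m"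
    using assms unfolding zloc_def by blast
  have "\<not> int p dvd int r ^ j"
    using assms by (metis int_dvd_int_iff prime_dvd_power_nat primes_dvd_imp_eq of_nat_power)
  then have "\<not> int p dvd k * int r ^ j"
    using * assms(1) by (simp add: prime_dvd_mult_iff)
  moreover have "of_int (k * int r ^ j) * (q / of_nat r ^ j) = of_int m"
    using * assms(2) by (simp add: prime_gt_0_nat)
  ultimately show ?thesis unfolding zloc_def by blast
qed

text \<open>Every power of p divides the numerator, which for a nonzero integer is impossible. This
  turns infinite divisibility into the vanishing of functionals.\<close>

lemma zloc_all_powers:
  assumes p: "prime p" and q: "\<And>j. zloc p (q / of_nat p ^ j)" shows "q = 0"
proof (rule ccontr)
  assume "q \<noteq> 0"
  obtain a b where ab: "q = of_int a / of_int b" "b > 0" "coprime a b" using Rat_cases_nonzero[of q]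
    by (metis Fract_of_int_quotient \<open>q \<noteq> 0\<close>)
  then have "a \<noteq> 0" using \<open>q \<noteq> 0\<close> by auto
  have "int p ^ j dvd a" for j
  proof -
    obtain k m where *: "\<not> int p dvd k" "of_int k * (q / of_nat p ^ j) = of_int m"
      using q[of j] unfolding zloc_def by blast
    have "(of_int (k * a) :: rat) = of_int (m * b * int p ^ j)"
      using *(2) ab p by (simp add: field_simps prime_gt_0_nat)
    then have "k * a = m * b * int p ^ j" by (simp only: of_int_eq_iff)
    then have "int p ^ j dvd k * a" by simp
    moreover have "coprime (int p ^ j) k"
      using * p by (simp add: prime_imp_coprime)
    ultimately show ?thesis by (simp add: coprime_dvd_mult_right_iff)
  qed
  then have "infinite {n. int p ^ n dvd a}" by simp
  then show False
    using \<open>a \<noteq> 0\<close> prime_gt_1_nat[OF p] finite_divisor_powers[of a "int p"] by simp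
qed

definition pr :: "nat \<Rightarrow> nat" where
  "pr k = enumerate {p. prime p} k"

lemma prime_pr [simp]: "prime (pr k)"
  using enumerate_in_set[OF primes_infinite] by (simp add: pr_def)

lemma pr_eq_iff [simp]: "pr k = pr l \<longleftrightarrow> k = l"
  unfolding pr_def by (metis enumerate_mono less_irrefl nat_neq_iff primes_infinite)

lemma pr_pos [simp]: "0 < pr k" by (simp add: prime_gt_0_nat)

section \<open>The group of a graph\<close>

text \<open>Only reduced words and pairs of distinct numbers carry structure; the other basis
  elements are kept merely to avoid a subtype.\<close>

datatype bas = Al nat "nat list" | Al' nat "nat list" | Ep nat nat

type_synonym vec = "bas \<Rightarrow> rat"

section \<open>Finitely supported vectors and their linear functionals\<close>

definition fsupp :: "vec \<Rightarrow> bool" where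
  "fsupp v \<longleftrightarrow> finite {b. v b \<noteq> 0}"

definition ebas :: "bas \<Rightarrow> vec" where
  "ebas b = (\<lambda>b'. if b' = b then 1 else 0)"

lemma ebas_same [simp]: "ebas b b = 1"
  and ebas_other: "b' \<noteq> b \<Longrightarrow> ebas b b' = 0"
  and ebas_Ints [simp]: "ebas b b' \<in> \<int>"
  by (auto simp: ebas_def)

lemma ebas_eq_0_iff: "ebas b b' = 0 \<longleftrightarrow> b \<noteq> b'"
  by (auto simp: ebas_def)

lemma fsupp_ebas [simp]: "fsupp (ebas b)"
  by (simp add: fsupp_def ebas_eq_0_iff)

lemma fsupp_add [simp]: "fsupp u \<Longrightarrow> fsupp v \<Longrightarrow> fsupp (\<lambda>b. u b + v b)"
  unfolding fsupp_def by (rule finite_subset[of _ "{b. u b \<noteq> 0} \<union> {b. v b \<noteq> 0}"]) auto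

lemma fsupp_mult [simp]: "fsupp v \<Longrightarrow> fsupp (\<lambda>b. r * v b)"
  unfolding fsupp_def by (rule finite_subset[of _ "{b. v b \<noteq> 0}"]) auto

lemma fsupp_0 [simp]: "fsupp (\<lambda>b. 0)"
  by (simp add: fsupp_def)

lemma fsupp_sum [simp]: "(\<And>i. i \<in> I \<Longrightarrow> fsupp (g i)) \<Longrightarrow> fsupp (\<lambda>b. \<Sum>i\<in>I. g i b)"
  by (induction I rule: infinite_finite_induct) auto

lemma fsupp_expand:
  assumes "fsupp v" shows "v b = (\<Sum>b' | v b' \<noteq> 0. v b' * ebas b' b)"
proof -
  have "(\<Sum>b' | v b' \<noteq> 0. v b' * ebas b' b) = (\<Sum>b' | v b' \<noteq> 0. if b' = b then v b' else 0)"
    by (rule sum.cong) (auto simp: ebas_def)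
  then show ?thesis using assms by (simp add: fsupp_def)
qed

text \<open>Linearity is asked for finite support only: \<open>kfun\<close> sums over the support,
  and a sum over an infinite set is 0 by convention.\<close>

definition flin :: "(vec \<Rightarrow> rat) \<Rightarrow> bool" where
  "flin c \<longleftrightarrow> (\<forall>u v. fsupp u \<longrightarrow> fsupp v \<longrightarrow> c (\<lambda>b. u b + v b) = c u + c v) \<and>
     (\<forall>r v. fsupp v \<longrightarrow> c (\<lambda>b. r * v b) = r * c v)"

lemma flinD:
  assumes "flin c"
  shows "fsupp u \<Longrightarrow> fsupp v \<Longrightarrow> c (\<lambda>b. u b + v b) = c u + c v"
    and "fsupp v \<Longrightarrow> c (\<lambda>b. r * v b) = r * c v"
  using assms by (auto simp: flin_def)

lemma flin_0: "flin c \<Longrightarrow> c (\<lambda>b. 0) = 0"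
  using flinD(2)[of c "\<lambda>b. 0" 0] by simp

lemma flin_coord [simp]: "flin (\<lambda>v. v b)" and flin_diff [simp]: "flin (\<lambda>v. v b - v b')"
  and flin_zero [simp]: "flin (\<lambda>v. 0)"
  by (auto simp: flin_def algebra_simps)

lemma flin_sum:
  assumes "flin c" "finite I" "\<And>i. i \<in> I \<Longrightarrow> fsupp (g i)"
  shows "c (\<lambda>b. \<Sum>i\<in>I. k i * g i b) = (\<Sum>i\<in>I. k i * c (g i))"
  using assms(2,3)
proof (induction I rule: finite_induct)
  case empty
  then show ?case by (simp add: flin_0 assms(1))
next
  case (insert i I)
  then have "c (\<lambda>b. k i * g i b + (\<Sum>i\<in>I. k i * g i b)) = k i * c (g i) + (\<Sum>i\<in>I. k i * c (g i))"
    by (subst flinD(1)[OF assms(1)]) (simp_all add: flinD(2)[OF assms(1)])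
  then show ?case using insert.hyps by simp
qed

lemma flin_expand:
  assumes "flin c" "fsupp v" shows "c v = (\<Sum>b | v b \<noteq> 0. v b * c (ebas b))"
proof -
  have "c v = c (\<lambda>b. \<Sum>b' | v b' \<noteq> 0. v b' * ebas b' b)"
    by (rule arg_cong[of _ _ c], rule ext, rule fsupp_expand[OF assms(2)])
  also have "\<dots> = (\<Sum>b | v b \<noteq> 0. v b * c (ebas b))"
    using assms by (intro flin_sum) (auto simp: fsupp_def[of v])
  finally show ?thesis .
qed

section \<open>Functionals and the subgroup they cut out\<close>

text \<open>The orbit map of the base pair (0, 1) sends the unprimed copy of F at level n onto the
  pairs of distinct numbers; this is its fibre over (a, b).\<close>

definition fiber :: "nat \<Rightarrow> nat \<Rightarrow> nat \<Rightarrow> bas set" where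
  "fiber n a b = {Al n w | w. reduced w \<and> ia w 0 = a \<and> ia w 1 = b}"

text \<open>Consider the linear map that sends \<open>Ep a b\<close> to the pair (a, b), a reduced
  \<open>Al n w\<close> to the pair over which it lies, and every other basis element to 0. This is
  the (a, b)-coordinate of that map, so the kernel identifies \<open>Ep a b\<close> with each
  element of the fibre.\<close>

definition kfun :: "nat \<Rightarrow> nat \<Rightarrow> nat \<Rightarrow> vec \<Rightarrow> rat" where
  "kfun n a b v = v (Ep a b) + (\<Sum>i | i \<in> fiber n a b \<and> v i \<noteq> 0. v i)"

lemma kfun_eq:
  assumes "finite S" "{i. v i \<noteq> 0} \<subseteq> S"
  shows "kfun n a b v = v (Ep a b) + (\<Sum>i \<in> S \<inter> fiber n a b. v i)"
  unfolding kfun_def using assms by (intro arg_cong2[of _ _ _ _ "(+)"] refl sum.mono_neutral_left) auto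

lemma flin_kfun [simp]: "flin (kfun n a b)"
  unfolding flin_def
proof (intro conjI allI impI)
  fix u v assume "fsupp u" "fsupp v"
  then have f: "finite ({i. u i \<noteq> 0} \<union> {i. v i \<noteq> 0})" by (simp add: fsupp_def)
  show "kfun n a b (\<lambda>b. u b + v b) = kfun n a b u + kfun n a b v"
    by (subst (1 2 3) kfun_eq[OF f]) (auto simp: sum.distrib)
next
  fix r v assume "fsupp v"
  then have f: "finite {i. v i \<noteq> 0}" by (simp add: fsupp_def)
  show "kfun n a b (\<lambda>b. r * v b) = r * kfun n a b v"
    by (subst (1 2) kfun_eq[OF f]) (auto simp: algebra_simps sum_distrib_left)
qed

lemma kfun_ebas: "kfun n a b (ebas i) = (if i = Ep a b \<or> i \<in> fiber n a b then 1 else 0)"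
proof -
  have "kfun n a b (ebas i) = ebas i (Ep a b) + (\<Sum>j \<in> {i} \<inter> fiber n a b. ebas i j)"
    by (rule kfun_eq) (auto simp: ebas_eq_0_iff)
  then show ?thesis by (auto simp: ebas_def fiber_def)
qed

text \<open>Index 0 is the identity and \<open>Suc l\<close> the letter \<open>l\<close>. The
  diagonal of index 0 compares the two copies of F directly, the others compare them up to a letter;
  together they yield translation by that letter within one copy.\<close>

definition lmul_opt :: "nat \<Rightarrow> nat list \<Rightarrow> nat list" where
  "lmul_opt l w = (case l of 0 \<Rightarrow> w | Suc l' \<Rightarrow> lmul l' w)"

lemma reduced_lmul_opt: "reduced w \<Longrightarrow> reduced (lmul_opt l w)"
  by (auto simp: lmul_opt_def reduced_lmul split: nat.split)

lemma lmul_opt_eq_iff: "reduced v \<Longrightarrow> reduced w \<Longrightarrow> lmul_opt l v = lmul_opt l w \<longleftrightarrow> v = w"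
  by (auto simp: lmul_opt_def split: nat.split) (metis lmul_linv')

lemma lmul_opt_wmul: "reduced z \<Longrightarrow> wmul (lmul_opt l w) z = lmul_opt l (wmul w z)"
  by (auto simp: lmul_opt_def wmul_lmul split: nat.split)

text \<open>The functionals defining the subspace that is \<open>pr k\<close>-divisible. The graph enters only through
  the last two clauses.\<close>

inductive annih :: "(nat \<Rightarrow> nat \<Rightarrow> bool) \<Rightarrow> nat \<Rightarrow> (vec \<Rightarrow> rat) \<Rightarrow> bool" for x where
  Al: "(\<And>w. reduced w \<Longrightarrow> b \<noteq> Al n w) \<Longrightarrow> annih x (pair 0 n) (\<lambda>v. v b)"
| Al': "(\<And>w. reduced w \<Longrightarrow> b \<noteq> Al' n w) \<Longrightarrow> annih x (pair 1 n) (\<lambda>v. v b)"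
| off: "(\<And>w. reduced w \<Longrightarrow> b \<noteq> Al n w \<and> b \<noteq> Al' n w) \<Longrightarrow>
    annih x (pair 2 (pair n l)) (\<lambda>v. v b)"
| mul: "reduced w \<Longrightarrow>
    annih x (pair 2 (pair n l)) (\<lambda>v. v (Al n w) - v (Al' n (lmul_opt l w)))"
| ker: "a \<noteq> b \<Longrightarrow> annih x (pair 3 n) (kfun n a b)"
| edge: "a \<noteq> b \<Longrightarrow> x a b \<Longrightarrow> annih x (pair 4 0) (\<lambda>v. v (Ep a b))"
| nonedge: "a \<noteq> b \<Longrightarrow> \<not> x a b \<Longrightarrow> annih x (pair 4 1) (\<lambda>v. v (Ep a b))"

lemma annih_2E:
  assumes "annih x (pair 2 (pair n l)) c"
  obtains b where "c = (\<lambda>v. v b)" "\<And>w. reduced w \<Longrightarrow> b \<noteq> Al n w" "\<And>w. reduced w \<Longrightarrow> b \<noteq> Al' n w"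
  | w where "c = (\<lambda>v. v (Al n w) - v (Al' n (lmul_opt l w)))" "reduced w"
  using assms by (rule annih.cases) auto

lemma annih_3E:
  assumes "annih x (pair 3 n) c"
  obtains a b where "c = kfun n a b" "a \<noteq> b"
  using assms by (rule annih.cases) auto

lemma annih_4E:
  assumes "annih x (pair 4 i) c"
  obtains a b where "c = (\<lambda>v. v (Ep a b))" "a \<noteq> b" "x a b \<longleftrightarrow> i = 0"
  using assms by (rule annih.cases) auto

text \<open>Prescribing denominators through functionals, instead of giving generators, serves three
  ends: divisibility inside a subspace is immediate (\<open>gr_divide\<close>), its failure outside
  follows from \<open>zloc_all_powers\<close>, and membership becomes an arithmetical
  condition.\<close>

definition gr :: "(nat \<Rightarrow> nat \<Rightarrow> bool) \<Rightarrow> vec set" where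
  "gr x = {v. fsupp v \<and> (\<forall>k c. annih x k c \<longrightarrow> zloc (pr k) (c v))}"

lemma annih_flin: "annih x k c \<Longrightarrow> flin c"
  by (induction rule: annih.induct) auto

lemma annih_ebas: "annih x k c \<Longrightarrow> c (ebas b) \<in> \<int>"
  by (induction rule: annih.induct) (auto simp: kfun_ebas)

lemma gr_fsupp: "v \<in> gr x \<Longrightarrow> fsupp v" by (simp add: gr_def)

lemma gr_integral:
  assumes "fsupp v" "\<And>b. v b \<in> \<int>" shows "v \<in> gr x"
proof -
  have "zloc (pr k) (c v)" if "annih x k c" for k c
    unfolding flin_expand[OF annih_flin[OF that] assms(1)]
    using annih_ebas[OF that] assms(2) by (intro zloc_Ints Ints_sum Ints_mult) auto
  then show ?thesis using assms by (simp add: gr_def)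
qed

lemma gr_ebas [simp]: "ebas b \<in> gr x"
  by (rule gr_integral) auto

lemma gr_add: "u \<in> gr x \<Longrightarrow> v \<in> gr x \<Longrightarrow> (\<lambda>b. u b + v b) \<in> gr x"
  by (auto simp: gr_def flinD[OF annih_flin] zloc_add)

lemma gr_mult_Ints:
  assumes "r \<in> \<int>" "v \<in> gr x" shows "(\<lambda>b. r * v b) \<in> gr x"
proof -
  have "zloc (pr k) (c (\<lambda>b. r * v b))" if "annih x k c" for k c
    using zloc_mult_Ints[of "pr k" "c v" r] assms that
    by (simp add: gr_def flinD(2)[OF annih_flin[OF that]] mult.commute)
  then show ?thesis using assms by (simp add: gr_def)
qed

lemma gr_0 [simp]: "(\<lambda>b. 0) \<in> gr x"
  by (rule gr_integral) auto

text \<open>Powers of \<open>pr k\<close> are invertible in the localizations at all other primes,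
  and at \<open>pr k\<close> itself the functionals to be tested vanish.\<close>

lemma gr_divide:
  assumes v: "v \<in> gr x" and c: "\<And>c. annih x k c \<Longrightarrow> c v = 0"
  shows "(\<lambda>b. inverse (of_nat (pr k) ^ j) * v b) \<in> gr x"
proof -
  have "zloc (pr l) (d (\<lambda>b. inverse (of_nat (pr k) ^ j) * v b))" if d: "annih x l d" for l d
  proof -
    have *: "d (\<lambda>b. inverse (of_nat (pr k) ^ j) * v b) = d v / of_nat (pr k) ^ j"
      using flinD(2)[OF annih_flin[OF d] gr_fsupp[OF v], of "inverse (of_nat (pr k) ^ j)"]
      by (simp add: divide_inverse mult.commute)
    show ?thesis
    proof (cases "l = k")
      case True
      then have "d v = 0" using c d by blast
      then show ?thesis unfolding * by (simp add: zloc_Ints)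
    next
      case False
      then show ?thesis using d v unfolding *
        by (intro zloc_divide_power) (auto simp: gr_def)
    qed
  qed
  then show ?thesis using v by (simp add: gr_def)
qed

section \<open>Isomorphisms of the groups\<close>

lemma common_denominator:
  assumes "finite F" shows "\<exists>N::int. N \<noteq> 0 \<and> (\<forall>b\<in>F. of_int N * (v b :: rat) \<in> \<int>)"
  using assms
proof (induction F rule: finite_induct)
  case empty
  show ?case by (rule exI[of _ 1]) simp
next
  case (insert x F)
  then obtain N where N: "N \<noteq> 0" "\<forall>b\<in>F. of_int N * v b \<in> \<int>" by blast
  obtain p q where pq: "v x = of_int p / of_int q" "q > 0"
    by (metis Rat_cases Fract_of_int_quotient)
  have "of_int (N * q) * v b \<in> \<int>" if "b \<in> insert x F" for b
  proof (cases "b = x")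
    case True
    have "of_int (N * q) * v x = of_int (N * p)" using pq by simp
    then show ?thesis using True by (metis Ints_of_int)
  next
    case False
    then have "of_int N * v b \<in> \<int>" using that N by blast
    then have "of_int q * (of_int N * v b) \<in> \<int>" by (rule Ints_mult[OF Ints_of_int])
    then show ?thesis by (simp add: ac_simps)
  qed
  then show ?case using N pq by (intro exI[of _ "N * q"]) auto
qed

locale group_iso =
  fixes x y :: "nat \<Rightarrow> nat \<Rightarrow> bool" and T T' :: "vec \<Rightarrow> vec"
  assumes T_in: "v \<in> gr x \<Longrightarrow> T v \<in> gr y"
    and T'_in: "v \<in> gr y \<Longrightarrow> T' v \<in> gr x"
    and T_add: "u \<in> gr x \<Longrightarrow> v \<in> gr x \<Longrightarrow> T (\<lambda>b. u b + v b) = (\<lambda>b. T u b + T v b)"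
    and T'_add: "u \<in> gr y \<Longrightarrow> v \<in> gr y \<Longrightarrow> T' (\<lambda>b. u b + v b) = (\<lambda>b. T' u b + T' v b)"
    and T'_T: "v \<in> gr x \<Longrightarrow> T' (T v) = v"
    and T_T': "v \<in> gr y \<Longrightarrow> T (T' v) = v"
begin

lemma sym: "group_iso y x T' T"
  by unfold_locales (simp_all add: T_in T'_in T_add T'_add T_T' T'_T)

lemma T_0: "T (\<lambda>b. 0) = (\<lambda>b. 0)"
  using T_add[of "\<lambda>b. 0" "\<lambda>b. 0"] by (auto simp: fun_eq_iff)

lemma T_of_nat: "v \<in> gr x \<Longrightarrow> T (\<lambda>b. of_nat n * v b) = (\<lambda>b. of_nat n * T v b)"
proof (induction n)
  case (Suc n)
  have "T (\<lambda>b. of_nat (Suc n) * v b) = T (\<lambda>b. v b + of_nat n * v b)"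
    by (simp add: algebra_simps)
  also have "\<dots> = (\<lambda>b. T v b + T (\<lambda>b. of_nat n * v b) b)"
    using Suc.prems by (intro T_add gr_mult_Ints) auto
  also have "\<dots> = (\<lambda>b. of_nat (Suc n) * T v b)"
    unfolding Suc.IH[OF Suc.prems] by (simp add: algebra_simps)
  finally show ?case .
qed (simp add: T_0)

lemma T_uminus:
  assumes "v \<in> gr x" shows "T (\<lambda>b. - v b) = (\<lambda>b. - T v b)"
proof -
  have "(\<lambda>b. - v b) \<in> gr x" using gr_mult_Ints[of "-1" v x] assms by simp
  from T_add[OF this assms] show ?thesis by (auto simp: T_0 fun_eq_iff) (metis add_eq_0_iff2)
qed

lemma T_of_int:
  assumes "v \<in> gr x" shows "T (\<lambda>b. of_int m * v b) = (\<lambda>b. of_int m * T v b)"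
proof (cases m rule: int_cases2)
  case (nonneg n)
  then show ?thesis using T_of_nat[OF assms, of n] by simp
next
  case (nonpos n)
  have "(\<lambda>b. of_nat n * v b) \<in> gr x" using assms by (intro gr_mult_Ints) auto
  from T_uminus[OF this] show ?thesis using T_of_nat[OF assms, of n] nonpos by simp
qed

lemma T_sum_of_int:
  assumes "finite I" "\<And>i. i \<in> I \<Longrightarrow> g i \<in> gr x"
  shows "T (\<lambda>b. \<Sum>i\<in>I. of_int (m i) * g i b) = (\<lambda>b. \<Sum>i\<in>I. of_int (m i) * T (g i) b) \<and>
    (\<lambda>b. \<Sum>i\<in>I. of_int (m i) * g i b) \<in> gr x"
  using assms
proof (induction I rule: finite_induct)
  case empty
  show ?case by (simp add: T_0)
next
  case (insert i I)
  then have IH: "T (\<lambda>b. \<Sum>i\<in>I. of_int (m i) * g i b) = (\<lambda>b. \<Sum>i\<in>I. of_int (m i) * T (g i) b)"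
    "(\<lambda>b. \<Sum>i\<in>I. of_int (m i) * g i b) \<in> gr x" by simp_all
  have gi: "g i \<in> gr x" "(\<lambda>b. of_int (m i) * g i b) \<in> gr x"
    using insert.prems by (auto intro: gr_mult_Ints)
  show ?case
    using T_add[OF gi(2) IH(2)] gr_add[OF gi(2) IH(2)] insert.hyps
    unfolding IH(1) T_of_int[OF gi(1)] by simp
qed

text \<open>Additivity is assumed on the group only. Clearing denominators makes \<open>v\<close> an
  integer combination of basis vectors, and the denominator can be cancelled in the target; so
  \<open>T\<close> is the restriction of a linear map.\<close>

lemma T_expand:
  assumes v: "v \<in> gr x" shows "T v b = (\<Sum>i | v i \<noteq> 0. v i * T (ebas i) b)"
proof -
  have fin: "finite {i. v i \<noteq> 0}" using gr_fsupp[OF v] by (simp add: fsupp_def)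
  obtain N where N: "N \<noteq> 0" "\<forall>b\<in>{i. v i \<noteq> 0}. of_int N * v b \<in> \<int>"
    using common_denominator[OF fin] by blast
  define m where "m i = \<lfloor>of_int N * v i\<rfloor>" for i
  have m: "of_int (m i) = of_int N * v i" if "v i \<noteq> 0" for i
    using N(2) that unfolding m_def by (metis (mono_tags) Ints_cases floor_of_int mem_Collect_eq)
  have "of_int N * T v b = T (\<lambda>b. of_int N * v b) b" by (simp add: T_of_int[OF v])
  also have "(\<lambda>b. of_int N * v b) = (\<lambda>b. \<Sum>i | v i \<noteq> 0. of_int (m i) * ebas i b)"
  proof
    fix b
    have "of_int N * v b = (\<Sum>i | v i \<noteq> 0. of_int N * (v i * ebas i b))"
      by (subst fsupp_expand[OF gr_fsupp[OF v]]) (rule sum_distrib_left)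
    also have "\<dots> = (\<Sum>i | v i \<noteq> 0. of_int (m i) * ebas i b)"
      by (rule sum.cong) (auto simp: m)
    finally show "of_int N * v b = (\<Sum>i | v i \<noteq> 0. of_int (m i) * ebas i b)" .
  qed
  also have "T \<dots> = (\<lambda>b. \<Sum>i | v i \<noteq> 0. of_int (m i) * T (ebas i) b)"
    using T_sum_of_int[OF fin, of ebas m] by simp
  also have "(\<Sum>i | v i \<noteq> 0. of_int (m i) * T (ebas i) b) = of_int N * (\<Sum>i | v i \<noteq> 0. v i * T (ebas i) b)"
    unfolding sum_distrib_left by (rule sum.cong) (auto simp: m)
  finally show ?thesis using N(1) by simp
qed

text \<open>The vector \<open>v\<close> is divisible by every power of \<open>pr k\<close> in the
  source, hence its image is in the target. There \<open>c\<close> takes values in the localization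
  after each division, so \<open>c (T v)\<close> is 0. Every structural constraint on
  \<open>T\<close> is obtained from this.\<close>

lemma T_annih:
  assumes v: "v \<in> gr x" and ker: "\<And>c. annih x k c \<Longrightarrow> c v = 0" and c: "annih y k c"
  shows "c (T v) = 0"
proof (rule zloc_all_powers[OF prime_pr[of k]])
  fix j
  define r :: rat where "r = of_nat (pr k) ^ j"
  have r: "r \<noteq> 0" by (simp add: r_def)
  define u where "u = (\<lambda>b. inverse r * v b)"
  have u: "u \<in> gr x" unfolding u_def r_def by (rule gr_divide[OF v]) (rule ker)
  have "T (\<lambda>b. of_nat (pr k ^ j) * u b) = (\<lambda>b. of_nat (pr k ^ j) * T u b)" by (rule T_of_nat[OF u])
  moreover have "(\<lambda>b. of_nat (pr k ^ j) * u b) = v" using r by (auto simp: u_def r_def)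
  ultimately have "T v = (\<lambda>b. r * T u b)" by (simp add: r_def)
  then have "c (T v) = r * c (T u)"
    using flinD(2)[OF annih_flin[OF c] gr_fsupp[OF T_in[OF u]]] by simp
  then have "c (T v) / r = c (T u)" using r by simp
  then show "zloc (pr k) (c (T v) / of_nat (pr k) ^ j)"
    using T_in[OF u] c by (simp add: gr_def r_def)
qed

section \<open>Invariance under left translation and units of the group ring\<close>

lemma T_Al_outside:
  assumes "reduced w" "\<And>z. reduced z \<Longrightarrow> b \<noteq> Al n z"
  shows "T (ebas (Al n w)) b = 0"
  using assms by (intro T_annih[of _ "pair 0 n" "\<lambda>v. v b"])
    (auto elim!: annih.cases intro: annih.Al simp: ebas_eq_0_iff)

lemma T_Al'_outside:
  assumes "reduced w" "\<And>z. reduced z \<Longrightarrow> b \<noteq> Al' n z"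
  shows "T (ebas (Al' n w)) b = 0"
proof (rule T_annih[of _ "pair 1 n" "\<lambda>v. v b"])
  show "annih y (pair 1 n) (\<lambda>v. v b)" using assms(2) by (rule annih.Al')
qed (use assms(1) in \<open>auto elim!: annih.cases simp: ebas_eq_0_iff\<close>)

text \<open>The sum of \<open>Al n w\<close> and its partner in the primed copy lies in the diagonal
  subspace of index \<open>l\<close>, which \<open>T\<close> respects. The cross terms vanish
  because \<open>T\<close> maps each copy of F into its own span.\<close>

lemma T_Al_Al':
  assumes w: "reduced w" and z: "reduced z"
  shows "T (ebas (Al n w)) (Al n z) = T (ebas (Al' n (lmul_opt l w))) (Al' n (lmul_opt l z))"
proof -
  let ?v = "\<lambda>b. ebas (Al n w) b + ebas (Al' n (lmul_opt l w)) b"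
  have "T ?v (Al n z) - T ?v (Al' n (lmul_opt l z)) = 0"
  proof (rule T_annih[of _ "pair 2 (pair n l)" "\<lambda>v. v (Al n z) - v (Al' n (lmul_opt l z))"])
    show "?v \<in> gr x" by (intro gr_add gr_ebas)
  next
    fix c assume "annih x (pair 2 (pair n l)) c"
    then show "c ?v = 0"
    proof (rule annih_2E)
      fix b assume c: "c = (\<lambda>v. v b)" and "\<And>w. reduced w \<Longrightarrow> b \<noteq> Al n w" "\<And>w. reduced w \<Longrightarrow> b \<noteq> Al' n w"
      then have "b \<noteq> Al n w" "b \<noteq> Al' n (lmul_opt l w)" using w reduced_lmul_opt by blast+
      then show ?thesis by (simp add: c ebas_other)
    next
      fix w' assume "c = (\<lambda>v. v (Al n w') - v (Al' n (lmul_opt l w')))" "reduced w'"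
      then show ?thesis using w by (simp add: ebas_def lmul_opt_eq_iff)
    qed
  qed (rule annih.mul[OF z])
  moreover have "T (ebas (Al n w)) (Al' n (lmul_opt l z)) = 0" "T (ebas (Al' n (lmul_opt l w))) (Al n z) = 0"
    using w by (auto intro!: T_Al_outside T_Al'_outside reduced_lmul_opt)
  ultimately show ?thesis by (simp add: T_add)
qed

definition coef where "coef n w z = T (ebas (Al n w)) (Al n z)"

text \<open>For one letter, pass to the primed copy along its own diagonal and come back along the
  diagonal of index 0. Hence the matrix of \<open>T\<close> on a copy of F is determined by the row
  of the empty word.\<close>

lemma coef_wmul:
  assumes "reduced w" "reduced z" shows "coef n (wmul u w) (wmul u z) = coef n w z"
proof (induction u)
  case (Cons l u)
  have "coef n (lmul l (wmul u w)) (lmul l (wmul u z)) = coef n (wmul u w) (wmul u z)"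
    using T_Al_Al'[of "wmul u w" "wmul u z" n "Suc l"]
      T_Al_Al'[of "lmul l (wmul u w)" "lmul l (wmul u z)" n 0] assms
    by (simp add: coef_def lmul_opt_def reduced_wmul reduced_lmul)
  then show ?case using Cons by simp
qed simp

lemma coef_eq: "reduced w \<Longrightarrow> reduced z \<Longrightarrow> coef n w z = coef n [] (wmul (winv w) z)"
  using coef_wmul[of w z n "winv w"] by (simp add: wmul_winv_self)

lemma finite_coef: "finite {z. coef n w z \<noteq> 0}"
proof -
  have "finite {b. T (ebas (Al n w)) b \<noteq> 0}" using gr_fsupp[OF T_in] by (simp add: fsupp_def)
  then have "finite (Al n -` {b. T (ebas (Al n w)) b \<noteq> 0})" by (rule finite_vimageI) (simp add: inj_def)
  then show ?thesis by (simp add: coef_def vimage_def)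
qed

end

context group_iso
begin

interpretation inv: group_iso y x T' T by (rule sym)

text \<open>Since \<open>T\<close> preserves the span of the copy, the identity
  \<open>T' (T v) = v\<close> becomes a product of matrices indexed by reduced words.\<close>

lemma T'_T_Al:
  assumes w: "reduced w"
  shows "(\<Sum>z | reduced z \<and> coef n w z \<noteq> 0. coef n w z * T' (ebas (Al n z)) b) = ebas (Al n w) b"
proof -
  let ?v = "T (ebas (Al n w))"
  have "ebas (Al n w) b = T' ?v b" by (simp add: T'_T)
  also have "\<dots> = (\<Sum>i | ?v i \<noteq> 0. ?v i * T' (ebas i) b)" by (rule inv.T_expand) (simp add: T_in)
  also have "{i. ?v i \<noteq> 0} = Al n ` {z. reduced z \<and> coef n w z \<noteq> 0}"
  proof (intro equalityI subsetI)
    fix i assume i: "i \<in> {i. ?v i \<noteq> 0}"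
    then obtain z where "reduced z" "i = Al n z" using T_Al_outside[OF w, of i n] by auto
    then show "i \<in> Al n ` {z. reduced z \<and> coef n w z \<noteq> 0}" using i by (auto simp: coef_def)
  qed (auto simp: coef_def)
  also have "(\<Sum>i \<in> Al n ` {z. reduced z \<and> coef n w z \<noteq> 0}. ?v i * T' (ebas i) b) =
      (\<Sum>z | reduced z \<and> coef n w z \<noteq> 0. coef n w z * T' (ebas (Al n z)) b)"
    by (subst sum.reindex) (auto simp: inj_on_def coef_def)
  finally show ?thesis by simp
qed

text \<open>The restriction of T to a copy of the regular representation is right multiplication by a
  unit of the group ring. A product of two support elements that has maximal length arises in only one way and
  so does not cancel; hence all these products are the empty word.\<close>

lemma T_monomial:
  "\<exists>g q. reduced g \<and> q \<noteq> 0 \<and> (\<forall>w b. reduced w \<longrightarrow> T (ebas (Al n w)) b = q * ebas (Al n (wmul w g)) b)"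
proof -
  define U where "U = {z. reduced z \<and> coef n [] z \<noteq> 0}"
  define V where "V = {z. reduced z \<and> inv.coef n [] z \<noteq> 0}"
  have fin: "finite U" "finite V"
    using finite_coef[of n "[]"] inv.finite_coef[of n "[]"]
    by (auto simp: U_def V_def intro: finite_subset[rotated])
  have red: "reduced u" "reduced v" if "u \<in> U" "v \<in> V" for u v using that by (auto simp: U_def V_def)
  \<comment> \<open>The rows of the empty word for \<open>T\<close> and \<open>T'\<close> are
    elements of the group ring; the sum is the coefficient of \<open>z\<close> in their convolution,
    which is thus the unit element.\<close>
  have prod: "(\<Sum>u\<in>U. coef n [] u * inv.coef n [] (wmul (winv u) z)) = (if z = [] then 1 else 0)"
    if z: "reduced z" for z
  proof -
    have "(\<Sum>u\<in>U. coef n [] u * inv.coef n [] (wmul (winv u) z)) =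
        (\<Sum>u\<in>U. coef n [] u * T' (ebas (Al n u)) (Al n z))"
      using inv.coef_eq[OF _ z] by (intro sum.cong refl) (simp add: U_def inv.coef_def)
    also have "\<dots> = ebas (Al n []) (Al n z)"
      using T'_T_Al[of "[]" n] by (simp add: U_def)
    finally show ?thesis by (simp add: ebas_def)
  qed
  have nonempty: "U \<noteq> {}" "V \<noteq> {}"
  proof -
    show "U \<noteq> {}" using prod[of "[]"] by auto
    show "V \<noteq> {}"
    proof
      assume "V = {}"
      then have "inv.coef n [] (wmul (winv u) []) = 0" for u by (auto simp: V_def reduced_wmul)
      then show False using prod[of "[]"] by simp
    qed
  qed
  define L where "L = (\<lambda>(u, v). length (wmul u v)) ` (U \<times> V)"
  have L: "finite L" "L \<noteq> {}" using fin nonempty by (auto simp: L_def)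
  obtain u0 v0 where 0: "u0 \<in> U" "v0 \<in> V" "length (wmul u0 v0) = Max L"
    using Max_in[OF L] by (auto simp: L_def)
  have le: "length (wmul u v) \<le> length (wmul u0 v0)" if "u \<in> U" "v \<in> V" for u v
    unfolding 0(3) using that by (intro Max_ge[OF L(1)]) (auto simp: L_def)
  define z where "z = wmul u0 v0"
  have rz: "reduced z" using red 0 by (auto simp: z_def reduced_wmul)
  have only: "u = u0" if u: "u \<in> U" "inv.coef n [] (wmul (winv u) z) \<noteq> 0" for u
  proof -
    have v: "wmul (winv u) z \<in> V" using u rz by (simp add: V_def reduced_wmul)
    have "wmul u (wmul (winv u) z) = wmul u0 v0" using wmul_winv'[OF rz, of u] by (simp add: z_def)
    then show ?thesis
      using wmul_unique_product(1)[of u0 v0 u "wmul (winv u) z"] le red 0 u v by metis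
  qed
  have "(\<Sum>u\<in>U. coef n [] u * inv.coef n [] (wmul (winv u) z)) =
      (\<Sum>u\<in>{u0}. coef n [] u * inv.coef n [] (wmul (winv u) z))"
    using 0 fin only by (intro sum.mono_neutral_right) auto
  also have "wmul (winv u0) z = v0" using red 0 by (simp add: z_def wmul_winv)
  then have "(\<Sum>u\<in>{u0}. coef n [] u * inv.coef n [] (wmul (winv u) z)) \<noteq> 0"
    using 0 by (simp add: U_def V_def)
  finally have "z = []" using prod[OF rz] by (auto split: if_splits)
  then have Nil: "wmul u v = []" if "u \<in> U" "v \<in> V" for u v
    using le[OF that] by (simp add: z_def)
  have "u = winv v0" if "u \<in> U" for u
    using Nil[OF that 0(2)] red[OF that 0(2)] by (intro wmul_eq_Nil)
  then have U: "U = {winv v0}" using nonempty(1) by blast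
  define g where "g = winv v0"
  have g: "reduced g" unfolding g_def using red(2)[OF 0(1) 0(2)] by (rule reduced_winv)
  have "T (ebas (Al n w)) b = coef n [] g * ebas (Al n (wmul w g)) b" if w: "reduced w" for w b
  proof (cases "\<exists>z. reduced z \<and> b = Al n z")
    case True
    then obtain z where z: "reduced z" "b = Al n z" by blast
    have "T (ebas (Al n w)) b = coef n [] (wmul (winv w) z)"
      using coef_eq[OF w z(1), of n] by (simp add: coef_def z)
    moreover have "coef n [] (wmul (winv w) z) = 0" if "z \<noteq> wmul w g"
    proof (rule ccontr)
      assume "coef n [] (wmul (winv w) z) \<noteq> 0"
      then have "wmul (winv w) z \<in> U" using z by (simp add: U_def reduced_wmul)
      then have "wmul (winv w) z = g" unfolding U g_def by simp
      then show False using that wmul_winv'[OF z(1), of w] by simp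
    qed
    moreover have "wmul (winv w) (wmul w g) = g" by (rule wmul_winv[OF g])
    ultimately show ?thesis using z by (auto simp: ebas_def)
  next
    case False
    then have "T (ebas (Al n w)) b = 0" using T_Al_outside[OF w] by blast
    moreover have "b \<noteq> Al n (wmul w g)" using False reduced_wmul[OF g, of w] by blast
    ultimately show ?thesis by (simp add: ebas_def)
  qed
  moreover have "g \<in> U" unfolding U g_def by simp
  then have "coef n [] g \<noteq> 0" by (simp add: U_def)
  ultimately show ?thesis using g by blast
qed

end

context group_iso
begin

section \<open>The limit permutation\<close>

text \<open>The future graph isomorphism, read off the coefficients of \<open>T\<close> without
  mentioning the words at the levels. In this form it is visibly a Borel function of a code of
  \<open>T\<close>.\<close>

definition eps_rel :: "nat \<Rightarrow> nat \<Rightarrow> bool" where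
  "eps_rel a c \<longleftrightarrow> (\<exists>b d. a \<noteq> b \<and> c \<noteq> d \<and> T (ebas (Ep a b)) (Ep c d) \<noteq> 0)"

definition monomial where
  "monomial g q \<longleftrightarrow> (\<forall>n. reduced (g n) \<and> q n \<noteq> 0 \<and>
     (\<forall>w b. reduced w \<longrightarrow> T (ebas (Al n w)) b = q n * ebas (Al n (wmul w (g n))) b))"

lemma ex_monomial: "\<exists>g q. monomial g q"
  unfolding monomial_def using T_monomial by metis

text \<open>Modulo the kernel subspace of level n, the basis element \<open>Ep a b\<close> is the image of the pair
  (a, b) at level n, on which T acts through the permutation \<open>ia (g n)\<close>. All levels outside the support
  of \<open>T (ebas (Ep a b))\<close> must agree.\<close>

lemma T_Ep_eventually:
  assumes mon: "monomial g q" and ab: "a \<noteq> b"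
  shows "\<exists>N. \<forall>n\<ge>N. \<forall>c d. c \<noteq> d \<longrightarrow>
    T (ebas (Ep a b)) (Ep c d) = (if c = ia (g n) a \<and> d = ia (g n) b then q n else 0)"
proof -
  let ?Y = "T (ebas (Ep a b))"
  have fY: "fsupp ?Y" by (rule gr_fsupp[OF T_in]) simp
  obtain w where w: "reduced w" "ia w 0 = a" "ia w 1 = b"
    using ia_extend[of "{0,1}" "\<lambda>i. if i = 0 then a else b"] ab by (auto simp: inj_on_def)
  have kY: "kfun n c d ?Y = (if c = ia (g n) a \<and> d = ia (g n) b then q n else 0)"
    if cd: "c \<noteq> d" for n c d
  proof -
    \<comment> \<open>The difference of \<open>Ep a b\<close> and \<open>Al n w\<close> lies in the
      kernel subspace of level n, both being sent to the pair (a, b).\<close>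
    let ?e = "\<lambda>i. (-1) * ebas (Al n w) i" and ?v = "\<lambda>i. ebas (Ep a b) i + (-1) * ebas (Al n w) i"
    have e: "?e \<in> gr x" by (intro gr_mult_Ints gr_ebas) auto
    have v: "?v \<in> gr x" by (intro gr_add e gr_ebas)
    have "kfun n c d (T ?v) = 0"
    proof (rule T_annih[OF v _ annih.ker[OF cd]])
      fix c assume "annih x (pair 3 n) c"
      then obtain a' b' where c: "c = kfun n a' b'" by (rule annih_3E)
      have "c ?v = c (ebas (Ep a b)) + c ?e" unfolding c
        by (rule flinD(1)[OF flin_kfun fsupp_ebas gr_fsupp[OF e]])
      also have "c ?e = - 1 * c (ebas (Al n w))" unfolding c by (rule flinD(2)[OF flin_kfun fsupp_ebas])
      finally show "c ?v = 0" using w by (auto simp: c kfun_ebas fiber_def)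
    qed
    moreover have "T ?v = (\<lambda>i. ?Y i + T ?e i)" by (rule T_add[OF gr_ebas e])
    moreover have "T ?e = (\<lambda>i. - 1 * T (ebas (Al n w)) i)" using T_of_int[of "ebas (Al n w)" "-1"] by simp
    ultimately have "kfun n c d (\<lambda>i. ?Y i + - 1 * T (ebas (Al n w)) i) = 0" by simp
    moreover have "kfun n c d (\<lambda>i. ?Y i + - 1 * T (ebas (Al n w)) i) =
        kfun n c d ?Y + kfun n c d (\<lambda>i. - 1 * T (ebas (Al n w)) i)"
      by (rule flinD(1)[OF flin_kfun fY]) (intro fsupp_mult gr_fsupp[OF T_in] gr_ebas)
    moreover have "kfun n c d (\<lambda>i. - 1 * T (ebas (Al n w)) i) = - 1 * kfun n c d (T (ebas (Al n w)))"
      by (rule flinD(2)[OF flin_kfun]) (intro gr_fsupp[OF T_in] gr_ebas)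
    ultimately have "kfun n c d ?Y = kfun n c d (T (ebas (Al n w)))" by simp
    also have "T (ebas (Al n w)) = (\<lambda>i. q n * ebas (Al n (wmul w (g n))) i)"
      using mon w by (auto simp: monomial_def)
    also have "kfun n c d \<dots> = q n * kfun n c d (ebas (Al n (wmul w (g n))))"
      by (rule flinD(2)[OF flin_kfun]) simp
    also have "\<dots> = (if c = ia (g n) a \<and> d = ia (g n) b then q n else 0)"
      using mon w by (auto simp: kfun_ebas fiber_def ia_wmul monomial_def reduced_wmul)
    finally show ?thesis .
  qed
  \<comment> \<open>The levels met by the support of the image; the default 0 for the other basis
    elements can only enlarge the set.\<close>
  define Lv where "Lv = (\<lambda>i. case i of Al n w \<Rightarrow> n | _ \<Rightarrow> 0) ` {i. ?Y i \<noteq> 0}"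
  have Lv: "finite Lv" using fY by (simp add: Lv_def fsupp_def)
  have lev: "?Y (Al n w) = 0" if "n > Max Lv" for n w
  proof (rule ccontr)
    assume "?Y (Al n w) \<noteq> 0"
    then have "n \<in> Lv" unfolding Lv_def by (force intro: image_eqI[of _ _ "Al n w"])
    then show False using that Max_ge[OF Lv] by fastforce
  qed
  have "?Y (Ep c d) = (if c = ia (g n) a \<and> d = ia (g n) b then q n else 0)"
    if n: "n \<ge> Suc (Max Lv)" and cd: "c \<noteq> d" for n c d
  proof -
    have "{i. i \<in> fiber n c d \<and> ?Y i \<noteq> 0} = {}" using lev n by (auto simp: fiber_def)
    then have "kfun n c d ?Y = ?Y (Ep c d)" unfolding kfun_def by simp
    then show ?thesis using kY[OF cd, of n] by simp
  qed
  then show ?thesis by blast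
qed

text \<open>A nonzero coefficient at (c, d) pins down the action of all late words on a, whichever b
  and d witness it. Conversely any second number serves as witness; \<open>Suc a\<close> is simply
  one that differs from a.\<close>

lemma eps_rel_iff:
  assumes mon: "monomial g q"
  shows "eps_rel a c \<longleftrightarrow> (\<exists>N. \<forall>n\<ge>N. ia (g n) a = c)"
proof
  assume "eps_rel a c"
  then obtain b d where *: "a \<noteq> b" "c \<noteq> d" "T (ebas (Ep a b)) (Ep c d) \<noteq> 0"
    unfolding eps_rel_def by blast
  obtain N where "\<forall>n\<ge>N. \<forall>c d. c \<noteq> d \<longrightarrow>
    T (ebas (Ep a b)) (Ep c d) = (if c = ia (g n) a \<and> d = ia (g n) b then q n else 0)"
    using T_Ep_eventually[OF mon *(1)] by blast
  then have "\<forall>n\<ge>N. ia (g n) a = c" using * by metis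
  then show "\<exists>N. \<forall>n\<ge>N. ia (g n) a = c" by blast
next
  assume "\<exists>N. \<forall>n\<ge>N. ia (g n) a = c"
  then obtain N where N: "\<forall>n\<ge>N. ia (g n) a = c" by blast
  have ab: "a \<noteq> Suc a" by simp
  obtain N' where N': "\<forall>n\<ge>N'. \<forall>c d. c \<noteq> d \<longrightarrow>
    T (ebas (Ep a (Suc a))) (Ep c d) = (if c = ia (g n) a \<and> d = ia (g n) (Suc a) then q n else 0)"
    using T_Ep_eventually[OF mon ab] by blast
  define n where "n = max N N'"
  have "c \<noteq> ia (g n) (Suc a)" using N[rule_format, of n] ia_eq_iff[of "g n" a "Suc a"] by (simp add: n_def)
  moreover have "T (ebas (Ep a (Suc a))) (Ep c (ia (g n) (Suc a))) = q n"
    using N N'[rule_format, OF _ calculation, of n] by (simp add: n_def)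
  moreover have "q n \<noteq> 0" using mon by (simp add: monomial_def)
  ultimately show "eps_rel a c" unfolding eps_rel_def using ab by metis
qed

text \<open>Convergence at a: at a sufficiently late level \<open>N\<close> the coefficient at the
  pair prescribed by that level is \<open>q N\<close>, and a nonzero coefficient already fixes the
  limit.\<close>

lemma eps_rel_total:
  assumes mon: "monomial g q" shows "\<exists>c. eps_rel a c"
proof -
  have ab: "a \<noteq> Suc a" by simp
  obtain N where N: "\<forall>n\<ge>N. \<forall>c d. c \<noteq> d \<longrightarrow>
    T (ebas (Ep a (Suc a))) (Ep c d) = (if c = ia (g n) a \<and> d = ia (g n) (Suc a) then q n else 0)"
    using T_Ep_eventually[OF mon ab] by blast
  have "T (ebas (Ep a (Suc a))) (Ep (ia (g N) a) (ia (g N) (Suc a))) = q N"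
    using N[rule_format, of N "ia (g N) a" "ia (g N) (Suc a)"] by simp
  moreover have "q N \<noteq> 0" using mon by (simp add: monomial_def)
  ultimately show ?thesis unfolding eps_rel_def using ab ia_eq_iff by metis
qed

lemma eps_rel_edge:
  assumes mon: "monomial g q" and ab: "a \<noteq> b" and ac: "eps_rel a c" and bd: "eps_rel b d"
  shows "x a b = y c d"
proof -
  obtain N where N: "\<forall>n\<ge>N. ia (g n) a = c" using ac unfolding eps_rel_iff[OF mon] by blast
  obtain M where M: "\<forall>n\<ge>M. ia (g n) b = d" using bd unfolding eps_rel_iff[OF mon] by blast
  obtain K where K: "\<forall>n\<ge>K. \<forall>c d. c \<noteq> d \<longrightarrow>
    T (ebas (Ep a b)) (Ep c d) = (if c = ia (g n) a \<and> d = ia (g n) b then q n else 0)"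
    using T_Ep_eventually[OF mon ab] by blast
  define n where "n = max N (max M K)"
  have n: "ia (g n) a = c" "ia (g n) b = d" using N M by (simp_all add: n_def)
  then have cd: "c \<noteq> d" using ab by auto
  have "T (ebas (Ep a b)) (Ep c d) = q n" using K[rule_format, OF _ cd, of n] n by (simp add: n_def)
  then have nz: "T (ebas (Ep a b)) (Ep c d) \<noteq> 0" using mon by (simp add: monomial_def)
  \<comment> \<open>The functionals of this index are the coordinates at pairs whose status in
    \<open>x\<close> is opposite to that of (a, b); all of them vanish on
    \<open>Ep a b\<close>.\<close>
  define k where "k = pair 4 (if x a b then 1 else 0)"
  show ?thesis
  proof (rule ccontr)
    assume "x a b \<noteq> y c d"
    then have "annih y k (\<lambda>v. v (Ep c d))"
      using cd by (cases "x a b") (simp_all add: k_def annih.edge annih.nonedge del: One_nat_def)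
    moreover have "c' (ebas (Ep a b)) = 0" if "annih x k c'" for c'
      using that unfolding k_def by (rule annih_4E) (auto simp: ebas_eq_0_iff split: if_splits)
    ultimately have "T (ebas (Ep a b)) (Ep c d) = 0"
      using T_annih[of "ebas (Ep a b)" k "\<lambda>v. v (Ep c d)"] by simp
    then show False using nz by simp
  qed
qed

interpretation inv: group_iso y x T' T by (rule sym)

lemma monomial_inverse:
  assumes mon: "monomial g q" and mon': "inv.monomial g' q'"
  shows "wmul (g n) (g' n) = []"
proof -
  have red: "reduced (g n)" "reduced (g' n)" using mon mon' by (auto simp: monomial_def inv.monomial_def)
  have qs: "q n \<noteq> 0" "q' n \<noteq> 0" using mon mon' by (auto simp: monomial_def inv.monomial_def)
  have "T (ebas (Al n [])) = (\<lambda>b. q n * ebas (Al n (g n)) b)"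
    using mon by (auto simp: monomial_def)
  moreover have "T (ebas (Al n [])) \<in> gr y" by (rule T_in) simp
  ultimately have in_y: "(\<lambda>b. q n * ebas (Al n (g n)) b) \<in> gr y" by simp
  have supp: "{b. q n * ebas (Al n (g n)) b \<noteq> 0} = {Al n (g n)}" using qs by (auto simp: ebas_eq_0_iff)
  have "ebas (Al n []) (Al n []) = T' (T (ebas (Al n []))) (Al n [])" by (simp add: T'_T)
  also have "T (ebas (Al n [])) = (\<lambda>b. q n * ebas (Al n (g n)) b)"
    using mon by (auto simp: monomial_def)
  also have "T' \<dots> (Al n []) = q n * T' (ebas (Al n (g n))) (Al n [])"
    unfolding inv.T_expand[OF in_y] supp by simp
  also have "T' (ebas (Al n (g n))) (Al n []) = q' n * ebas (Al n (wmul (g n) (g' n))) (Al n [])"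
    using mon' red by (simp add: inv.monomial_def)
  finally show ?thesis by (auto simp: ebas_def split: if_splits)
qed

theorem graph_iso:
  "\<exists>f. bij f \<and> (\<forall>a b. a \<noteq> b \<longrightarrow> x a b = y (f a) (f b)) \<and> (\<forall>a c. eps_rel a c \<longleftrightarrow> c = f a)"
proof -
  obtain g q where mon: "monomial g q" using ex_monomial by blast
  obtain g' q' where mon': "inv.monomial g' q'" using inv.ex_monomial by blast
  have inv1: "ia (g' n) (ia (g n) a) = a" for n a
    using ia_wmul[of "g n" "g' n" a] monomial_inverse[OF mon mon', of n] by simp
  have inv2: "ia (g n) (ia (g' n) a) = a" for n a
    using inv1[of n "ia (winv (g' n)) a"] by (metis ia_winv ia_eq_iff inv1)
  obtain f where f: "eps_rel a (f a)" for a using eps_rel_total[OF mon] by metis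
  have uniq: "c = f a" if ac: "eps_rel a c" for a c
  proof -
    obtain N M where "\<forall>n\<ge>N. ia (g n) a = c" "\<forall>n\<ge>M. ia (g n) a = f a"
      using ac f[of a] unfolding eps_rel_iff[OF mon] by blast
    then show ?thesis using max.cobounded1[of N M] max.cobounded2[of M N] by metis
  qed
  have inj: "inj f"
  proof
    fix a b assume eq: "f a = f b"
    obtain N M where "\<forall>n\<ge>N. ia (g n) a = f a" "\<forall>n\<ge>M. ia (g n) b = f b"
      using f[of a] f[of b] unfolding eps_rel_iff[OF mon] by blast
    then have "ia (g (max N M)) a = ia (g (max N M)) b" using eq by simp
    then show "a = b" by simp
  qed
  \<comment> \<open>A pointwise limit of permutations need not be onto. The preimage comes from the
    inverse isomorphism, whose words act as the inverse permutations and converge as well.\<close>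
  have "\<exists>a. c = f a" for c
  proof -
    obtain a where "inv.eps_rel c a" using inv.eps_rel_total[OF mon'] by blast
    then obtain N where "\<forall>n\<ge>N. ia (g' n) c = a" unfolding inv.eps_rel_iff[OF mon'] by blast
    then have "\<forall>n\<ge>N. ia (g n) a = c" using inv2 by blast
    then have "eps_rel a c" unfolding eps_rel_iff[OF mon] by blast
    then show ?thesis using uniq by blast
  qed
  then have "surj f" by (auto simp: surj_def)
  with inj have "bij f" by (simp add: bij_def)
  moreover have "x a b = y (f a) (f b)" if "a \<noteq> b" for a b
    by (rule eps_rel_edge[OF mon that f f])
  ultimately show ?thesis using f uniq by blast
qed

end

section \<open>Graph isomorphisms induce group isomorphisms\<close>

definition pair_word :: "nat \<Rightarrow> nat \<Rightarrow> nat list" where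
  "pair_word a b = (SOME w. reduced w \<and> ia w 0 = a \<and> ia w 1 = b)"

lemma pair_word:
  assumes "a \<noteq> b"
  shows "reduced (pair_word a b)" "ia (pair_word a b) 0 = a" "ia (pair_word a b) 1 = b"
proof -
  have "\<exists>w. reduced w \<and> ia w 0 = a \<and> ia w 1 = b"
    using ia_extend[of "{0,1}" "\<lambda>i. if i = 0 then a else b"] assms by (auto simp: inj_on_def)
  then have "reduced (pair_word a b) \<and> ia (pair_word a b) 0 = a \<and> ia (pair_word a b) 1 = b"
    unfolding pair_word_def by (rule someI_ex)
  then show "reduced (pair_word a b)" "ia (pair_word a b) 0 = a" "ia (pair_word a b) 1 = b" by blast+
qed

text \<open>The bound on m makes the set finite for arbitrary \<open>g\<close>. For words that agree
  with \<pi> below their level it excludes nothing, as \<open>bad_eq\<close> shows.\<close>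

definition bad :: "(nat \<Rightarrow> nat) \<Rightarrow> (nat \<Rightarrow> nat list) \<Rightarrow> nat \<Rightarrow> nat \<Rightarrow> nat set" where
  "bad \<pi> g a b = {m. m \<le> max a b \<and> (ia (g m) a \<noteq> \<pi> a \<or> ia (g m) b \<noteq> \<pi> b)}"

lemma finite_bad [simp]: "finite (bad \<pi> g a b)"
  by (rule finite_subset[of _ "{..max a b}"]) (auto simp: bad_def)

text \<open>\<open>Ep a b\<close> is sent to \<open>Ep (\<pi> a) (\<pi> b)\<close>, corrected at the finitely many levels where the word
  does not yet act on a and b as \<open>\<pi>\<close> does.\<close>

fun tau :: "(nat \<Rightarrow> nat) \<Rightarrow> (nat \<Rightarrow> nat list) \<Rightarrow> bas \<Rightarrow> vec" where
  "tau \<pi> g (Al n w) = ebas (Al n (if reduced w then wmul w (g n) else w))"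
| "tau \<pi> g (Al' n w) = ebas (Al' n (if reduced w then wmul w (g n) else w))"
| "tau \<pi> g (Ep a b) = (\<lambda>i. ebas (Ep (\<pi> a) (\<pi> b)) i + (if a = b then 0 else
     \<Sum>m\<in>bad \<pi> g a b. ebas (Al m (wmul (pair_word a b) (g m))) i - ebas (Al m (pair_word (\<pi> a) (\<pi> b))) i))"

definition tmap :: "(nat \<Rightarrow> nat) \<Rightarrow> (nat \<Rightarrow> nat list) \<Rightarrow> vec \<Rightarrow> vec" where
  "tmap \<pi> g v = (\<lambda>b. \<Sum>i | v i \<noteq> 0. v i * tau \<pi> g i b)"

lemma fsupp_diff: "fsupp u \<Longrightarrow> fsupp v \<Longrightarrow> fsupp (\<lambda>b. u b - v b)"
  using fsupp_add[of u "\<lambda>b. (-1) * v b"] fsupp_mult[of v "-1"] by simp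

lemma fsupp_tau: "fsupp (tau \<pi> g i)"
proof (cases i)
  case (Ep a b)
  show ?thesis by (cases "a = b") (auto simp: Ep intro!: fsupp_add fsupp_diff fsupp_sum)
qed auto

lemma tau_Ints: "tau \<pi> g i b \<in> \<int>"
  by (cases i) (auto intro!: Ints_add Ints_sum Ints_diff)

lemma fsupp_tmap: "fsupp (tmap \<pi> g v)"
  unfolding tmap_def by (intro fsupp_sum fsupp_mult fsupp_tau)

lemma tmap_eq:
  assumes "finite S" "{i. v i \<noteq> 0} \<subseteq> S" shows "tmap \<pi> g v b = (\<Sum>i\<in>S. v i * tau \<pi> g i b)"
  unfolding tmap_def using assms by (intro sum.mono_neutral_left) auto

lemma tmap_add:
  assumes "fsupp u" "fsupp v"
  shows "tmap \<pi> g (\<lambda>b. u b + v b) = (\<lambda>b. tmap \<pi> g u b + tmap \<pi> g v b)"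
proof
  fix b
  have f: "finite ({i. u i \<noteq> 0} \<union> {i. v i \<noteq> 0})" using assms by (simp add: fsupp_def)
  show "tmap \<pi> g (\<lambda>b. u b + v b) b = tmap \<pi> g u b + tmap \<pi> g v b"
    by (subst (1 2 3) tmap_eq[OF f]) (auto simp: sum.distrib algebra_simps)
qed

lemma flin_tmap_coord: "flin (\<lambda>v. tmap \<pi> g v b)"
  unfolding flin_def
proof (intro conjI allI impI)
  fix r v assume "fsupp v"
  then have f: "finite {i. v i \<noteq> 0}" by (simp add: fsupp_def)
  show "tmap \<pi> g (\<lambda>b. r * v b) b = r * tmap \<pi> g v b"
    by (subst (1 2) tmap_eq[OF f]) (auto simp: algebra_simps sum_distrib_left)
qed (simp add: tmap_add)

lemma tmap_ebas: "tmap \<pi> g (ebas i) = tau \<pi> g i"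
proof
  fix b show "tmap \<pi> g (ebas i) b = tau \<pi> g i b"
    by (subst tmap_eq[of "{i}"]) (auto simp: ebas_eq_0_iff)
qed

lemma flin_tmap:
  assumes "flin c" "fsupp v" shows "c (tmap \<pi> g v) = (\<Sum>i | v i \<noteq> 0. v i * c (tau \<pi> g i))"
  unfolding tmap_def using assms by (intro flin_sum fsupp_tau) (auto simp: fsupp_def[of v])

lemma flin_tau_Ep:
  assumes c: "flin c" and ab: "a \<noteq> b"
  shows "c (tau \<pi> g (Ep a b)) = c (ebas (Ep (\<pi> a) (\<pi> b))) +
    (\<Sum>m\<in>bad \<pi> g a b. c (ebas (Al m (wmul (pair_word a b) (g m)))) - c (ebas (Al m (pair_word (\<pi> a) (\<pi> b)))))"
proof -
  have diff: "c (\<lambda>i. ebas k i - ebas l i) = c (ebas k) - c (ebas l)" for k l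
    using flinD(1)[OF c, of "ebas k" "\<lambda>i. -1 * ebas l i"] flinD(2)[OF c, of "ebas l" "-1"]
      fsupp_mult[OF fsupp_ebas, of "-1" l] by simp
  let ?d = "\<lambda>m i. ebas (Al m (wmul (pair_word a b) (g m))) i - ebas (Al m (pair_word (\<pi> a) (\<pi> b))) i"
  have "c (tau \<pi> g (Ep a b)) = c (\<lambda>i. ebas (Ep (\<pi> a) (\<pi> b)) i + (\<Sum>m\<in>bad \<pi> g a b. 1 * ?d m i))"
    using ab by simp
  also have "\<dots> = c (ebas (Ep (\<pi> a) (\<pi> b))) + c (\<lambda>i. \<Sum>m\<in>bad \<pi> g a b. 1 * ?d m i)"
    by (rule flinD(1)[OF c]) (intro fsupp_ebas fsupp_sum fsupp_mult fsupp_diff)+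
  also have "c (\<lambda>i. \<Sum>m\<in>bad \<pi> g a b. 1 * ?d m i) = (\<Sum>m\<in>bad \<pi> g a b. 1 * c (?d m))"
    by (rule flin_sum[OF c]) (auto intro: fsupp_diff)
  finally show ?thesis by (simp add: diff)
qed

section \<open>The group isomorphism given by approximating words\<close>

text \<open>The words have to approximate \<pi> and its inverse alike: \<open>ia_g'\<close> is what
  makes the situation symmetric, with the inverse words approximating \<pi>'.\<close>

locale graph_perm =
  fixes x y :: "nat \<Rightarrow> nat \<Rightarrow> bool" and \<pi> \<pi>' :: "nat \<Rightarrow> nat" and g :: "nat \<Rightarrow> nat list"
  assumes left_inv: "\<pi>' (\<pi> a) = a"
    and right_inv: "\<pi> (\<pi>' a) = a"
    and edges: "a \<noteq> b \<Longrightarrow> x a b = y (\<pi> a) (\<pi> b)"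
    and red_g: "reduced (g n)"
    and ia_g: "a < n \<Longrightarrow> ia (g n) a = \<pi> a"
    and ia_g': "b < n \<Longrightarrow> ia (g n) (\<pi>' b) = b"
begin

lemma pi_eq_iff [simp]: "\<pi> a = \<pi> b \<longleftrightarrow> a = b"
  by (metis left_inv)

lemma pi'_eq_iff [simp]: "\<pi>' a = \<pi>' b \<longleftrightarrow> a = b"
  by (metis right_inv)

lemma sym: "graph_perm y x \<pi>' \<pi> (\<lambda>n. winv (g n))"
proof
  fix a n :: nat assume "a < n"
  then show "ia (winv (g n)) a = \<pi>' a" "ia (winv (g n)) (\<pi> a) = a"
    using ia_winv(1)[of "g n" "\<pi>' a"] ia_winv(1)[of "g n" a] ia_g ia_g' by simp_all
next
  fix a b :: nat assume "a \<noteq> b"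
  then show "y a b = x (\<pi>' a) (\<pi>' b)" using edges[of "\<pi>' a" "\<pi>' b"] by (simp add: right_inv)
qed (simp_all add: left_inv right_inv reduced_winv red_g)

lemma bad_eq: "bad \<pi> g a b = {m. ia (g m) a \<noteq> \<pi> a \<or> ia (g m) b \<noteq> \<pi> b}"
proof -
  have "m \<le> max a b" if "ia (g m) a \<noteq> \<pi> a \<or> ia (g m) b \<noteq> \<pi> b" for m
    using that ia_g[of a m] ia_g[of b m] by (cases "a < m"; cases "b < m") auto
  then show ?thesis by (auto simp: bad_def)
qed

lemma wmul_g_eq_iff:
  assumes "reduced w" "reduced z" shows "z = wmul w (g n) \<longleftrightarrow> w = wmul z (winv (g n))"
proof -
  have 1: "wmul (wmul u (g n)) (winv (g n)) = u" if "reduced u" for u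
    unfolding wmul_assoc[OF reduced_winv[OF red_g]] wmul_winv_self(2)[OF red_g]
    by (rule wmul_Nil_right[OF that])
  have 2: "wmul (wmul u (winv (g n))) (g n) = u" if "reduced u" for u
    unfolding wmul_assoc[OF red_g] wmul_winv_self(1)[OF red_g]
    by (rule wmul_Nil_right[OF that])
  show ?thesis using 1[OF assms(1)] 2[OF assms(2)] by metis
qed

text \<open>The basis element whose image under \<open>tau\<close> has leading term b, corrections
  disregarded.\<close>

fun pre :: "bas \<Rightarrow> bas" where
  "pre (Al n w) = Al n (if reduced w then wmul w (winv (g n)) else w)"
| "pre (Al' n w) = Al' n (if reduced w then wmul w (winv (g n)) else w)"
| "pre (Ep a b) = Ep (\<pi>' a) (\<pi>' b)"

lemma red_wmul_g [simp]: "reduced (wmul w (g n))" "reduced (wmul w (winv (g n)))"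
  by (simp_all add: reduced_wmul red_g reduced_winv)

text \<open>Apart from the corrections \<open>tau\<close> permutes the basis. Corrections come from
  elements \<open>Ep\<close> only and are visible only at reduced words of unprimed copies.\<close>

lemma tau_coord:
  "tau \<pi> g i b = ebas i (pre b) \<or> (\<exists>a c. i = Ep a c) \<and> (\<exists>m w. b = Al m w \<and> reduced w)"
proof (cases i)
  case (Al n w)
  show ?thesis
  proof (cases b)
    case b: (Al m z)
    show ?thesis using wmul_g_eq_iff[of w z n] by (auto simp: Al b ebas_def)
  qed (auto simp: Al ebas_def)
next
  case (Al' n w)
  show ?thesis
  proof (cases b)
    case b: (Al' m z)
    show ?thesis using wmul_g_eq_iff[of w z n] by (auto simp: Al' b ebas_def)
  qed (auto simp: Al' ebas_def)
next
  case (Ep a c)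
  show ?thesis
  proof (cases b)
    case b: (Al m z)
    show ?thesis
    proof (cases "reduced z \<or> a = c")
      case False
      then have "pair_word (\<pi> a) (\<pi> c) \<noteq> z" using pair_word(1)[of "\<pi> a" "\<pi> c"] by auto
      moreover have "wmul u (g k) \<noteq> z" for u k using False red_wmul_g(1)[of u k] by auto
      ultimately have "tau \<pi> g i b = 0"
        using False by (simp add: Ep b ebas_def) (auto intro!: sum.neutral)
      moreover have "ebas i (pre b) = 0" by (simp add: Ep b ebas_def)
      ultimately show ?thesis by simp
    qed (auto simp: Ep b ebas_def)
  next
    case b: (Al' m z)
    show ?thesis by (auto simp: Ep b ebas_def)
  next
    case b: (Ep u v)
    have "Ep u v = Ep (\<pi> a) (\<pi> c) \<longleftrightarrow> Ep (\<pi>' u) (\<pi>' v) = Ep a c" by (metis bas.inject(3) left_inv right_inv)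
    then show ?thesis by (auto simp: Ep b ebas_def)
  qed
qed

text \<open>This is the purpose of the corrections. At a bad level n they replace the pair (\<pi> a,
  \<pi> b) by the pair to which \<open>g n\<close> moves (a, b); at a good level the two pairs
  agree. So level n always sees exactly the action of \<open>g n\<close>.\<close>

lemma kfun_tau:
  assumes cd: "c \<noteq> d"
  shows "kfun n c d (tau \<pi> g i) = kfun n (ia (winv (g n)) c) (ia (winv (g n)) d) (ebas i)"
proof -
  have iff: "ia (g n) a = c \<longleftrightarrow> a = ia (winv (g n)) c" for a c by (metis ia_winv)
  show ?thesis
  proof (cases i)
    case (Al m w)
    show ?thesis by (auto simp: Al kfun_ebas fiber_def ia_wmul iff)
  next
    case (Al' m w)
    show ?thesis by (auto simp: Al' kfun_ebas fiber_def)
  next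
    case (Ep a b)
    show ?thesis
    proof (cases "a = b")
      case True
      then show ?thesis using cd by (auto simp: Ep kfun_ebas fiber_def)
    next
      case ab: False
      have pab: "\<pi> a \<noteq> \<pi> b" using ab by simp
      let ?P = "\<lambda>a b. (if a = c \<and> b = d then 1 else 0) :: rat"
      have "(\<Sum>m\<in>bad \<pi> g a b. kfun n c d (ebas (Al m (wmul (pair_word a b) (g m)))) -
              kfun n c d (ebas (Al m (pair_word (\<pi> a) (\<pi> b))))) =
          (\<Sum>m\<in>bad \<pi> g a b. if m = n then ?P (ia (g n) a) (ia (g n) b) - ?P (\<pi> a) (\<pi> b) else 0)"
        using pair_word[OF ab] pair_word[OF pab]
        by (intro sum.cong refl) (auto simp: kfun_ebas fiber_def ia_wmul)
      also have "\<dots> = (if n \<in> bad \<pi> g a b then ?P (ia (g n) a) (ia (g n) b) - ?P (\<pi> a) (\<pi> b) else 0)"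
        by (rule sum.delta[OF finite_bad])
      also have "\<dots> = ?P (ia (g n) a) (ia (g n) b) - ?P (\<pi> a) (\<pi> b)"
        by (auto simp: bad_eq)
      finally have "kfun n c d (tau \<pi> g (Ep a b)) = ?P (ia (g n) a) (ia (g n) b)"
        unfolding flin_tau_Ep[OF flin_kfun ab] by (auto simp: kfun_ebas fiber_def)
      then show ?thesis by (auto simp: Ep kfun_ebas fiber_def iff)
    qed
  qed
qed

text \<open>The pullback of \<open>c\<close> along \<open>tmap\<close> differs from
  \<open>c0\<close> only by integer multiples of coordinates that are themselves among the
  functionals of index k, hence harmless.\<close>

lemma zloc_tmap:
  assumes v: "v \<in> gr x" and c: "flin c" "\<And>i. c (tau \<pi> g i) \<in> \<int>"
    and c0: "annih x k c0"
    and eq: "\<And>i. c (tau \<pi> g i) = c0 (ebas i) \<or> annih x k (\<lambda>v. v i)"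
  shows "zloc (pr k) (c (tmap \<pi> g v))"
proof -
  have fv: "fsupp v" by (rule gr_fsupp[OF v])
  have "c (tmap \<pi> g v) = c0 v + (\<Sum>i | v i \<noteq> 0. v i * (c (tau \<pi> g i) - c0 (ebas i)))"
    unfolding flin_tmap[OF c(1) fv] flin_expand[OF annih_flin[OF c0] fv]
    by (simp add: sum.distrib[symmetric] algebra_simps)
  moreover have "zloc (pr k) (v i * (c (tau \<pi> g i) - c0 (ebas i)))" for i
  proof (cases "c (tau \<pi> g i) = c0 (ebas i)")
    case False
    then have "zloc (pr k) (v i)" using eq[of i] v by (auto simp: gr_def)
    then show ?thesis by (rule zloc_mult_Ints) (intro Ints_diff c(2) annih_ebas[OF c0])
  qed (simp add: zloc_Ints)
  ultimately show ?thesis using v c0 by (auto intro!: zloc_add zloc_sum simp: gr_def)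
qed

lemma zloc_tmap_coord:
  assumes v: "v \<in> gr x" and c0: "annih x k (\<lambda>v. v (pre b))"
    and Ep: "\<And>a c m w. b = Al m w \<Longrightarrow> annih x k (\<lambda>v. v (Ep a c))"
  shows "zloc (pr k) (tmap \<pi> g v b)"
proof (rule zloc_tmap[OF v _ _ c0, where c = "\<lambda>v. v b"])
  fix i show "tau \<pi> g i b = ebas i (pre b) \<or> annih x k (\<lambda>v. v i)"
    using tau_coord[of i b] Ep by blast
qed (auto simp: tau_Ints)

text \<open>Each functional for \<open>y\<close> pulls back to one of the same index for
  \<open>x\<close>, up to coordinates at \<open>Ep\<close>. Wherever a correction can show up as an
  error, these coordinates are functionals of that index too; the kernel functionals need no such
  allowance by \<open>kfun_tau\<close>.\<close>

lemma tmap_gr: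
  assumes v: "v \<in> gr x" shows "tmap \<pi> g v \<in> gr y"
proof -
  have "zloc (pr k) (c (tmap \<pi> g v))" if "annih y k c" for k c
    using that
  proof (induction rule: annih.induct)
    case (Al b n)
    have "pre b \<noteq> Al n w" if "reduced w" for w
      using Al[of "wmul w (g n)"] Al[of w] that wmul_g_eq_iff by (cases b) (auto split: if_splits)
    then show ?case by (intro zloc_tmap_coord[OF v] annih.Al) auto
  next
    case (Al' b n)
    have "pre b \<noteq> Al' n w" if "reduced w" for w
      using Al'[of "wmul w (g n)"] Al'[of w] that wmul_g_eq_iff by (cases b) (auto split: if_splits)
    then show ?case by (intro zloc_tmap_coord[OF v] annih.Al') auto
  next
    case (off b n l)
    have "pre b \<noteq> Al n w" "pre b \<noteq> Al' n w" if "reduced w" for w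
      using off[of "wmul w (g n)"] off[of w] that wmul_g_eq_iff by (cases b; auto split: if_splits)+
    then show ?case by (intro zloc_tmap_coord[OF v] annih.off) auto
  next
    case (mul w n l)
    let ?w = "wmul w (winv (g n))"
    have pre: "pre (Al n w) = Al n ?w" "pre (Al' n (lmul_opt l w)) = Al' n (lmul_opt l ?w)"
      using mul reduced_lmul_opt[OF mul, of l] by (auto simp: lmul_opt_wmul reduced_winv red_g)
    show ?case
    proof (rule zloc_tmap[OF v, where c = "\<lambda>v. v (Al n w) - v (Al' n (lmul_opt l w))"])
      show "annih x (pair 2 (pair n l)) (\<lambda>v. v (Al n ?w) - v (Al' n (lmul_opt l ?w)))"
        by (rule annih.mul) simp
      fix i
      show "tau \<pi> g i (Al n w) - tau \<pi> g i (Al' n (lmul_opt l w)) \<in> \<int>" by (intro Ints_diff tau_Ints)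
      show "tau \<pi> g i (Al n w) - tau \<pi> g i (Al' n (lmul_opt l w)) =
          ebas i (Al n ?w) - ebas i (Al' n (lmul_opt l ?w)) \<or>
          annih x (pair 2 (pair n l)) (\<lambda>v. v i)"
        using tau_coord[of i "Al n w"] tau_coord[of i "Al' n (lmul_opt l w)"] annih.off[of i n x l]
        unfolding pre by auto
    qed simp
  next
    case (ker c d n)
    then have "ia (winv (g n)) c \<noteq> ia (winv (g n)) d" by simp
    from annih.ker[OF this]
    have c0: "annih x (pair 3 n) (kfun n (ia (winv (g n)) c) (ia (winv (g n)) d))" .
    show ?case
      by (rule zloc_tmap[OF v flin_kfun _ c0]) (simp_all add: kfun_tau[OF ker] annih_ebas[OF c0])
  next
    case (edge a b)
    then show ?case using edges[of "\<pi>' a" "\<pi>' b"]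
      by (intro zloc_tmap_coord[OF v]) (auto simp: right_inv intro!: annih.edge)
  next
    case (nonedge a b)
    then have "annih x (pair 4 1) (\<lambda>v. v (Ep (\<pi>' a) (\<pi>' b)))"
      using edges[of "\<pi>' a" "\<pi>' b"] by (intro annih.nonedge) (auto simp: right_inv)
    then show ?case by (intro zloc_tmap_coord[OF v]) auto
  qed
  then show ?thesis by (simp add: gr_def fsupp_tmap)
qed

lemma tmap_inverse:
  assumes v: "fsupp v" shows "tmap \<pi>' (\<lambda>n. winv (g n)) (tmap \<pi> g v) = v"
proof
  interpret inv: graph_perm y x \<pi>' \<pi> "\<lambda>n. winv (g n)" by (rule sym)
  have cancel: "wmul (wmul w (g n)) (winv (g n)) = w" if "reduced w" for w n
    using wmul_g_eq_iff[OF that red_wmul_g(1)] by metis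
  have tau_inv: "tmap \<pi>' (\<lambda>n. winv (g n)) (tau \<pi> g i) b = ebas i b" for i b
  proof (cases i)
    case (Al n w)
    then show ?thesis by (simp add: tmap_ebas cancel)
  next
    case (Al' n w)
    then show ?thesis by (simp add: tmap_ebas cancel)
  next
    case (Ep u v)
    show ?thesis
    proof (cases "u = v")
      case True
      then show ?thesis by (simp add: Ep tmap_ebas left_inv)
    next
      case uv: False
      then have puv: "\<pi> u \<noteq> \<pi> v" by simp
      \<comment> \<open>With the same bad levels on both sides, the corrections of the two maps
        cancel term by term.\<close>
      have bad: "bad \<pi>' (\<lambda>n. winv (g n)) (\<pi> u) (\<pi> v) = bad \<pi> g u v"
        unfolding inv.bad_eq bad_eq left_inv using ia_winv by metis
      show ?thesis
        unfolding Ep flin_tau_Ep[OF flin_tmap_coord uv] tmap_ebas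
        using uv pair_word(1)[OF uv] pair_word(1)[OF puv]
        by (simp add: bad left_inv cancel sum_subtractf)
    qed
  qed
  fix b
  have "tmap \<pi>' (\<lambda>n. winv (g n)) (tmap \<pi> g v) b = (\<Sum>i | v i \<noteq> 0. v i * ebas i b)"
    unfolding flin_tmap[OF flin_tmap_coord v] tau_inv ..
  then show "tmap \<pi>' (\<lambda>n. winv (g n)) (tmap \<pi> g v) b = v b"
    unfolding fsupp_expand[OF v, of b, symmetric] .
qed

lemma group_iso: "group_iso x y (tmap \<pi> g) (tmap \<pi>' (\<lambda>n. winv (g n)))"
proof -
  interpret inv: graph_perm y x \<pi>' \<pi> "\<lambda>n. winv (g n)" by (rule sym)
  show ?thesis
    using inv.tmap_gr inv.tmap_inverse
    by unfold_locales (auto simp: tmap_gr tmap_inverse tmap_add gr_fsupp)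
qed

end

text \<open>Only the values of \<pi> and \<pi>' below n enter, so the choice is local in the
  permutation; this is exploited in \<open>approx_cong\<close>.\<close>

definition approx :: "(nat \<Rightarrow> nat) \<Rightarrow> (nat \<Rightarrow> nat) \<Rightarrow> nat \<Rightarrow> nat list" where
  "approx \<pi> \<pi>' n = (SOME w. reduced w \<and> (\<forall>a<n. ia w a = \<pi> a) \<and> (\<forall>b<n. ia w (\<pi>' b) = b))"

theorem graph_perm_approx:
  assumes inv: "\<And>a. \<pi>' (\<pi> a) = a" "\<And>a. \<pi> (\<pi>' a) = a"
    and edges: "\<And>a b. a \<noteq> b \<Longrightarrow> x a b = y (\<pi> a) (\<pi> b)"
  shows "graph_perm x y \<pi> \<pi>' (approx \<pi> \<pi>')"
proof -
  have ap: "reduced (approx \<pi> \<pi>' n) \<and> (\<forall>a<n. ia (approx \<pi> \<pi>' n) a = \<pi> a) \<and> (\<forall>b<n. ia (approx \<pi> \<pi>' n) (\<pi>' b) = b)" for n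
  proof -
    \<comment> \<open>One word meets both requirements, since \<pi> takes the value b at \<pi>'
      b.\<close>
    have "inj_on \<pi> ({..<n} \<union> \<pi>' ` {..<n})" by (metis inj_onI inv(1))
    from ia_extend[OF _ this] obtain w where "reduced w" "\<forall>a\<in>{..<n} \<union> \<pi>' ` {..<n}. ia w a = \<pi> a" by auto
    then have "\<exists>w. reduced w \<and> (\<forall>a<n. ia w a = \<pi> a) \<and> (\<forall>b<n. ia w (\<pi>' b) = b)" using inv by auto
    then show ?thesis unfolding approx_def by (rule someI_ex)
  qed
  show ?thesis by unfold_locales (use inv edges ap in auto)
qed

section \<open>Arithmetical definability\<close>

text \<open>In \<open>tdef d\<close> and \<open>adef d\<close> only the number variables below d may occur, so that d is available as the
  next bound variable.\<close>

definition tdef :: "nat \<Rightarrow> ((nat \<Rightarrow> nat) \<Rightarrow> nat) \<Rightarrow> bool" where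
  "tdef d t \<longleftrightarrow> (\<exists>s. tvars s \<subseteq> {..<d} \<and> (\<forall>e. tval e s = t e))"

definition adef :: "nat \<Rightarrow> ((nat \<Rightarrow> nat) \<Rightarrow> (nat \<Rightarrow> nat set) \<Rightarrow> bool) \<Rightarrow> bool" where
  "adef d R \<longleftrightarrow> (\<exists>\<phi>. arithmetical \<phi> \<and> free_num \<phi> \<subseteq> {..<d} \<and> free_set \<phi> \<subseteq> {0, 1} \<and>
     (\<forall>e X. sat e X \<phi> \<longleftrightarrow> R e X))"

lemma tdef_var: "i < d \<Longrightarrow> tdef d (\<lambda>e. e i)"
  unfolding tdef_def by (rule exI[of _ "NVar i"]) auto

lemma tdef_0: "tdef d (\<lambda>e. 0)"
  unfolding tdef_def by (rule exI[of _ Zero]) auto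

lemma tdef_Suc: "tdef d t \<Longrightarrow> tdef d (\<lambda>e. Suc (t e))"
  unfolding tdef_def by (elim exE, rule_tac x = "Succ s" in exI) auto

lemma tdef_add: "tdef d s \<Longrightarrow> tdef d t \<Longrightarrow> tdef d (\<lambda>e. s e + t e)"
  unfolding tdef_def by (elim exE, rule_tac x = "Plus sa saa" in exI) auto

lemma tdef_mult: "tdef d s \<Longrightarrow> tdef d t \<Longrightarrow> tdef d (\<lambda>e. s e * t e)"
  unfolding tdef_def by (elim exE, rule_tac x = "Times sa saa" in exI) auto

lemma tdef_pair: "tdef d s \<Longrightarrow> tdef d t \<Longrightarrow> tdef d (\<lambda>e. pair (s e) (t e))"
  unfolding tdef_def by (elim exE, rule_tac x = "PairT sa saa" in exI) auto

lemma tdef_1: "tdef d (\<lambda>e. 1)"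
  using tdef_Suc[OF tdef_0] by simp

lemma tdef_numeral: "tdef d (\<lambda>e. numeral n)"
proof -
  have "tdef d (\<lambda>e. k)" for k by (induction k) (auto intro: tdef_0 tdef_Suc)
  then show ?thesis .
qed

lemma tdef_le: "tdef d t \<Longrightarrow> d \<le> k \<Longrightarrow> tdef k t"
  unfolding tdef_def by (meson lessThan_subset_iff subset_trans)

lemma tdef_indep: "tdef d t \<Longrightarrow> d \<le> k \<Longrightarrow> t (e(k := m)) = t e"
proof -
  assume "tdef d t" "d \<le> k"
  then obtain s where s: "tvars s \<subseteq> {..<d}" "\<And>e. tval e s = t e" unfolding tdef_def by blast
  have "tval (e(k := m)) s = tval e s" by (rule tval_cong) (use s(1) \<open>d \<le> k\<close> in auto)
  then show ?thesis by (simp add: s(2))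
qed

lemmas tdef_intros = tdef_var tdef_0 tdef_1 tdef_numeral tdef_Suc tdef_add tdef_mult tdef_pair

lemma adef_mem: "tdef d t \<Longrightarrow> i = 0 \<or> i = 1 \<Longrightarrow> adef d (\<lambda>e X. t e \<in> X i)"
  unfolding tdef_def adef_def by (elim exE, rule_tac x = "Mem s i" in exI) auto

lemma adef_eq: "tdef d s \<Longrightarrow> tdef d t \<Longrightarrow> adef d (\<lambda>e X. s e = t e)"
  unfolding tdef_def adef_def by (elim exE, rule_tac x = "Equal sa saa" in exI) auto

lemma adef_not: "adef d R \<Longrightarrow> adef d (\<lambda>e X. \<not> R e X)"
  unfolding adef_def by (elim exE, rule_tac x = "Neg \<phi>" in exI) auto

lemma adef_conj: "adef d R \<Longrightarrow> adef d S \<Longrightarrow> adef d (\<lambda>e X. R e X \<and> S e X)"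
  unfolding adef_def by (elim exE, rule_tac x = "And \<phi> \<phi>'" in exI) auto

lemma adef_disj: "adef d R \<Longrightarrow> adef d S \<Longrightarrow> adef d (\<lambda>e X. R e X \<or> S e X)"
  using adef_not[OF adef_conj[OF adef_not adef_not], of d R S] by simp

lemma adef_imp: "adef d R \<Longrightarrow> adef d S \<Longrightarrow> adef d (\<lambda>e X. R e X \<longrightarrow> S e X)"
  unfolding imp_conv_disj by (rule adef_disj[OF adef_not])

lemma adef_iff: "adef d R \<Longrightarrow> adef d S \<Longrightarrow> adef d (\<lambda>e X. R e X \<longleftrightarrow> S e X)"
  unfolding iff_conv_conj_imp by (rule adef_conj[OF adef_imp adef_imp])

text \<open>The second premise says that \<open>Q\<close> depends on the variable \<open>d\<close>
  only through its first argument, so binding \<open>d\<close> captures nothing.\<close>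

lemma adef_ex:
  assumes "adef (Suc d) (\<lambda>e X. Q (e d) e X)" "\<And>n e m X. Q n (e(d := m)) X = Q n e X"
  shows "adef d (\<lambda>e X. \<exists>n. Q n e X)"
proof -
  obtain \<phi> where \<phi>: "arithmetical \<phi>" "free_num \<phi> \<subseteq> {..<Suc d}" "free_set \<phi> \<subseteq> {0, 1}"
    "\<And>e X. sat e X \<phi> \<longleftrightarrow> Q (e d) e X" using assms(1) unfolding adef_def by blast
  have "free_num (ExN d \<phi>) \<subseteq> {..<d}" using \<phi>(2) by (auto simp: ExN_def less_Suc_eq)
  moreover have "arithmetical (ExN d \<phi>)" "free_set (ExN d \<phi>) \<subseteq> {0, 1}" using \<phi>(1,3) by (simp_all add: ExN_def)
  moreover have "sat e X (ExN d \<phi>) \<longleftrightarrow> (\<exists>n. Q n e X)" for e X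
    unfolding sat_connectives \<phi>(4) fun_upd_same assms(2) ..
  ultimately show ?thesis unfolding adef_def by blast
qed

lemma adef_all:
  assumes "adef (Suc d) (\<lambda>e X. Q (e d) e X)" "\<And>n e m X. Q n (e(d := m)) X = Q n e X"
  shows "adef d (\<lambda>e X. \<forall>n. Q n e X)"
proof -
  have "adef d (\<lambda>e X. \<not> (\<exists>n. \<not> Q n e X))"
    by (rule adef_not, rule adef_ex, rule adef_not, rule assms(1)) (simp only: assms(2))
  then show ?thesis by simp
qed

lemmas adef_intros = adef_not adef_conj adef_disj adef_imp adef_iff adef_ex adef_all adef_eq

lemma adef_le: 
  assumes "tdef d s" "tdef d t" shows "adef d (\<lambda>e X. s e \<le> t e)"
  unfolding le_iff_add
  by (intro adef_intros tdef_intros assms[THEN tdef_le]) (simp_all add: assms[THEN tdef_indep] eq_commute)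

lemma adef_less:
  assumes "tdef d s" "tdef d t" shows "adef d (\<lambda>e X. s e < t e)"
  unfolding Suc_le_eq[symmetric] by (intro adef_le tdef_intros assms)

lemma adef_dvd:
  assumes "tdef d s" "tdef d t" shows "adef d (\<lambda>e X. s e dvd t e)"
  unfolding dvd_def
  by (intro adef_intros tdef_intros assms[THEN tdef_le]) (simp_all add: assms[THEN tdef_indep])

section \<open>Coding of finite sequences and transitive closures\<close>

text \<open>Goedel's beta function, with its two parameters packed into one number.\<close>

definition beta :: "nat \<Rightarrow> nat \<Rightarrow> nat" where
  "beta a i = (case prod_decode a of (u, v) \<Rightarrow> u mod Suc (Suc i * v))"

text \<open>Take v to be the factorial of a bound \<open>b\<close>. A prime dividing two of the
  moduli divides (j - i) v, hence v, hence 1; so the moduli are coprime and the Chinese remainder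
  theorem applies. The bound exceeds no less than \<open>n\<close>, for the divisibility, and all
  values, so that they are proper remainders.\<close>

lemma beta_exists: "\<exists>a. \<forall>i<n. beta a i = s i"
proof -
  define b where "b = Max (insert n (s ` {..<n}))"
  define v where "v = (fact b :: nat)"
  have b: "n \<le> b" "\<And>i. i < n \<Longrightarrow> s i \<le> b" unfolding b_def by (auto intro: Max_ge)
  have cop: "coprime (Suc (Suc i * v)) (Suc (Suc j * v))" if ij: "i < j" "j < n" for i j
  proof (rule ccontr)
    assume "\<not> coprime (Suc (Suc i * v)) (Suc (Suc j * v))"
    then have "gcd (Suc (Suc i * v)) (Suc (Suc j * v)) \<noteq> 1" unfolding coprime_iff_gcd_eq_1 .
    then obtain p where p: "prime p" "p dvd gcd (Suc (Suc i * v)) (Suc (Suc j * v))"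
      using prime_factor_nat by blast
    have p2: "p dvd Suc (Suc i * v)" "p dvd Suc (Suc j * v)"
      using dvd_trans[OF p(2) gcd_dvd1] dvd_trans[OF p(2) gcd_dvd2] .
    have "Suc (Suc j * v) - Suc (Suc i * v) = (j - i) * v" by (simp add: diff_mult_distrib)
    then have "p dvd (j - i) * v" using dvd_diff_nat[OF p2(2,1)] by (simp only:)
    moreover have "(j - i) dvd v" unfolding v_def using ij b by (intro dvd_fact) auto
    ultimately have "p dvd v" using p(1) by (metis dvd_trans prime_dvd_mult_iff)
    then have "p dvd Suc i * v" by simp
    moreover have "p dvd Suc i * v + 1" using p2(1) by simp
    ultimately have "p dvd 1" by (simp only: dvd_add_right_iff)
    then show False using p(1) by simp
  qed
  have cop': "coprime (Suc (Suc i * v)) (Suc (Suc j * v))" if "i < n" "j < n" "i \<noteq> j" for i j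
    using cop[of i j] cop[of j i] that by (metis coprime_commute nat_neq_iff)
  obtain u where u: "\<forall>i\<in>{..<n}. [u = s i] (mod Suc (Suc i * v))"
    using chinese_remainder_nat[of "{..<n}" "\<lambda>i. Suc (Suc i * v)" s] cop' by auto
  have "beta (pair u v) i = s i" if i: "i < n" for i
  proof -
    have "s i \<le> b" using b(2)[OF i] .
    also have "b \<le> v" unfolding v_def by (rule fact_ge_self)
    finally have "s i < Suc (Suc i * v)" by simp
    then show ?thesis using u i by (simp add: beta_def cong_def)
  qed
  then show ?thesis by blast
qed

text \<open>Division with remainder is spelled out in terms of the formal language. The later
  \<open>_iff\<close> lemmas for coded notions serve the same end: a shape to which the
  \<open>adef\<close> rules apply.\<close>

lemma beta_iff: "x = beta a i \<longleftrightarrow> (\<exists>u v q. a = pair u v \<and> u = q * Suc (Suc i * v) + x \<and> x < Suc (Suc i * v))"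
proof
  assume x: "x = beta a i"
  obtain u v where uv: "prod_decode a = (u, v)" by fastforce
  have "x = u mod Suc (Suc i * v)" using x uv by (simp add: beta_def)
  then have "u = (u div Suc (Suc i * v)) * Suc (Suc i * v) + x \<and> x < Suc (Suc i * v)"
    by (metis div_mult_mod_eq mod_less_divisor zero_less_Suc)
  moreover have "a = pair u v" using uv by (metis prod_decode_inverse)
  ultimately show "\<exists>u v q. a = pair u v \<and> u = q * Suc (Suc i * v) + x \<and> x < Suc (Suc i * v)" by blast
next
  assume "\<exists>u v q. a = pair u v \<and> u = q * Suc (Suc i * v) + x \<and> x < Suc (Suc i * v)"
  then obtain u v q where *: "a = pair u v" "u = q * Suc (Suc i * v) + x" "x < Suc (Suc i * v)" by blast
  then have "u mod Suc (Suc i * v) = x" by (simp only: mod_mult_self3 mod_less)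
  then show "x = beta a i" using *(1) by (simp add: beta_def)
qed

lemma adef_beta:
  assumes "tdef d x" "tdef d a" "tdef d i" shows "adef d (\<lambda>e X. x e = beta (a e) (i e))"
  unfolding beta_iff
  by (intro adef_less adef_intros tdef_intros assms[THEN tdef_le])
    (simp_all add: assms[THEN tdef_indep])

lemma rtranclp_iff_sequence: "r\<^sup>*\<^sup>* a b \<longleftrightarrow> (\<exists>n s. a = s 0 \<and> b = s n \<and> (\<forall>i<n. r (s i) (s (Suc i))))"
  by (metis relpowp_fun_conv rtranclp_power)

text \<open>Recursions are treated below as runs of an arithmetical step relation, and a run is
  coded by one number. As \<open>beta\<close> is no term of the language, its values are named by
  \<open>u\<close> and \<open>v\<close>.\<close>

lemma rtranclp_iff_beta:
  "r\<^sup>*\<^sup>* a b \<longleftrightarrow> (\<exists>n s. a = beta s 0 \<and> b = beta s n \<and>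
     (\<forall>i. i < n \<longrightarrow> (\<forall>u v. u = beta s i \<longrightarrow> v = beta s (Suc i) \<longrightarrow> r u v)))"
proof
  assume "r\<^sup>*\<^sup>* a b"
  then obtain n s where s: "a = s 0" "b = s n" "\<forall>i<n. r (s i) (s (Suc i))"
    unfolding rtranclp_iff_sequence by blast
  obtain t where "\<forall>i<Suc n. beta t i = s i" using beta_exists by blast
  then show "\<exists>n s. a = beta s 0 \<and> b = beta s n \<and> (\<forall>i. i < n \<longrightarrow> (\<forall>u v. u = beta s i \<longrightarrow> v = beta s (Suc i) \<longrightarrow> r u v))"
    using s by (intro exI[of _ n] exI[of _ t]) auto
next
  assume "\<exists>n s. a = beta s 0 \<and> b = beta s n \<and> (\<forall>i. i < n \<longrightarrow> (\<forall>u v. u = beta s i \<longrightarrow> v = beta s (Suc i) \<longrightarrow> r u v))"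
  then show "r\<^sup>*\<^sup>* a b" unfolding rtranclp_iff_sequence by blast
qed

lemma adef_rtranclp:
  assumes st: "tdef d s" "tdef d t"
    and r: "\<And>k u v. d \<le> k \<Longrightarrow> tdef k u \<Longrightarrow> tdef k v \<Longrightarrow> adef k (\<lambda>e X. r e X (u e) (v e))"
    and ind: "\<And>k e X m. d \<le> k \<Longrightarrow> r (e(k := m)) X = r e X"
  shows "adef d (\<lambda>e X. (r e X)\<^sup>*\<^sup>* (s e) (t e))"
  unfolding rtranclp_iff_beta
  by (intro adef_beta adef_less adef_intros tdef_intros st[THEN tdef_le] r)
    (simp_all add: st[THEN tdef_indep] ind)

section \<open>Words and enumerations in arithmetic\<close>

lemma swp_iff: "y = swp l a \<longleftrightarrow> (\<exists>u v. (l = 2 * pair u v \<or> l = 2 * pair u v + 1) \<and>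
    (a = u \<and> y = v \<or> a \<noteq> u \<and> a = v \<and> y = u \<or> a \<noteq> u \<and> a \<noteq> v \<and> y = a))"
proof -
  obtain u v where uv: "prod_decode (l div 2) = (u, v)" by fastforce
  then have k: "l div 2 = pair u v" by (metis prod_decode_inverse)
  have l: "l = 2 * pair u' v' \<or> l = 2 * pair u' v' + 1 \<longleftrightarrow> u' = u \<and> v' = v" for u' v'
  proof -
    have "l = 2 * m \<or> l = 2 * m + 1 \<longleftrightarrow> l div 2 = m" for m by auto
    then show ?thesis by (auto simp: k)
  qed
  show ?thesis unfolding l swp_def uv by auto
qed

lemma adef_swp:
  assumes "tdef d y" "tdef d l" "tdef d a" shows "adef d (\<lambda>e X. y e = swp (l e) (a e))"
  unfolding swp_iff
  by (intro adef_intros tdef_intros assms[THEN tdef_le]) (simp_all add: assms[THEN tdef_indep])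

lemma linv_iff: "m = linv l \<longleftrightarrow> (\<exists>k. l = 2 * k \<and> m = 2 * k + 1 \<or> l = 2 * k + 1 \<and> m = 2 * k)"
  unfolding linv_def by presburger

lemma adef_linv:
  assumes "tdef d m" "tdef d l" shows "adef d (\<lambda>e X. m e = linv (l e))"
  unfolding linv_iff
  by (intro adef_intros tdef_intros assms[THEN tdef_le]) (simp_all add: assms[THEN tdef_indep])

text \<open>\<open>Suc (pair a v)\<close> is the code of the list with head a and tail coded by v,
  so iterating the step runs through the codes of all suffixes.\<close>

definition tl_step :: "nat \<Rightarrow> nat \<Rightarrow> bool" where
  "tl_step u v \<longleftrightarrow> (\<exists>a. u = Suc (pair a v))"

lemma adef_tl_step:
  assumes "tdef d u" "tdef d v" shows "adef d (\<lambda>e X. tl_step (u e) (v e))"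
  unfolding tl_step_def
  by (intro adef_intros tdef_intros assms[THEN tdef_le]) (simp_all add: assms[THEN tdef_indep])

lemma tl_step_rtranclp: "tl_step\<^sup>*\<^sup>* (list_encode w) u \<longleftrightarrow> (\<exists>v v'. w = v' @ v \<and> u = list_encode v)"
proof
  assume "tl_step\<^sup>*\<^sup>* (list_encode w) u"
  then show "\<exists>v v'. w = v' @ v \<and> u = list_encode v"
  proof (induction rule: rtranclp_induct)
    case (step u z)
    then obtain v v' a where *: "w = v' @ v" "u = list_encode v" "u = Suc (pair a z)"
      by (auto simp: tl_step_def)
    then obtain v1 where v1: "v = a # v1" "z = list_encode v1" by (cases v) auto
    then have "w = (v' @ [a]) @ v1" using * by simp
    then show ?case using v1(2) by blast
  qed auto
next
  have "tl_step\<^sup>*\<^sup>* (list_encode (v' @ v)) (list_encode v)" for v v'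
  proof (induction v')
    case (Cons a v')
    have "tl_step (list_encode ((a # v') @ v)) (list_encode (v' @ v))" by (simp add: tl_step_def)
    then show ?case using Cons by (rule converse_rtranclp_into_rtranclp)
  qed simp
  then show "\<exists>v v'. w = v' @ v \<and> u = list_encode v \<Longrightarrow> tl_step\<^sup>*\<^sup>* (list_encode w) u" by auto
qed

definition reduced_code :: "nat \<Rightarrow> bool" where
  "reduced_code n \<longleftrightarrow> reduced (list_decode n)"

text \<open>Being reduced concerns adjacent letters, and each adjacent pair stands at the front of
  some suffix.\<close>

lemma reduced_code_iff: "reduced_code n \<longleftrightarrow> (\<forall>a b r. tl_step\<^sup>*\<^sup>* n (Suc (pair a (Suc (pair b r)))) \<longrightarrow> b \<noteq> linv a)"
proof -
  have code: "Suc (pair a (Suc (pair b r))) = list_encode v \<longleftrightarrow> (\<exists>v'. v = a # b # v' \<and> r = list_encode v')" for a b r v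
    by (cases v; cases "tl v") auto
  have red: "reduced w \<longleftrightarrow> (\<forall>a b v v'. w = v' @ a # b # v \<longrightarrow> b \<noteq> linv a)" for w
  proof
    assume r: "\<forall>a b v v'. w = v' @ a # b # v \<longrightarrow> b \<noteq> linv a"
    show "reduced w" unfolding reduced_def successively_conv_nth
    proof (intro allI impI)
      fix i assume "Suc i < length w"
      then have "w = take i w @ w ! i # w ! Suc i # drop (Suc (Suc i)) w"
        by (metis Cons_nth_drop_Suc Suc_lessD append_take_drop_id)
      then show "w ! Suc i \<noteq> linv (w ! i)" using r by blast
    qed
  qed (auto simp: reduced_append reduced_Cons)
  have "tl_step\<^sup>*\<^sup>* n u \<longleftrightarrow> (\<exists>v v'. list_decode n = v' @ v \<and> u = list_encode v)" for u
    using tl_step_rtranclp[of "list_decode n" u] by simp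
  then show ?thesis unfolding reduced_code_def red code by (metis code)
qed

lemma adef_reduced_code:
  assumes "tdef d n" shows "adef d (\<lambda>e X. reduced_code (n e))"
  unfolding reduced_code_iff
  by (intro adef_rtranclp adef_linv adef_tl_step adef_intros tdef_intros assms[THEN tdef_le])
    (simp_all add: assms[THEN tdef_indep])

text \<open>A state is the code of the word still to be applied together with the current number.
  Runs end at the empty word, whose code is 0.\<close>

definition ia_step :: "nat \<Rightarrow> nat \<Rightarrow> bool" where
  "ia_step p q \<longleftrightarrow> (\<exists>l r x y. p = pair (Suc (pair l r)) x \<and> q = pair r y \<and> y = swp l x)"

lemma ia_step_rtranclp: "ia_step\<^sup>*\<^sup>* (pair (list_encode w) a) (pair 0 b) \<longleftrightarrow> b = ia w a"
proof (induction w arbitrary: a)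
  case Nil
  have "\<not> ia_step (pair 0 a) q" for q by (auto simp: ia_step_def)
  then have "ia_step\<^sup>*\<^sup>* (pair 0 a) q \<longleftrightarrow> q = pair 0 a" for q
    by (metis converse_rtranclpE rtranclp.rtrancl_refl)
  then show ?case by auto
next
  case (Cons l w)
  have "ia_step (pair (list_encode (l # w)) a) q \<longleftrightarrow> q = pair (list_encode w) (swp l a)" for q
    by (auto simp: ia_step_def)
  moreover have "pair (list_encode (l # w)) a \<noteq> pair 0 b" by simp
  ultimately have "ia_step\<^sup>*\<^sup>* (pair (list_encode (l # w)) a) (pair 0 b) \<longleftrightarrow>
      ia_step\<^sup>*\<^sup>* (pair (list_encode w) (swp l a)) (pair 0 b)"
    by (metis converse_rtranclpE converse_rtranclp_into_rtranclp)
  then show ?case using Cons by simp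
qed

definition ia_code :: "nat \<Rightarrow> nat \<Rightarrow> nat" where
  "ia_code n a = ia (list_decode n) a"

lemma ia_code_iff: "b = ia_code n a \<longleftrightarrow> ia_step\<^sup>*\<^sup>* (pair n a) (pair 0 b)"
  using ia_step_rtranclp[of "list_decode n" a b] by (simp add: ia_code_def)

lemma adef_ia_step:
  assumes "tdef d u" "tdef d v" shows "adef d (\<lambda>e X. ia_step (u e) (v e))"
  unfolding ia_step_def
  by (intro adef_swp adef_intros tdef_intros assms[THEN tdef_le]) (simp_all add: assms[THEN tdef_indep])

lemma adef_ia_code:
  assumes "tdef d b" "tdef d n" "tdef d a" shows "adef d (\<lambda>e X. b e = ia_code (n e) (a e))"
  unfolding ia_code_iff
  by (intro adef_rtranclp adef_ia_step tdef_intros assms) simp_all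

definition lmul_code :: "nat \<Rightarrow> nat \<Rightarrow> nat" where
  "lmul_code l n = list_encode (lmul_opt l (list_decode n))"

lemma lmul_code_iff: "m = lmul_code l n \<longleftrightarrow> l = 0 \<and> m = n \<or> (\<exists>k i. l = Suc k \<and> i = linv k \<and>
    ((\<exists>r. n = Suc (pair i r) \<and> m = r) \<or>
     (\<forall>r. n \<noteq> Suc (pair i r)) \<and> m = Suc (pair k n)))"
proof -
  obtain w where n: "n = list_encode w" by (metis list_decode_inverse)
  have eq: "list_encode w = Suc (pair i r) \<longleftrightarrow> (\<exists>w'. w = i # w' \<and> r = list_encode w')" for i r
    by (cases w) auto
  show ?thesis
  proof (cases l)
    case 0
    then show ?thesis by (simp add: lmul_code_def lmul_opt_def n)
  next
    case (Suc k)
    show ?thesis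
      unfolding lmul_code_def n eq by (cases w) (auto simp: Suc lmul_opt_def lmul_def)
  qed
qed

lemma adef_lmul_code:
  assumes "tdef d m" "tdef d l" "tdef d n" shows "adef d (\<lambda>e X. m e = lmul_code (l e) (n e))"
  unfolding lmul_code_iff
  by (intro adef_linv adef_intros tdef_intros assms[THEN tdef_le]) (simp_all add: assms[THEN tdef_indep])

text \<open>A state is an index with the element enumerated at it; a step goes to the next larger
  element of S.\<close>

definition enum_step :: "nat set \<Rightarrow> nat \<Rightarrow> nat \<Rightarrow> bool" where
  "enum_step S p q \<longleftrightarrow> (\<exists>i a b. p = pair i a \<and> q = pair (Suc i) b \<and>
     b \<in> S \<and> a < b \<and> (\<forall>m. m \<in> S \<longrightarrow> a < m \<longrightarrow> b \<le> m))"

lemma enumerate_iff: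
  assumes S: "infinite S"
  shows "c = enumerate S n \<longleftrightarrow>
    (\<exists>a. a \<in> S \<and> (\<forall>m. m \<in> S \<longrightarrow> a \<le> m) \<and> (enum_step S)\<^sup>*\<^sup>* (pair 0 a) (pair n c))"
proof -
  have least: "a \<in> S \<and> (\<forall>m. m \<in> S \<longrightarrow> a \<le> m) \<longleftrightarrow> a = enumerate S 0" for a
  proof -
    have "enumerate S 0 \<in> S" "\<forall>m\<in>S. enumerate S 0 \<le> m"
      using enumerate_in_set[OF S, of 0] by (auto simp: enumerate_0 intro: Least_le)
    then show ?thesis by (metis le_antisym)
  qed
  have step: "enum_step S (pair i (enumerate S i)) q \<longleftrightarrow> q = pair (Suc i) (enumerate S (Suc i))" for i q
  proof -
    have "enumerate S (Suc i) \<in> S" "enumerate S i < enumerate S (Suc i)"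
      using enumerate_in_set[OF S] enumerate_step[OF S] by auto
    moreover have "enumerate S (Suc i) \<le> m" if "m \<in> S" "enumerate S i < m" for m
      unfolding enumerate_Suc''[OF S] by (rule Least_le) (use that in simp)
    ultimately have "b \<in> S \<and> enumerate S i < b \<and> (\<forall>m. m \<in> S \<longrightarrow> enumerate S i < m \<longrightarrow> b \<le> m) \<longleftrightarrow>
        b = enumerate S (Suc i)" for b
      by (metis le_antisym)
    then show ?thesis unfolding enum_step_def by auto
  qed
  have path: "(enum_step S)\<^sup>*\<^sup>* (pair 0 (enumerate S 0)) q \<longleftrightarrow> (\<exists>i. q = pair i (enumerate S i))" for q
  proof
    assume "(enum_step S)\<^sup>*\<^sup>* (pair 0 (enumerate S 0)) q"
    then show "\<exists>i. q = pair i (enumerate S i)"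
      by (induction rule: rtranclp_induct) (auto simp: step)
  next
    have "(enum_step S)\<^sup>*\<^sup>* (pair 0 (enumerate S 0)) (pair i (enumerate S i))" for i
    proof (induction i)
      case (Suc i)
      from this[THEN rtranclp.rtrancl_into_rtrancl, of "pair (Suc i) (enumerate S (Suc i))"] step[of i]
      show ?case by blast
    qed simp
    then show "\<exists>i. q = pair i (enumerate S i) \<Longrightarrow> (enum_step S)\<^sup>*\<^sup>* (pair 0 (enumerate S 0)) q" by blast
  qed
  show ?thesis unfolding conj_assoc[symmetric] least by (auto simp: path)
qed

lemma adef_enumerate:
  assumes t: "tdef d c" "tdef d n"
    and S: "\<And>k t. tdef k t \<Longrightarrow> adef k (\<lambda>e X. t e \<in> S X)" and inf: "\<And>X. infinite (S X)"
  shows "adef d (\<lambda>e X. c e = enumerate (S X) (n e))"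
proof -
  have step: "adef k (\<lambda>e X. enum_step (S X) (u e) (v e))" if "tdef k u" "tdef k v" for k u v
    unfolding enum_step_def
    by (intro adef_le adef_less S adef_intros tdef_intros that[THEN tdef_le]) (simp_all add: that[THEN tdef_indep])
  show ?thesis
    unfolding enumerate_iff[OF inf]
    by (intro adef_rtranclp adef_le step S adef_intros tdef_intros t[THEN tdef_le])
      (simp_all add: t[THEN tdef_indep])
qed

lemma adef_prime:
  assumes "tdef d p" shows "adef d (\<lambda>e X. prime (p e))"
  unfolding prime_nat_iff
  by (intro adef_less adef_dvd adef_intros tdef_intros assms[THEN tdef_le]) (simp_all add: assms[THEN tdef_indep])

lemma adef_pr:
  assumes "tdef d p" "tdef d k" shows "adef d (\<lambda>e X. p e = pr (k e))"
  unfolding pr_def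
  by (rule adef_enumerate[OF assms, where S = "\<lambda>X. {p. prime p}"])
    (simp_all add: adef_prime primes_infinite)

section \<open>Codes of basis elements and vectors\<close>

fun bas_code :: "bas \<Rightarrow> nat" where
  "bas_code (Al n w) = pair 0 (pair n (list_encode w))"
| "bas_code (Al' n w) = pair 1 (pair n (list_encode w))"
| "bas_code (Ep a b) = pair 2 (pair a b)"

lemma bas_code_eq_iff [simp]: "bas_code b = bas_code b' \<longleftrightarrow> b = b'"
  by (cases b; cases b') (auto simp: list_encode_eq)

text \<open>A vector is coded by a common denominator, a bound on the codes of its support, and the positive
  and negative parts of its numerators.\<close>

definition cden :: "nat \<Rightarrow> nat" where
  "cden c = Suc (fst (prod_decode c))"

definition cpos :: "nat \<Rightarrow> nat \<Rightarrow> nat" where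
  "cpos c i = (case prod_decode (snd (prod_decode c)) of (N, c') \<Rightarrow>
     if i < N then beta (fst (prod_decode c')) i else 0)"

definition cneg :: "nat \<Rightarrow> nat \<Rightarrow> nat" where
  "cneg c i = (case prod_decode (snd (prod_decode c)) of (N, c') \<Rightarrow>
     if i < N then beta (snd (prod_decode c')) i else 0)"

definition clen :: "nat \<Rightarrow> nat" where
  "clen c = fst (prod_decode (snd (prod_decode c)))"

definition cvec :: "nat \<Rightarrow> vec" where
  "cvec c b = (of_nat (cpos c (bas_code b)) - of_nat (cneg c (bas_code b))) / of_nat (cden c)"

lemma cden_pos [simp]: "0 < cden c" by (simp add: cden_def)

lemma ex_prod_decode: "(\<exists>u v. a = pair u v \<and> Q u v) \<longleftrightarrow> Q (fst (prod_decode a)) (snd (prod_decode a))"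
  by (metis prod.collapse prod_decode_inverse prod_encode_inverse fst_conv snd_conv)

lemma cden_iff: "x = cden c \<longleftrightarrow> (\<exists>d r. c = pair d r \<and> x = Suc d)"
  unfolding ex_prod_decode cden_def ..

lemma clen_iff: "x = clen c \<longleftrightarrow> (\<exists>d r. c = pair d r \<and> (\<exists>N r'. r = pair N r' \<and> x = N))"
  unfolding ex_prod_decode clen_def ..

lemma cpos_iff: "x = cpos c i \<longleftrightarrow> (\<exists>d r. c = pair d r \<and> (\<exists>N r'. r = pair N r' \<and>
    (\<exists>a b. r' = pair a b \<and> (i < N \<and> x = beta a i \<or> \<not> i < N \<and> x = 0))))"
  unfolding ex_prod_decode cpos_def by (auto split: prod.split)

lemma cneg_iff: "x = cneg c i \<longleftrightarrow> (\<exists>d r. c = pair d r \<and> (\<exists>N r'. r = pair N r' \<and>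
    (\<exists>a b. r' = pair a b \<and> (i < N \<and> x = beta b i \<or> \<not> i < N \<and> x = 0))))"
  unfolding ex_prod_decode cneg_def by (auto split: prod.split)

lemma adef_cden:
  assumes "tdef d x" "tdef d c" shows "adef d (\<lambda>e X. x e = cden (c e))"
  unfolding cden_iff
  by (intro adef_intros tdef_intros assms[THEN tdef_le]) (simp_all add: assms[THEN tdef_indep])

lemma adef_clen:
  assumes "tdef d x" "tdef d c" shows "adef d (\<lambda>e X. x e = clen (c e))"
  unfolding clen_iff
  by (intro adef_intros tdef_intros assms[THEN tdef_le]) (simp_all add: assms[THEN tdef_indep])

lemma adef_cpos:
  assumes "tdef d x" "tdef d c" "tdef d i" shows "adef d (\<lambda>e X. x e = cpos (c e) (i e))"
  unfolding cpos_iff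
  by (intro adef_beta adef_less adef_intros tdef_intros assms[THEN tdef_le]) (simp_all add: assms[THEN tdef_indep])

lemma adef_cneg:
  assumes "tdef d x" "tdef d c" "tdef d i" shows "adef d (\<lambda>e X. x e = cneg (c e) (i e))"
  unfolding cneg_iff
  by (intro adef_beta adef_less adef_intros tdef_intros assms[THEN tdef_le]) (simp_all add: assms[THEN tdef_indep])

lemma clen_cpos: "cpos c i \<noteq> 0 \<or> cneg c i \<noteq> 0 \<Longrightarrow> i < clen c"
  by (auto simp: clen_def cpos_def cneg_def split: prod.splits if_splits)

lemma cvec_nonzero: "cvec c b \<noteq> 0 \<Longrightarrow> bas_code b < clen c"
  by (rule clen_cpos) (auto simp: cvec_def)

lemma fsupp_cvec: "fsupp (cvec c)"
proof -
  have "finite (bas_code -` {..<clen c})" by (rule finite_vimageI) (auto simp: inj_def)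
  then show ?thesis unfolding fsupp_def by (rule finite_subset[rotated]) (auto dest: cvec_nonzero)
qed

lemma cvec_surj:
  assumes "fsupp v" shows "\<exists>c. cvec c = v"
proof -
  have fin: "finite {b. v b \<noteq> 0}" using assms by (simp add: fsupp_def)
  obtain N where N: "N \<noteq> 0" "\<forall>b\<in>{b. v b \<noteq> 0}. of_int N * v b \<in> \<int>"
    using common_denominator[OF fin] by blast
  define D where "D = nat \<bar>N\<bar>"
  have D: "D > 0" using N by (simp add: D_def)
  have "of_nat D * v b \<in> \<int>" for b
  proof (cases "v b = 0")
    case False
    then have "of_int N * v b \<in> \<int>" using N by blast
    moreover have "of_nat D * v b = of_int N * v b \<or> of_nat D * v b = - (of_int N * v b)"
      by (auto simp: D_def abs_if)
    ultimately show ?thesis by (metis Ints_minus)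
  qed auto
  then have "of_nat D * v b = of_int \<lfloor>of_nat D * v b\<rfloor>" for b by (metis Ints_cases floor_of_int)
  then obtain z where z: "\<And>b. of_nat D * v b = of_int (z b)"
    using that[of "\<lambda>b. \<lfloor>of_nat D * v b\<rfloor>"] by blast
  define K where "K = Suc (Max (insert 0 (bas_code ` {b. v b \<noteq> 0})))"
  have K: "bas_code b < K" if "v b \<noteq> 0" for b
    using that fin unfolding K_def less_Suc_eq_le by (intro Max_ge) auto
  define m where "m i = z (inv_into UNIV bas_code i)" for i
  have inv: "inv_into UNIV bas_code (bas_code b) = b" for b by (rule inv_f_f) (auto simp: inj_def)
  obtain p q where p: "\<forall>i<K. beta p i = nat (m i)" and q: "\<forall>i<K. beta q i = nat (- m i)"
    using beta_exists[of K "\<lambda>i. nat (m i)"] beta_exists[of K "\<lambda>i. nat (- m i)"] by blast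
  define c where "c = pair (D - 1) (pair K (pair p q))"
  have "cvec c b = v b" for b
  proof (cases "bas_code b < K")
    case True
    have "cvec c b = (of_nat (nat (z b)) - of_nat (nat (- z b))) / of_nat D"
      using True p q D by (simp add: cvec_def c_def cpos_def cneg_def cden_def m_def inv)
    also have "of_nat (nat (z b)) - of_nat (nat (- z b)) = (of_int (z b) :: rat)"
      by (cases "z b \<ge> 0") auto
    also have "of_int (z b) / of_nat D = v b" using z[of b] D by (simp add: field_simps)
    finally show ?thesis .
  next
    case False
    then have "v b = 0" using K by blast
    then show ?thesis using False by (simp add: cvec_def c_def cpos_def cneg_def)
  qed
  then show ?thesis by blast
qed

lemma is_bas_code: "(\<exists>b. i = bas_code b \<and> Q b) \<longleftrightarrow>
    (\<exists>n w. i = pair 0 (pair n w) \<and> Q (Al n (list_decode w))) \<or>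
    (\<exists>n w. i = pair 1 (pair n w) \<and> Q (Al' n (list_decode w))) \<or>
    (\<exists>n w. i = pair 2 (pair n w) \<and> Q (Ep n w))"
proof -
  have "(\<exists>b. i = bas_code b \<and> Q b) \<longleftrightarrow> (\<exists>n w. i = bas_code (Al n w) \<and> Q (Al n w)) \<or>
      (\<exists>n w. i = bas_code (Al' n w) \<and> Q (Al' n w)) \<or> (\<exists>n w. i = bas_code (Ep n w) \<and> Q (Ep n w))"
    by (metis bas.exhaust)
  moreover have "(\<exists>w. i = pair t (pair n (list_encode w)) \<and> Q (C w)) \<longleftrightarrow>
      (\<exists>w. i = pair t (pair n w) \<and> Q (C (list_decode w)))" for t n C
    by (metis list_decode_inverse list_encode_inverse)
  ultimately show ?thesis unfolding bas_code.simps by simp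
qed

text \<open>Every number codes some word, so only the tag has to be checked.\<close>

definition bas_codes :: "nat \<Rightarrow> bool" where
  "bas_codes i \<longleftrightarrow> (\<exists>n w. i = pair 0 (pair n w) \<or> i = pair 1 (pair n w) \<or>
     i = pair 2 (pair n w))"

lemma bas_codes_iff: "bas_codes i \<longleftrightarrow> i \<in> range bas_code"
  using is_bas_code[of i "\<lambda>_. True"] by (auto simp: bas_codes_def image_def)

lemma adef_bas_codes:
  assumes "tdef d i" shows "adef d (\<lambda>e X. bas_codes (i e))"
  unfolding bas_codes_def
  by (intro adef_intros tdef_intros assms[THEN tdef_le]) (simp_all add: assms[THEN tdef_indep])

definition cadd :: "nat \<Rightarrow> nat \<Rightarrow> nat \<Rightarrow> bool" where
  "cadd c1 c2 c3 \<longleftrightarrow> (\<forall>b. cvec c1 b + cvec c2 b = cvec c3 b)"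

text \<open>Multiplying out the denominators and moving the negative parts to the other side leaves
  an identity between natural numbers.\<close>

lemma cadd_iff: "cadd c1 c2 c3 \<longleftrightarrow> (\<forall>i. bas_codes i \<longrightarrow> (\<forall>p1 p2 p3 m1 m2 m3 d1 d2 d3.
    p1 = cpos c1 i \<longrightarrow> p2 = cpos c2 i \<longrightarrow> p3 = cpos c3 i \<longrightarrow> m1 = cneg c1 i \<longrightarrow> m2 = cneg c2 i \<longrightarrow> m3 = cneg c3 i \<longrightarrow>
    d1 = cden c1 \<longrightarrow> d2 = cden c2 \<longrightarrow> d3 = cden c3 \<longrightarrow>
    p1 * d2 * d3 + p2 * d1 * d3 + m3 * d1 * d2 = m1 * d2 * d3 + m2 * d1 * d3 + p3 * d1 * d2))"
proof -
  have "(of_nat p1 - of_nat m1) / of_nat d1 + (of_nat p2 - of_nat m2) / of_nat d2 = ((of_nat p3 - of_nat m3) / of_nat d3 :: rat) \<longleftrightarrow>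
      p1 * d2 * d3 + p2 * d1 * d3 + m3 * d1 * d2 = m1 * d2 * d3 + m2 * d1 * d3 + p3 * d1 * d2"
    if "d1 > 0" "d2 > 0" "d3 > 0" for p1 p2 p3 m1 m2 m3 d1 d2 d3 :: nat
  proof -
    have "(of_nat p1 - of_nat m1) / of_nat d1 + (of_nat p2 - of_nat m2) / of_nat d2 = ((of_nat p3 - of_nat m3) / of_nat d3 :: rat) \<longleftrightarrow>
      (of_nat (p1 * d2 * d3 + p2 * d1 * d3 + m3 * d1 * d2) :: rat) = of_nat (m1 * d2 * d3 + m2 * d1 * d3 + p3 * d1 * d2)"
      using that by (simp add: field_simps)
    then show ?thesis by (simp only: of_nat_eq_iff)
  qed
  note eq = this[OF cden_pos cden_pos cden_pos]
  have all: "(\<forall>i. i \<in> range bas_code \<longrightarrow> Q i) \<longleftrightarrow> (\<forall>b. Q (bas_code b))" for Q by auto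
  show ?thesis unfolding cadd_def cvec_def eq bas_codes_iff all by blast
qed

lemma adef_cadd:
  assumes "tdef d c1" "tdef d c2" "tdef d c3" shows "adef d (\<lambda>e X. cadd (c1 e) (c2 e) (c3 e))"
  unfolding cadd_iff
  by (intro adef_bas_codes adef_cpos adef_cneg adef_cden adef_intros tdef_intros assms[THEN tdef_le])
    (simp_all add: assms[THEN tdef_indep])

text \<open>\<open>cloc k u v w\<close>: the rational number (u - v) / w lies in the localization at \<open>pr k\<close>.\<close>

definition cloc :: "nat \<Rightarrow> nat \<Rightarrow> nat \<Rightarrow> nat \<Rightarrow> bool" where
  "cloc k u v w \<longleftrightarrow> (\<exists>p m s t. p = pr k \<and> \<not> p dvd m \<and> m * u + w * t = m * v + w * s)"

lemma adef_cloc: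
  assumes "tdef d k" "tdef d u" "tdef d v" "tdef d w" shows "adef d (\<lambda>e X. cloc (k e) (u e) (v e) (w e))"
  unfolding cloc_def
  by (intro adef_pr adef_dvd adef_intros tdef_intros assms[THEN tdef_le]) (simp_all add: assms[THEN tdef_indep])

lemma cloc_iff:
  assumes w: "w > 0"
  shows "cloc k u v w \<longleftrightarrow> zloc (pr k) ((of_nat u - of_nat v) / of_nat w)"
proof
  assume "cloc k u v w"
  then obtain m s t where *: "\<not> pr k dvd m" "m * u + w * t = m * v + w * s" unfolding cloc_def by blast
  have "(of_nat (m * u + w * t) :: rat) = of_nat (m * v + w * s)" by (simp only: *(2))
  then have "of_int (int m) * ((of_nat u - of_nat v) / of_nat w :: rat) = of_int (int s - int t)"
    using w by (simp add: field_simps)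
  moreover have "\<not> int (pr k) dvd int m" using *(1) by simp
  ultimately show "zloc (pr k) ((of_nat u - of_nat v) / of_nat w)" unfolding zloc_def by blast
next
  assume "zloc (pr k) ((of_nat u - of_nat v) / of_nat w)"
  then obtain a b where ab: "\<not> int (pr k) dvd a" "of_int a * ((of_nat u - of_nat v) / of_nat w :: rat) = of_int b"
    unfolding zloc_def by blast
  define m where "m = nat \<bar>a\<bar>"
  \<comment> \<open>The multiplier from \<open>zloc\<close> may be negative, whereas
    \<open>cloc\<close> wants a natural number; its sign is moved to the right-hand side.\<close>
  define b' where "b' = (if a \<ge> 0 then b else - b)"
  have m: "int m = \<bar>a\<bar>" by (simp add: m_def)
  have "of_int (int m) * ((of_nat u - of_nat v) / of_nat w :: rat) = of_int b'"
    using ab(2) by (auto simp: m b'_def abs_if)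
  then have "(of_int (int m * (int u - int v)) :: rat) = of_int (int w * b')"
    using w by (simp add: field_simps)
  then have "int m * (int u - int v) = int w * b'" by (simp only: of_int_eq_iff)
  moreover have "b' = int (nat b') - int (nat (- b'))" by auto
  ultimately have "int m * (int u - int v) = int w * (int (nat b') - int (nat (- b')))" by simp
  then have "int (m * u + w * nat (- b')) = int (m * v + w * nat b')"
    by (simp only: of_nat_add of_nat_mult) (simp add: algebra_simps)
  then have "m * u + w * nat (- b') = m * v + w * nat b'" by (simp only: of_nat_eq_iff)
  moreover have "\<not> pr k dvd m" using ab(1) m by (metis dvd_abs_iff int_dvd_int_iff)
  ultimately show "cloc k u v w" unfolding cloc_def by blast
qed

section \<open>The copy of the group on the natural numbers\<close>

definition fib_code :: "nat \<Rightarrow> nat \<Rightarrow> nat \<Rightarrow> nat \<Rightarrow> bool" where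
  "fib_code n a b j \<longleftrightarrow> (\<exists>w. j = pair 0 (pair n w) \<and> reduced_code w \<and>
     a = ia_code w 0 \<and> b = ia_code w 1)"

lemma adef_fib_code:
  assumes "tdef d n" "tdef d a" "tdef d b" "tdef d j" shows "adef d (\<lambda>e X. fib_code (n e) (a e) (b e) (j e))"
  unfolding fib_code_def
  by (intro adef_reduced_code adef_ia_code adef_intros tdef_intros assms[THEN tdef_le])
    (simp_all add: assms[THEN tdef_indep])

lemma fib_code_iff: "fib_code n a b j \<longleftrightarrow> j \<in> bas_code ` fiber n a b"
proof -
  have "(\<exists>w. Q w) \<longleftrightarrow> (\<exists>w. Q (list_encode w))" for Q by (metis list_decode_inverse)
  then have "fib_code n a b j \<longleftrightarrow> (\<exists>w. j = bas_code (Al n w) \<and> reduced w \<and> a = ia w 0 \<and> b = ia w 1)"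
    unfolding fib_code_def by (simp add: reduced_code_def ia_code_def)
  then show ?thesis unfolding fiber_def by blast
qed

definition sum_step :: "(nat \<Rightarrow> nat) \<Rightarrow> nat \<Rightarrow> nat \<Rightarrow> bool" where
  "sum_step g p q \<longleftrightarrow> (\<exists>i s x. p = pair i s \<and> q = pair (Suc i) (s + x) \<and> x = g i)"

lemma sum_iff: "m = (\<Sum>j<N. g j) \<longleftrightarrow> (sum_step g)\<^sup>*\<^sup>* (pair 0 0) (pair N m)" for g :: "nat \<Rightarrow> nat"
proof -
  have "(sum_step g)\<^sup>*\<^sup>* (pair 0 0) q \<longleftrightarrow> (\<exists>i. q = pair i (\<Sum>j<i. g j))" for q
  proof
    assume "(sum_step g)\<^sup>*\<^sup>* (pair 0 0) q"
    then show "\<exists>i. q = pair i (\<Sum>j<i. g j)"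
      by (induction rule: rtranclp_induct) (auto simp: sum_step_def intro: exI[of _ 0])
  next
    have "(sum_step g)\<^sup>*\<^sup>* (pair 0 0) (pair i (\<Sum>j<i. g j))" for i
    proof (induction i)
      case (Suc i)
      have "sum_step g (pair i (\<Sum>j<i. g j)) (pair (Suc i) (\<Sum>j<Suc i. g j))"
        by (simp add: sum_step_def)
      with Suc show ?case by (rule rtranclp.rtrancl_into_rtrancl)
    qed simp
    then show "\<exists>i. q = pair i (\<Sum>j<i. g j) \<Longrightarrow> (sum_step g)\<^sup>*\<^sup>* (pair 0 0) q" by blast
  qed
  then show ?thesis by auto
qed

text \<open>\<open>F\<close> will be \<open>cpos\<close> or \<open>cneg\<close>: positive and
  negative parts are summed separately to stay within the natural numbers.\<close>

definition fib_sum :: "(nat \<Rightarrow> nat \<Rightarrow> nat) \<Rightarrow> nat \<Rightarrow> nat \<Rightarrow> nat \<Rightarrow> nat \<Rightarrow> nat" where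
  "fib_sum F c n a b = (\<Sum>j<clen c. if fib_code n a b j then F c j else 0)"

lemma adef_fib_sum:
  assumes F: "\<And>k x c i. tdef k x \<Longrightarrow> tdef k c \<Longrightarrow> tdef k i \<Longrightarrow> adef k (\<lambda>e X. x e = F (c e) (i e))"
    and t: "tdef d m" "tdef d c" "tdef d n" "tdef d a" "tdef d b"
  shows "adef d (\<lambda>e X. m e = fib_sum F (c e) (n e) (a e) (b e))"
proof -
  have if_iff: "x = (if Q then y else 0) \<longleftrightarrow> (Q \<longrightarrow> x = y) \<and> (\<not> Q \<longrightarrow> x = 0)" for x y :: nat and Q by simp
  have step: "adef k (\<lambda>e X. sum_step (\<lambda>j. if fib_code (n e) (a e) (b e) j then F (c e) j else 0) (u e) (v e))"
    if "d \<le> k" "tdef k u" "tdef k v" for k u v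
    unfolding sum_step_def if_iff
    by (intro adef_fib_code F adef_intros tdef_intros t[THEN tdef_le] that(2,3)[THEN tdef_le])
      (use that(1) in \<open>simp_all add: that(2,3)[THEN tdef_indep] t[THEN tdef_indep] cong: if_cong\<close>)
  have ex: "m' = fib_sum F c' n' a' b' \<longleftrightarrow> (\<exists>N. N = clen c' \<and>
      (sum_step (\<lambda>j. if fib_code n' a' b' j then F c' j else 0))\<^sup>*\<^sup>* (pair 0 0) (pair N m'))" for m' c' n' a' b'
    by (simp add: fib_sum_def sum_iff)
  show ?thesis
    unfolding ex
    by (intro adef_clen adef_rtranclp step adef_intros tdef_intros t[THEN tdef_le])
      (simp_all add: t[THEN tdef_indep] cong: if_cong)
qed

lemma kfun_cvec:
  "kfun n a b (cvec c) = (of_nat (cpos c (bas_code (Ep a b)) + fib_sum cpos c n a b) -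
     of_nat (cneg c (bas_code (Ep a b)) + fib_sum cneg c n a b)) / of_nat (cden c)"
proof -
  define S where "S = {b. bas_code b < clen c}"
  have "S = bas_code -` {..<clen c}" by (auto simp: S_def)
  then have fin: "finite S" by (auto intro: finite_vimageI simp: inj_def)
  have sum: "fib_sum F c n a b = (\<Sum>i\<in>S \<inter> fiber n a b. F c (bas_code i))" for F
  proof -
    have "bas_code ` (S \<inter> fiber n a b) = {j \<in> {..<clen c}. fib_code n a b j}"
      by (auto simp: S_def fib_code_iff)
    moreover have "fib_sum F c n a b = (\<Sum>j \<in> {j \<in> {..<clen c}. fib_code n a b j}. F c j)"
      unfolding fib_sum_def by (rule sum.inter_filter[symmetric]) simp
    moreover have "(\<Sum>j \<in> bas_code ` (S \<inter> fiber n a b). F c j) = (\<Sum>i\<in>S \<inter> fiber n a b. F c (bas_code i))"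
      by (subst sum.reindex) (auto simp: inj_on_def)
    ultimately show ?thesis by simp
  qed
  have "kfun n a b (cvec c) = cvec c (Ep a b) + (\<Sum>i\<in>S \<inter> fiber n a b. cvec c i)"
    by (rule kfun_eq[OF fin]) (auto simp: S_def dest: cvec_nonzero)
  also have "(\<Sum>i\<in>S \<inter> fiber n a b. cvec c i) =
      (of_nat (fib_sum cpos c n a b) - of_nat (fib_sum cneg c n a b)) / of_nat (cden c)"
    unfolding sum cvec_def by (simp add: sum_subtractf sum_divide_distrib[symmetric])
  finally show ?thesis by (simp add: cvec_def[of c "Ep a b"] add_divide_distrib diff_divide_distrib)
qed

text \<open>One predicate for each shape of functional in \<open>annih\<close>: \<open>locc\<close>
  for a coordinate, \<open>locd\<close> for a difference of two coordinates, \<open>lock\<close> for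
  \<open>kfun\<close>.\<close>

definition locc :: "nat \<Rightarrow> nat \<Rightarrow> nat \<Rightarrow> bool" where
  "locc c k i \<longleftrightarrow> (\<forall>u v w. u = cpos c i \<longrightarrow> v = cneg c i \<longrightarrow> w = cden c \<longrightarrow> cloc k u v w)"

definition locd :: "nat \<Rightarrow> nat \<Rightarrow> nat \<Rightarrow> nat \<Rightarrow> bool" where
  "locd c k i j \<longleftrightarrow> (\<forall>u v u' v' w. u = cpos c i \<longrightarrow> v = cneg c i \<longrightarrow> u' = cpos c j \<longrightarrow> v' = cneg c j \<longrightarrow>
     w = cden c \<longrightarrow> cloc k (u + v') (v + u') w)"

definition lock :: "nat \<Rightarrow> nat \<Rightarrow> nat \<Rightarrow> nat \<Rightarrow> nat \<Rightarrow> bool" where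
  "lock c k n a b \<longleftrightarrow> (\<forall>u v s t w. u = cpos c (pair 2 (pair a b)) \<longrightarrow>
     v = cneg c (pair 2 (pair a b)) \<longrightarrow> s = fib_sum cpos c n a b \<longrightarrow> t = fib_sum cneg c n a b \<longrightarrow>
     w = cden c \<longrightarrow> cloc k (u + s) (v + t) w)"

lemma adef_locc:
  assumes "tdef d c" "tdef d k" "tdef d i" shows "adef d (\<lambda>e X. locc (c e) (k e) (i e))"
  unfolding locc_def
  by (intro adef_cpos adef_cneg adef_cden adef_cloc adef_intros tdef_intros assms[THEN tdef_le])
    (simp_all add: assms[THEN tdef_indep])

lemma adef_locd:
  assumes "tdef d c" "tdef d k" "tdef d i" "tdef d j" shows "adef d (\<lambda>e X. locd (c e) (k e) (i e) (j e))"
  unfolding locd_def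
  by (intro adef_cpos adef_cneg adef_cden adef_cloc adef_intros tdef_intros assms[THEN tdef_le])
    (simp_all add: assms[THEN tdef_indep])

lemma adef_lock:
  assumes "tdef d c" "tdef d k" "tdef d n" "tdef d a" "tdef d b"
  shows "adef d (\<lambda>e X. lock (c e) (k e) (n e) (a e) (b e))"
  unfolding lock_def
  by (intro adef_fib_sum[OF adef_cpos] adef_fib_sum[OF adef_cneg] adef_cpos adef_cneg adef_cden adef_cloc
      adef_intros tdef_intros assms[THEN tdef_le])
    (simp_all add: assms[THEN tdef_indep])

lemma locc_iff: "locc c k (bas_code b) \<longleftrightarrow> zloc (pr k) (cvec c b)"
  by (simp add: locc_def cloc_iff cvec_def)

lemma locd_iff: "locd c k (bas_code b) (bas_code b') \<longleftrightarrow> zloc (pr k) (cvec c b - cvec c b')"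
  by (simp add: locd_def cloc_iff cvec_def diff_divide_distrib add_divide_distrib algebra_simps)

lemma lock_iff: "lock c k n a b \<longleftrightarrow> zloc (pr k) (kfun n a b (cvec c))"
  unfolding kfun_cvec by (simp add: lock_def cloc_iff)

definition edge_rel :: "nat set \<Rightarrow> nat \<Rightarrow> nat \<Rightarrow> bool" where
  "edge_rel M a b \<longleftrightarrow> pair 0 (Suc (pair a (Suc (pair b 0)))) \<in> M"

text \<open>Replaces quantification over functionals by quantification over numbers, words and basis
  elements, which can be coded.\<close>

lemma annih_all: "(\<forall>k g. annih x k g \<longrightarrow> Q k g) \<longleftrightarrow>
   (\<forall>n b. \<not> (\<exists>w. reduced w \<and> b = Al n w) \<longrightarrow> Q (pair 0 n) (\<lambda>v. v b)) \<and>
   (\<forall>n b. \<not> (\<exists>w. reduced w \<and> b = Al' n w) \<longrightarrow> Q (pair 1 n) (\<lambda>v. v b)) \<and>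
   (\<forall>n l b. \<not> (\<exists>w. reduced w \<and> (b = Al n w \<or> b = Al' n w)) \<longrightarrow>
      Q (pair 2 (pair n l)) (\<lambda>v. v b)) \<and>
   (\<forall>n l w. reduced w \<longrightarrow> Q (pair 2 (pair n l)) (\<lambda>v. v (Al n w) - v (Al' n (lmul_opt l w)))) \<and>
   (\<forall>n a b. a \<noteq> b \<longrightarrow> Q (pair 3 n) (kfun n a b)) \<and>
   (\<forall>a b. a \<noteq> b \<longrightarrow> x a b \<longrightarrow> Q (pair 4 0) (\<lambda>v. v (Ep a b))) \<and>
   (\<forall>a b. a \<noteq> b \<longrightarrow> \<not> x a b \<longrightarrow> Q (pair 4 1) (\<lambda>v. v (Ep a b)))" (is "?L \<longleftrightarrow> ?R")
proof
  assume L: ?L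
  show ?R
    by (intro conjI allI impI L[rule_format] annih.intros) blast+
next
  assume R: ?R
  show ?L
  proof (intro allI impI)
    note R1 = conjunct1[OF R] and S1 = conjunct2[OF R]
    note R2 = conjunct1[OF S1] and S2 = conjunct2[OF S1]
    note R3 = conjunct1[OF S2] and S3 = conjunct2[OF S2]
    note R4 = conjunct1[OF S3] and S4 = conjunct2[OF S3]
    note R5 = conjunct1[OF S4] and R6 = conjunct1[OF conjunct2[OF S4]]
      and R7 = conjunct2[OF conjunct2[OF S4]]
    fix k g assume "annih x k g"
    then show "Q k g"
    proof (induction rule: annih.induct)
      case (Al b n)
      then have "\<not> (\<exists>w. reduced w \<and> b = Al n w)" by blast
      then show ?case by (rule R1[rule_format])
    next
      case (Al' b n)
      then have "\<not> (\<exists>w. reduced w \<and> b = Al' n w)" by blast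
      then show ?case by (rule R2[rule_format])
    next
      case (off b n l)
      then have "\<not> (\<exists>w. reduced w \<and> (b = Al n w \<or> b = Al' n w))" by blast
      then show ?case by (rule R3[rule_format])
    next
      case (mul w n l)
      then show ?case by (rule R4[rule_format])
    next
      case (ker a b n)
      then show ?case by (rule R5[rule_format])
    next
      case (edge a b)
      then show ?case by (rule R6[rule_format])
    next
      case (nonedge a b)
      then show ?case by (rule R7[rule_format])
    qed
  qed
qed

lemma gr_iff: "cvec c \<in> gr (edge_rel M) \<longleftrightarrow>
   (\<forall>n i. bas_codes i \<longrightarrow> (\<forall>w. reduced_code w \<longrightarrow> i \<noteq> pair 0 (pair n w)) \<longrightarrow> locc c (pair 0 n) i) \<and>
   (\<forall>n i. bas_codes i \<longrightarrow> (\<forall>w. reduced_code w \<longrightarrow> i \<noteq> pair 1 (pair n w)) \<longrightarrow> locc c (pair 1 n) i) \<and>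
   (\<forall>n l i. bas_codes i \<longrightarrow> (\<forall>w. reduced_code w \<longrightarrow> i \<noteq> pair 0 (pair n w) \<and> i \<noteq> pair 1 (pair n w)) \<longrightarrow>
      locc c (pair 2 (pair n l)) i) \<and>
   (\<forall>n l w w'. reduced_code w \<longrightarrow> w' = lmul_code l w \<longrightarrow>
      locd c (pair 2 (pair n l)) (pair 0 (pair n w)) (pair 1 (pair n w'))) \<and>
   (\<forall>n a b. a \<noteq> b \<longrightarrow> lock c (pair 3 n) n a b) \<and>
   (\<forall>a b. a \<noteq> b \<longrightarrow> edge_rel M a b \<longrightarrow> locc c (pair 4 0) (pair 2 (pair a b))) \<and>
   (\<forall>a b. a \<noteq> b \<longrightarrow> \<not> edge_rel M a b \<longrightarrow> locc c (pair 4 1) (pair 2 (pair a b)))"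
proof -
  have codes: "(\<forall>i. bas_codes i \<longrightarrow> Q i) \<longleftrightarrow> (\<forall>b. Q (bas_code b))" for Q by (auto simp: bas_codes_iff)
  have words: "(\<forall>w. Q w) \<longleftrightarrow> (\<forall>w. Q (list_encode w))" for Q by (metis list_decode_inverse)
  have Al: "pair 0 (pair n (list_encode w)) = bas_code (Al n w)"
    and Al': "pair 1 (pair n (list_encode w)) = bas_code (Al' n w)"
    for n w by simp_all
  have Ep: "locc c k (pair 2 (pair a b)) \<longleftrightarrow> zloc (pr k) (cvec c (Ep a b))" for k a b
    using locc_iff[of c k "Ep a b"] by simp
  have red: "reduced_code (list_encode w) \<longleftrightarrow> reduced w" for w by (simp add: reduced_code_def)
  have mul: "(\<forall>w'. w' = lmul_code l (list_encode w) \<longrightarrow> Q w') \<longleftrightarrow> Q (list_encode (lmul_opt l w))" for l w Q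
    by (simp add: lmul_code_def)
  have cong: "(\<forall>w. reduced w \<longrightarrow> bas_code b \<noteq> bas_code (f w)) \<longleftrightarrow> \<not> (\<exists>w. reduced w \<and> b = f w)" for b f by auto
  have cong2: "(\<forall>w. reduced w \<longrightarrow> bas_code b \<noteq> bas_code (f w) \<and> bas_code b \<noteq> bas_code (g w)) \<longleftrightarrow>
      \<not> (\<exists>w. reduced w \<and> (b = f w \<or> b = g w))" for b f g by auto
  have A: "(\<forall>n i. bas_codes i \<longrightarrow> (\<forall>w. reduced_code w \<longrightarrow> i \<noteq> pair 0 (pair n w)) \<longrightarrow> locc c (pair 0 n) i) \<longleftrightarrow>
     (\<forall>n b. \<not> (\<exists>w. reduced w \<and> b = Al n w) \<longrightarrow> zloc (pr (pair 0 n)) (cvec c b))"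
    unfolding codes words[of "\<lambda>w. reduced_code w \<longrightarrow> _ \<noteq> pair 0 (pair _ w)"] Al red cong locc_iff ..
  have A': "(\<forall>n i. bas_codes i \<longrightarrow> (\<forall>w. reduced_code w \<longrightarrow> i \<noteq> pair 1 (pair n w)) \<longrightarrow> locc c (pair 1 n) i) \<longleftrightarrow>
     (\<forall>n b. \<not> (\<exists>w. reduced w \<and> b = Al' n w) \<longrightarrow> zloc (pr (pair 1 n)) (cvec c b))"
    unfolding codes words[of "\<lambda>w. reduced_code w \<longrightarrow> _ \<noteq> pair 1 (pair _ w)"] Al' red cong locc_iff ..
  have B: "(\<forall>n l i. bas_codes i \<longrightarrow> (\<forall>w. reduced_code w \<longrightarrow> i \<noteq> pair 0 (pair n w) \<and> i \<noteq> pair 1 (pair n w)) \<longrightarrow>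
      locc c (pair 2 (pair n l)) i) \<longleftrightarrow>
     (\<forall>n l b. \<not> (\<exists>w. reduced w \<and> (b = Al n w \<or> b = Al' n w)) \<longrightarrow> zloc (pr (pair 2 (pair n l))) (cvec c b))"
    unfolding codes words[of "\<lambda>w. reduced_code w \<longrightarrow> _ \<noteq> pair 0 (pair _ w) \<and> _ \<noteq> pair 1 (pair _ w)"]
      Al Al' red cong2 locc_iff ..
  have C: "(\<forall>n l w w'. reduced_code w \<longrightarrow> w' = lmul_code l w \<longrightarrow>
      locd c (pair 2 (pair n l)) (pair 0 (pair n w)) (pair 1 (pair n w'))) \<longleftrightarrow>
     (\<forall>n l w. reduced w \<longrightarrow> zloc (pr (pair 2 (pair n l))) (cvec c (Al n w) - cvec c (Al' n (lmul_opt l w))))"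
  proof (intro iff_allI)
    fix n l
    have "(\<forall>w w'. reduced_code w \<longrightarrow> w' = lmul_code l w \<longrightarrow> Q w w') \<longleftrightarrow> (\<forall>w. reduced w \<longrightarrow> Q (list_encode w) (list_encode (lmul_opt l w)))" for Q
      by (metis lmul_code_def list_decode_inverse list_encode_inverse reduced_code_def)
    then show "(\<forall>w w'. reduced_code w \<longrightarrow> w' = lmul_code l w \<longrightarrow>
        locd c (pair 2 (pair n l)) (pair 0 (pair n w)) (pair 1 (pair n w'))) \<longleftrightarrow>
      (\<forall>w. reduced w \<longrightarrow> zloc (pr (pair 2 (pair n l))) (cvec c (Al n w) - cvec c (Al' n (lmul_opt l w))))"
      unfolding Al Al' locd_iff[symmetric] by simp
  qed
  show ?thesis
    unfolding A A' B C lock_iff Ep gr_def mem_Collect_eq annih_all by (simp only: fsupp_cvec simp_thms)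
qed

lemma adef_gr:
  assumes "tdef d c" shows "adef d (\<lambda>e X. cvec (c e) \<in> gr (edge_rel (X 0)))"
proof -
  have edge: "adef k (\<lambda>e X. edge_rel (X 0) (a e) (b e))" if "tdef k a" "tdef k b" for k a b
    unfolding edge_rel_def by (intro adef_mem tdef_intros that) simp
  show ?thesis
    unfolding gr_iff
    by (intro edge adef_bas_codes adef_reduced_code adef_lmul_code adef_locc adef_locd adef_lock
        adef_intros tdef_intros assms[THEN tdef_le])
      (simp_all add: assms[THEN tdef_indep])
qed

section \<open>Least codes and the enumeration of the group\<close>

lemma cvec_0: "cvec 0 = (\<lambda>b. 0)"
proof -
  have "pair 0 0 = 0" by (simp add: prod_encode_def)
  then have "prod_decode 0 = (0, 0)" using prod_encode_inverse[of "(0, 0)"] by simp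
  then show ?thesis by (auto simp: cvec_def cpos_def cneg_def)
qed

lemma cvec_eq_iff: "cvec c = cvec c' \<longleftrightarrow> cadd c 0 c'"
  by (auto simp: cadd_def cvec_0)

text \<open>A vector has many codes, and the least one is taken. As 0 codes the zero vector,
  \<open>cadd c' 0 c\<close> says that both codes give the same vector.\<close>

definition codes :: "nat set \<Rightarrow> nat set" where
  "codes M = {c. cvec c \<in> gr (edge_rel M) \<and> (\<forall>c'. c' < c \<longrightarrow> \<not> cadd c' 0 c)}"

lemma adef_codes:
  assumes "tdef d c" shows "adef d (\<lambda>e X. c e \<in> codes (X 0))"
  unfolding codes_def mem_Collect_eq
  by (intro adef_gr adef_cadd adef_less adef_intros tdef_intros assms[THEN tdef_le])
    (simp_all add: assms[THEN tdef_indep])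

lemma codes_iff: "c \<in> codes M \<longleftrightarrow> cvec c \<in> gr (edge_rel M) \<and> (\<forall>c'<c. cvec c' \<noteq> cvec c)"
  unfolding codes_def mem_Collect_eq cvec_eq_iff by simp

lemma bij_codes: "bij_betw cvec (codes M) (gr (edge_rel M))"
  unfolding bij_betw_def
proof
  show "inj_on cvec (codes M)"
  proof (rule inj_onI, rule ccontr)
    fix c c' assume *: "c \<in> codes M" "c' \<in> codes M" "cvec c = cvec c'" "c \<noteq> c'"
    then have "c < c' \<or> c' < c" by linarith
    then show False
    proof
      assume "c < c'"
      then show False using *(2,3) unfolding codes_iff by blast
    next
      assume "c' < c"
      then show False using *(1) *(3)[symmetric] unfolding codes_iff by blast
    qed
  qed
  have "v \<in> cvec ` codes M" if v: "v \<in> gr (edge_rel M)" for v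
  proof -
    define c where "c = (LEAST c. cvec c = v)"
    have c: "cvec c = v" unfolding c_def by (rule LeastI_ex) (rule cvec_surj[OF gr_fsupp[OF v]])
    have "cvec c' \<noteq> v" if "c' < c" for c' using not_less_Least[OF that[unfolded c_def]] .
    then have "c \<in> codes M" using v unfolding codes_iff c by blast
    then show ?thesis using c by (metis imageI)
  qed
  moreover have "cvec c \<in> gr (edge_rel M)" if "c \<in> codes M" for c using that unfolding codes_iff by blast
  ultimately show "cvec ` codes M = gr (edge_rel M)" by blast
qed

lemma infinite_codes: "infinite (codes M)"
proof
  assume "finite (codes M)"
  then have "finite (gr (edge_rel M))" using bij_codes bij_betw_finite by blast
  then have fin: "finite (range (\<lambda>n. ebas (Ep n 0)))" by (rule finite_subset[rotated]) auto
  have "inj (\<lambda>n. ebas (Ep n 0))"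
  proof (rule injI)
    fix m n assume eq: "ebas (Ep m 0) = ebas (Ep n 0)"
    have "ebas (Ep n 0) (Ep m 0) \<noteq> 0" unfolding eq[symmetric] by simp
    then show "m = n" by (simp add: ebas_eq_0_iff)
  qed
  from finite_imageD[OF fin this] show False by simp
qed

lemma adef_enum_codes:
  assumes "tdef d c" "tdef d n" shows "adef d (\<lambda>e X. c e = enumerate (codes (X 0)) (n e))"
  using adef_enumerate[OF assms, where S = "\<lambda>X. codes (X 0)"] adef_codes infinite_codes by blast

definition elem :: "nat set \<Rightarrow> nat \<Rightarrow> vec" where
  "elem M i = cvec (enumerate (codes M) i)"

lemma bij_elem: "bij_betw (elem M) UNIV (gr (edge_rel M))"
  using bij_betw_trans[OF bij_enumerate[OF infinite_codes] bij_codes] by (simp add: elem_def[abs_def] o_def)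

definition group_of :: "nat set \<Rightarrow> nat set" where
  "group_of M = {pair 0 (list_encode [i, j, k]) | i j k. (\<forall>b. elem M i b + elem M j b = elem M k b)}"

lemma group_of_iff: "N = group_of M \<longleftrightarrow> (\<forall>n. n \<in> N \<longleftrightarrow>
   (\<exists>i j k. n = pair 0 (Suc (pair i (Suc (pair j (Suc (pair k 0)))))) \<and>
     (\<exists>a b c. a = enumerate (codes M) i \<and> b = enumerate (codes M) j \<and> c = enumerate (codes M) k \<and> cadd a b c)))"
  unfolding group_of_def elem_def cadd_def by auto

lemma group_of_definable:
  "\<exists>\<phi>. arithmetical \<phi> \<and> free_num \<phi> = {} \<and> free_set \<phi> \<subseteq> {0, 1} \<and>
     (\<forall>e X. sat e X \<phi> \<longleftrightarrow> X 1 = group_of (X 0))"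
proof -
  have "adef 0 (\<lambda>e X. X 1 = group_of (X 0))"
    unfolding group_of_iff
    by (intro adef_mem adef_enum_codes adef_cadd adef_intros tdef_intros) simp_all
  then show ?thesis unfolding adef_def by simp
qed

section \<open>Forcing of formulas without set quantifiers\<close>

primrec no_set_quant :: "fm \<Rightarrow> bool" where
  "no_set_quant (Mem t i) = True"
| "no_set_quant (Equal s t) = True"
| "no_set_quant (Neg \<phi>) = no_set_quant \<phi>"
| "no_set_quant (And \<phi> \<psi>) = (no_set_quant \<phi> \<and> no_set_quant \<psi>)"
| "no_set_quant (BigAnd \<Phi>) = (\<forall>m. no_set_quant (\<Phi> m))"
| "no_set_quant (AllN i \<phi>) = no_set_quant \<phi>"
| "no_set_quant (AllS i \<phi>) = False"

lemma arithmetical_no_set_quant: "arithmetical \<phi> \<Longrightarrow> no_set_quant \<phi>"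
  by (induction \<phi>) auto

text \<open>All subformulas with the assignments under which evaluation meets them. Number
  quantifiers and \<open>BigAnd\<close> branch countably, so countably many dense sets suffice for
  the truth lemma.\<close>

primrec instances :: "fm \<Rightarrow> (nat \<Rightarrow> nat) \<Rightarrow> (fm \<times> (nat \<Rightarrow> nat)) set" where
  "instances (Mem t i) e = {(Mem t i, e)}"
| "instances (Equal s t) e = {(Equal s t, e)}"
| "instances (Neg \<phi>) e = insert (Neg \<phi>, e) (instances \<phi> e)"
| "instances (And \<phi> \<psi>) e = insert (And \<phi> \<psi>, e) (instances \<phi> e \<union> instances \<psi> e)"
| "instances (BigAnd \<Phi>) e = insert (BigAnd \<Phi>, e) (\<Union>m. instances (\<Phi> m) e)"
| "instances (AllN i \<phi>) e = insert (AllN i \<phi>, e) (\<Union>n. instances \<phi> (e(i := n)))"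
| "instances (AllS i \<phi>) e = {}"

lemma countable_instances: "countable (instances \<phi> e)"
  by (induction \<phi> arbitrary: e) auto

locale forcing_poset =
  fixes P :: "'p set" and le :: "'p \<Rightarrow> 'p \<Rightarrow> bool"
  assumes forcing_notion: "forcing_notion P le"
begin

lemma le_refl: "p \<in> P \<Longrightarrow> le p p"
  and le_trans: "p \<in> P \<Longrightarrow> q \<in> P \<Longrightarrow> r \<in> P \<Longrightarrow> le p q \<Longrightarrow> le q r \<Longrightarrow> le p r"
  using forcing_notion unfolding forcing_notion_def by blast+

lemma forces_mono:
  "forces P le p e X \<phi> \<Longrightarrow> p \<in> P \<Longrightarrow> q \<in> P \<Longrightarrow> le q p \<Longrightarrow> forces P le q e X \<phi>"
proof (induction \<phi> arbitrary: e X)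
  case (Mem t i)
  then have "le r p" if "r \<in> P" "le r q" for r using le_trans[OF that(1), of q p] that by blast
  then show ?case using Mem.prems(1) by simp
next
  case (Neg \<phi>)
  then have "le r p" if "r \<in> P" "le r q" for r using le_trans[OF that(1), of q p] that by blast
  then show ?case using Neg.prems(1) by simp
qed auto

text \<open>In this weak form of forcing, being forced densely below p amounts to being forced by p;
  so witnesses need only be found densely.\<close>

lemma forces_dense:
  "p \<in> P \<Longrightarrow> (\<And>q. q \<in> P \<Longrightarrow> le q p \<Longrightarrow> \<exists>r\<in>P. le r q \<and> forces P le r e X \<phi>) \<Longrightarrow> forces P le p e X \<phi>"
proof (induction \<phi> arbitrary: e X)
  case (Mem t i)
  have "\<exists>r\<in>P. le r q \<and> (\<exists>s\<in>X i (tval e t). le r s)" if q: "q \<in> P" "le q p" for q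
  proof -
    obtain r where r: "r \<in> P" "le r q" "forces P le r e X (Mem t i)" using Mem.prems(2)[OF q] by blast
    from r(3) have "\<forall>q\<in>P. le q r \<longrightarrow> (\<exists>r\<in>P. le r q \<and> (\<exists>s\<in>X i (tval e t). le r s))" by simp
    with r(1) le_refl[OF r(1)]
    obtain r' where "r' \<in> P" "le r' r" "\<exists>s\<in>X i (tval e t). le r' s" by blast
    then show ?thesis using le_trans r q by blast
  qed
  then show ?case by simp
next
  case (Equal s t)
  then show ?case using le_refl by auto
next
  case (Neg \<phi>)
  have False if q: "q \<in> P" "le q p" "forces P le q e X \<phi>" for q
  proof -
    obtain r where r: "r \<in> P" "le r q" "forces P le r e X (Neg \<phi>)" using Neg.prems(2)[OF q(1,2)] by blast
    then show False using forces_mono[OF q(3) q(1) r(1,2)] le_refl by auto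
  qed
  then show ?case by auto
next
  case (And \<phi> \<psi>)
  have "forces P le p e X \<phi>" by (rule And.IH(1)[OF And.prems(1)]) (use And.prems(2) in fastforce)
  moreover have "forces P le p e X \<psi>" by (rule And.IH(2)[OF And.prems(1)]) (use And.prems(2) in fastforce)
  ultimately show ?case by simp
next
  case (BigAnd \<Phi>)
  have "forces P le p e X (\<Phi> m)" for m
  proof (rule BigAnd.IH[OF _ BigAnd.prems(1)])
    fix q assume "q \<in> P" "le q p"
    from BigAnd.prems(2)[OF this] show "\<exists>r\<in>P. le r q \<and> forces P le r e X (\<Phi> m)" by auto
  qed simp
  then show ?case by simp
next
  case (AllN i \<phi>)
  have "forces P le p (e(i := n)) X \<phi>" for n
  proof (rule AllN.IH[OF AllN.prems(1)])
    fix q assume "q \<in> P" "le q p"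
    from AllN.prems(2)[OF this] show "\<exists>r\<in>P. le r q \<and> forces P le r (e(i := n)) X \<phi>" by auto
  qed
  then show ?case by simp
next
  case (AllS i \<phi>)
  have "forces P le p e (X(i := A)) \<phi>" if "\<forall>n. A n \<subseteq> P" for A
  proof (rule AllS.IH[OF AllS.prems(1)])
    fix q assume "q \<in> P" "le q p"
    from AllS.prems(2)[OF this] that show "\<exists>r\<in>P. le r q \<and> forces P le r e (X(i := A)) \<phi>" by auto
  qed
  then show ?case by simp
qed

lemma not_forces: "p \<in> P \<Longrightarrow> \<not> forces P le p e X \<phi> \<Longrightarrow> \<exists>q\<in>P. le q p \<and> forces P le q e X (Neg \<phi>)"
  using forces_dense[of p e X \<phi>] by auto

lemma forces_Imp:
  assumes "p \<in> P" "\<And>q. q \<in> P \<Longrightarrow> le q p \<Longrightarrow> forces P le q e X \<phi> \<Longrightarrow> forces P le q e X \<psi>"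
  shows "forces P le p e X (Imp \<phi> \<psi>)"
  using assms le_refl by (auto simp: Imp_def)

lemma forces_ExS_I:
  assumes "p \<in> P" "\<And>n. B n \<subseteq> P" "forces P le p e (X(i := B)) \<phi>"
  shows "forces P le p e X (ExS i \<phi>)"
proof -
  have "\<not> forces P le q e X (AllS i (Neg \<phi>))" if q: "q \<in> P" "le q p" for q
  proof
    assume "forces P le q e X (AllS i (Neg \<phi>))"
    then have "forces P le q e (X(i := B)) (Neg \<phi>)" using assms(2) by simp
    then show False using forces_mono[OF assms(3,1) q] q(1) le_refl by auto
  qed
  then show ?thesis by (simp add: ExS_def)
qed

lemma forces_ExS_D:
  assumes "forces P le p e X (ExS i \<phi>)" "p \<in> P" "q \<in> P" "le q p"
  shows "\<exists>r\<in>P. le r q \<and> (\<exists>B. (\<forall>n. B n \<subseteq> P) \<and> forces P le r e (X(i := B)) \<phi>)"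
proof -
  have "\<not> forces P le q e X (AllS i (Neg \<phi>))"
    using assms unfolding ExS_def forces.simps(3) by blast
  then obtain B where "\<forall>n. B n \<subseteq> P" "\<not> forces P le q e (X(i := B)) (Neg \<phi>)"
    unfolding forces.simps(7) by blast
  then show ?thesis unfolding forces.simps(3) by blast
qed

section \<open>Filters deciding countably many formulas\<close>

definition dense where
  "dense D \<longleftrightarrow> (\<forall>p\<in>P. \<exists>q\<in>P. le q p \<and> q \<in> D)"

definition filter where
  "filter G \<longleftrightarrow> G \<subseteq> P \<and> (\<forall>p\<in>G. \<forall>q\<in>P. le p q \<longrightarrow> q \<in> G) \<and>
     (\<forall>p\<in>G. \<forall>q\<in>G. \<exists>r\<in>G. le r p \<and> le r q)"

lemma rasiowa_sikorski:
  assumes "countable \<D>" "\<And>D. D \<in> \<D> \<Longrightarrow> dense D" "p \<in> P"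
  shows "\<exists>G. filter G \<and> p \<in> G \<and> (\<forall>D\<in>\<D>. G \<inter> D \<noteq> {})"
proof -
  \<comment> \<open>P itself is added to the family, so that there is something to
    enumerate.\<close>
  define d where "d n = from_nat_into (insert P \<D>) n" for n
  have "dense P" using le_refl by (auto simp: dense_def)
  then have d: "dense (d n)" for n
    using from_nat_into[of "insert P \<D>" n] assms(2) unfolding d_def by auto
  have "\<exists>s. \<forall>n. (s n \<in> P \<and> le (s n) p) \<and> (le (s (Suc n)) (s n) \<and> s (Suc n) \<in> d n)"
  proof (rule dependent_nat_choice)
    show "\<exists>x. x \<in> P \<and> le x p" using assms(3) le_refl by blast
    fix x n assume x: "x \<in> P \<and> le x p"
    then obtain y where y: "y \<in> P" "le y x" "y \<in> d n" using d[of n] unfolding dense_def by blast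
    then have "le y p" using le_trans x assms(3) by blast
    with y show "\<exists>y. (y \<in> P \<and> le y p) \<and> le y x \<and> y \<in> d n" by blast
  qed
  then obtain s where s: "\<And>n. s n \<in> P" "\<And>n. le (s n) p" "\<And>n. le (s (Suc n)) (s n)" "\<And>n. s (Suc n) \<in> d n"
    by blast
  have anti: "le (s (m + n)) (s m)" for m n
  proof (induction n)
    case (Suc n)
    then show ?case using le_trans[OF s(1) s(1) s(1) s(3)[of "m + n"]] by simp
  qed (simp add: le_refl s(1))
  define G where "G = {q \<in> P. \<exists>n. le (s n) q}"
  have "\<exists>r\<in>G. le r a \<and> le r b" if ab: "a \<in> G" "b \<in> G" for a b
  proof -
    obtain m n where mn: "le (s m) a" "le (s n) b" using ab unfolding G_def by blast
    have "s (m + n) \<in> G" using s le_refl by (auto simp: G_def)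
    moreover have "le (s (m + n)) a" "le (s (m + n)) b"
      using le_trans[OF s(1) s(1) _ anti[of m n] mn(1)] le_trans[OF s(1) s(1) _ anti[of n m] mn(2)] ab
      by (auto simp: G_def add.commute)
    ultimately show ?thesis by blast
  qed
  moreover have "b \<in> G" if "a \<in> G" "b \<in> P" "le a b" for a b
    using that s le_trans unfolding G_def by blast
  ultimately have "filter G" by (auto simp: filter_def G_def)
  moreover have "p \<in> G" using s assms(3) by (auto simp: G_def)
  moreover have "G \<inter> D \<noteq> {}" if "D \<in> \<D>" for D
  proof -
    have "\<exists>n. from_nat_into (insert P \<D>) n = D"
      using from_nat_into_surj[of "insert P \<D>" D] assms(1) that by simp
    then obtain n where "d n = D" unfolding d_def by blast
    then have "s (Suc n) \<in> G \<inter> D" using s le_refl by (auto simp: G_def)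
    then show ?thesis by blast
  qed
  ultimately show ?thesis by blast
qed

definition eval_name :: "'p set \<Rightarrow> 'p nice_name \<Rightarrow> nat set" where
  "eval_name G N = {n. G \<inter> N n \<noteq> {}}"

definition names :: "(nat \<Rightarrow> 'p nice_name) \<Rightarrow> bool" where
  "names A \<longleftrightarrow> (\<forall>i n. A i n \<subseteq> P)"

lemma names_upd: "names A \<Longrightarrow> (\<And>n. B n \<subseteq> P) \<Longrightarrow> names (A(i := B))"
  by (auto simp: names_def)

text \<open>What one condition of the filter must settle for the truth lemma to pass through an
  instance. A failing conjunction or number quantifier must fail at a specific conjunct or number,
  and membership must be realized by a specific condition of the name.\<close>

fun witnesses :: "(nat \<Rightarrow> 'p nice_name) \<Rightarrow> fm \<times> (nat \<Rightarrow> nat) \<Rightarrow> 'p \<Rightarrow> bool" where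
  "witnesses A (Mem t i, e) p \<longleftrightarrow> (\<exists>s\<in>A i (tval e t). le p s) \<or> forces P le p e A (Neg (Mem t i))"
| "witnesses A (Equal s t, e) p \<longleftrightarrow> True"
| "witnesses A (Neg \<phi>, e) p \<longleftrightarrow> forces P le p e A \<phi> \<or> forces P le p e A (Neg \<phi>)"
| "witnesses A (And \<phi> \<psi>, e) p \<longleftrightarrow> forces P le p e A (And \<phi> \<psi>) \<or> forces P le p e A (Neg \<phi>) \<or> forces P le p e A (Neg \<psi>)"
| "witnesses A (BigAnd \<Phi>, e) p \<longleftrightarrow> forces P le p e A (BigAnd \<Phi>) \<or> (\<exists>m. forces P le p e A (Neg (\<Phi> m)))"
| "witnesses A (AllN i \<phi>, e) p \<longleftrightarrow> forces P le p e A (AllN i \<phi>) \<or> (\<exists>n. forces P le p (e(i := n)) A (Neg \<phi>))"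
| "witnesses A (AllS i \<phi>, e) p \<longleftrightarrow> True"

lemma dense_witnesses: "dense {p \<in> P. witnesses A (\<phi>, e) p}"
  unfolding dense_def
proof
  fix p assume p: "p \<in> P"
  note nf = not_forces[OF p]
  have "\<exists>q\<in>P. le q p \<and> witnesses A (\<phi>, e) q"
  proof (cases "forces P le p e A \<phi>")
    case True
    show ?thesis
    proof (cases \<phi>)
      case (Mem t i)
      with True have "\<forall>q\<in>P. le q p \<longrightarrow> (\<exists>r\<in>P. le r q \<and> (\<exists>s\<in>A i (tval e t). le r s))" by simp
      then obtain r where "r \<in> P" "le r p" "\<exists>s\<in>A i (tval e t). le r s" using p le_refl[OF p] by blast
      then show ?thesis by (auto simp: Mem simp del: forces.simps)
    qed (use True p le_refl[OF p] in \<open>force simp del: forces.simps\<close>)+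
  next
    case False
    show ?thesis
    proof (cases \<phi>)
      case (BigAnd \<Phi>)
      with False obtain m where "\<not> forces P le p e A (\<Phi> m)" by auto
      then show ?thesis using nf[of e A "\<Phi> m"] by (auto simp: BigAnd simp del: forces.simps)
    next
      case (AllN i \<psi>)
      with False obtain n where "\<not> forces P le p (e(i := n)) A \<psi>" by auto
      then show ?thesis using nf[of "e(i := n)" A \<psi>] by (auto simp: AllN simp del: forces.simps)
    next
      case (And \<psi> \<chi>)
      with False consider "\<not> forces P le p e A \<psi>" | "\<not> forces P le p e A \<chi>" by auto
      then show ?thesis
        using nf[of e A \<psi>] nf[of e A \<chi>] by cases (auto simp: And simp del: forces.simps)
    next
      case (Neg \<psi>)
      with False show ?thesis by auto
    next
      case (Mem t i)
      then show ?thesis using nf[OF False] by (auto simp del: forces.simps)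
    qed (use p le_refl[OF p] in auto)
  qed
  then show "\<exists>q\<in>P. le q p \<and> q \<in> {p \<in> P. witnesses A (\<phi>, e) p}" by blast
qed

lemma forces_consistent:
  assumes "filter G" "p \<in> G" "q \<in> G" "forces P le p e A \<phi>" "forces P le q e A (Neg \<phi>)"
  shows False
proof -
  obtain r where r: "r \<in> G" "le r p" "le r q" using assms unfolding filter_def by blast
  have "p \<in> P" "q \<in> P" "r \<in> P" using assms r by (auto simp: filter_def)
  then have "forces P le r e A \<phi>" "forces P le r e A (Neg \<phi>)" using forces_mono assms r by blast+
  then show False using \<open>r \<in> P\<close> le_refl by auto
qed

text \<open>The usual induction, but for a filter in V that meets only the dense sets belonging to
  the instances. Set quantifiers are excluded because they would bring in all names.\<close>

lemma truth:
  assumes G: "filter G" and A: "names A"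
  shows "no_set_quant \<phi> \<Longrightarrow> (\<And>i. i \<in> instances \<phi> e \<Longrightarrow> \<exists>p\<in>G. witnesses A i p) \<Longrightarrow>
    sat e (\<lambda>i. eval_name G (A i)) \<phi> \<longleftrightarrow> (\<exists>p\<in>G. forces P le p e A \<phi>)"
proof (induction \<phi> arbitrary: e)
  case (Mem t i)
  have GP: "G \<subseteq> P" using G by (simp add: filter_def)
  show ?case
  proof
    assume "sat e (\<lambda>i. eval_name G (A i)) (Mem t i)"
    then obtain p where "p \<in> G" "p \<in> A i (tval e t)" by (auto simp: eval_name_def)
    moreover from this have "forces P le p e A (Mem t i)" using GP le_refl by auto
    ultimately show "\<exists>p\<in>G. forces P le p e A (Mem t i)" by blast
  next
    assume "\<exists>p\<in>G. forces P le p e A (Mem t i)"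
    then obtain p where p: "p \<in> G" "forces P le p e A (Mem t i)" by blast
    obtain q where q: "q \<in> G" "witnesses A (Mem t i, e) q" using Mem.prems(2) by auto
    then obtain s where s: "s \<in> A i (tval e t)" "le q s"
      using forces_consistent[OF G p(1) q(1) p(2)] by auto
    moreover from this have "s \<in> P" using A by (auto simp: names_def)
    ultimately have "s \<in> G" using G q(1) unfolding filter_def by blast
    then show "sat e (\<lambda>i. eval_name G (A i)) (Mem t i)"
      using s(1) by (auto simp: eval_name_def)
  qed
next
  case (Equal s t)
  have "\<exists>p. p \<in> G" using Equal.prems(2)[of "(Equal s t, e)"] by auto
  then show ?case by auto
next
  case (Neg \<phi>)
  have IH: "sat e (\<lambda>i. eval_name G (A i)) \<phi> \<longleftrightarrow> (\<exists>p\<in>G. forces P le p e A \<phi>)"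
    using Neg.prems by (intro Neg.IH) auto
  obtain p where p: "p \<in> G" "witnesses A (Neg \<phi>, e) p" using Neg.prems(2)[of "(Neg \<phi>, e)"] by auto
  show ?case
    unfolding sat.simps IH using p forces_consistent[OF G, of _ _ e A \<phi>]
    by (auto simp del: forces.simps)
next
  case (And \<phi> \<psi>)
  have IH: "sat e (\<lambda>i. eval_name G (A i)) \<phi> \<longleftrightarrow> (\<exists>p\<in>G. forces P le p e A \<phi>)"
    "sat e (\<lambda>i. eval_name G (A i)) \<psi> \<longleftrightarrow> (\<exists>p\<in>G. forces P le p e A \<psi>)"
    using And.prems by (auto intro!: And.IH)
  obtain p where p: "p \<in> G" "witnesses A (And \<phi> \<psi>, e) p"
    using And.prems(2)[of "(And \<phi> \<psi>, e)"] by auto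
  show ?case
    unfolding sat.simps IH
    using p forces_consistent[OF G, of _ p e A \<phi>] forces_consistent[OF G, of _ p e A \<psi>] by auto
next
  case (BigAnd \<Phi>)
  have IH: "sat e (\<lambda>i. eval_name G (A i)) (\<Phi> m) \<longleftrightarrow> (\<exists>p\<in>G. forces P le p e A (\<Phi> m))" for m
  proof (rule BigAnd.IH)
    fix i assume "i \<in> instances (\<Phi> m) e"
    then have "i \<in> instances (BigAnd \<Phi>) e" by auto
    then show "\<exists>p\<in>G. witnesses A i p" by (rule BigAnd.prems(2))
  qed (use BigAnd.prems(1) in auto)
  obtain p where p: "p \<in> G" "witnesses A (BigAnd \<Phi>, e) p"
    using BigAnd.prems(2)[of "(BigAnd \<Phi>, e)"] by auto
  show ?case
    unfolding sat.simps IH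
    using p forces_consistent[OF G, of _ p e A "\<Phi> _"] by (simp del: forces.simps(3)) blast
next
  case (AllN i \<phi>)
  have IH: "sat (e(i := n)) (\<lambda>i. eval_name G (A i)) \<phi> \<longleftrightarrow> (\<exists>p\<in>G. forces P le p (e(i := n)) A \<phi>)" for n
  proof (rule AllN.IH)
    fix i' assume "i' \<in> instances \<phi> (e(i := n))"
    then have "i' \<in> instances (AllN i \<phi>) e" by auto
    then show "\<exists>p\<in>G. witnesses A i' p" by (rule AllN.prems(2))
  qed (use AllN.prems(1) in auto)
  obtain p where p: "p \<in> G" "witnesses A (AllN i \<phi>, e) p"
    using AllN.prems(2)[of "(AllN i \<phi>, e)"] by auto
  show ?case
    unfolding sat.simps IH
    using p forces_consistent[OF G, of _ p "e(i := _)" A \<phi>] by (simp del: forces.simps(3)) blast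
qed simp

text \<open>From here on genericity enters only in this form: for the listed formulas, truth under
  the evaluated names is the same as being forced by a member of G.\<close>

definition decided where
  "decided G \<Phi> \<longleftrightarrow> (\<forall>(\<phi>, e, A) \<in> \<Phi>. no_set_quant \<phi> \<longrightarrow> names A \<longrightarrow>
     (sat e (\<lambda>i. eval_name G (A i)) \<phi> \<longleftrightarrow> (\<exists>p\<in>G. forces P le p e A \<phi>)))"

lemma decidedD:
  "decided G \<Phi> \<Longrightarrow> (\<phi>, e, A) \<in> \<Phi> \<Longrightarrow> no_set_quant \<phi> \<Longrightarrow> names A \<Longrightarrow>
    sat e (\<lambda>i. eval_name G (A i)) \<phi> \<longleftrightarrow> (\<exists>p\<in>G. forces P le p e A \<phi>)"
  unfolding decided_def by blast

lemma generic_exists: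
  assumes "countable \<Phi>" "p \<in> P" shows "\<exists>G. p \<in> G \<and> filter G \<and> decided G \<Phi>"
proof -
  define \<D> where "\<D> = (\<Union>(\<phi>, e, A)\<in>\<Phi>. (\<lambda>i. {p \<in> P. witnesses A i p}) ` instances \<phi> e)"
  have "countable \<D>" unfolding \<D>_def
    using assms(1) by (intro countable_UN) (auto intro: countable_instances)
  moreover have "dense D" if "D \<in> \<D>" for D using that dense_witnesses by (auto simp: \<D>_def)
  ultimately obtain G where G: "filter G" "p \<in> G" "\<And>D. D \<in> \<D> \<Longrightarrow> G \<inter> D \<noteq> {}"
    using rasiowa_sikorski[of \<D> p] assms(2) by blast
  have "decided G \<Phi>"
    unfolding decided_def
  proof (clarify, rule truth[OF G(1)])
    fix \<phi> e A i assume "(\<phi>, e, A) \<in> \<Phi>" "i \<in> instances \<phi> e"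
    then have "{p \<in> P. witnesses A i p} \<in> \<D>" by (auto simp: \<D>_def)
    from G(3)[OF this] show "\<exists>p\<in>G. witnesses A i p" by blast
  qed auto
  then show ?thesis using G by blast
qed

text \<open>Otherwise some q below p forces the negation. A filter through q contains p, and if it
  also decides the negation, it makes both \<psi> and its negation true.\<close>

lemma forces_generic:
  assumes p: "p \<in> P" and \<psi>: "no_set_quant \<psi>" and A: "names A" and \<Phi>: "countable \<Phi>"
    and sat: "\<And>G. p \<in> G \<Longrightarrow> G \<subseteq> P \<Longrightarrow> decided G \<Phi> \<Longrightarrow> sat e (\<lambda>i. eval_name G (A i)) \<psi>"
  shows "forces P le p e A \<psi>"
proof (rule ccontr)
  assume "\<not> forces P le p e A \<psi>"
  then obtain q where q: "q \<in> P" "le q p" "forces P le q e A (Neg \<psi>)" using not_forces[OF p] by blast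
  have "countable (insert (Neg \<psi>, e, A) \<Phi>)" using \<Phi> by simp
  from generic_exists[OF this q(1)]
  obtain G where G: "q \<in> G" "filter G" "decided G (insert (Neg \<psi>, e, A) \<Phi>)" by blast
  have "p \<in> G" using G(1,2) q p unfolding filter_def by blast
  moreover have "decided G \<Phi>" using G(3) unfolding decided_def by blast
  ultimately have "sat e (\<lambda>i. eval_name G (A i)) \<psi>" using sat G(2) by (simp add: filter_def)
  moreover have "sat e (\<lambda>i. eval_name G (A i)) (Neg \<psi>)"
    using decidedD[OF G(3) insertI1] \<psi> A G(1) q(3) unfolding no_set_quant.simps by blast
  ultimately show False by simp
qed

definition borel_name :: "(nat \<Rightarrow> fm) \<Rightarrow> (nat \<Rightarrow> nat) \<Rightarrow> (nat \<Rightarrow> 'p nice_name) \<Rightarrow> 'p nice_name" where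
  "borel_name \<theta> e A n = {p \<in> P. forces P le p e A (\<theta> n)}"

lemma borel_name_subset: "borel_name \<theta> e A n \<subseteq> P"
  by (auto simp: borel_name_def)

lemma eval_borel_name:
  assumes "decided G \<Phi>" "G \<subseteq> P" "range (\<lambda>n. (\<theta> n, e, A)) \<subseteq> \<Phi>" "\<And>n. no_set_quant (\<theta> n)" "names A"
  shows "eval_name G (borel_name \<theta> e A) = {n. sat e (\<lambda>i. eval_name G (A i)) (\<theta> n)}"
proof -
  have "sat e (\<lambda>i. eval_name G (A i)) (\<theta> n) \<longleftrightarrow> (\<exists>p\<in>G. forces P le p e A (\<theta> n))" for n
    by (rule decidedD[OF assms(1) _ assms(4,5)]) (use assms(3) in blast)
  then show ?thesis using assms(2) by (auto simp: eval_name_def borel_name_def)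
qed

end

section \<open>Transfer of a reduction to forcing extensions\<close>

text \<open>Isomorphism with its witness exposed as a real z. Unlike \<open>isomorphic\<close>, this
  is expressible without set quantifiers, and z is the argument of the Borel functions between
  witnesses.\<close>

definition iso_code :: "language \<Rightarrow> nat set \<Rightarrow> nat set \<Rightarrow> nat set \<Rightarrow> bool" where
  "iso_code L M N z \<longleftrightarrow> (\<exists>\<pi>. bij \<pi> \<and> (\<forall>a b. pair a b \<in> z \<longleftrightarrow> b = \<pi> a) \<and>
     (\<forall>r xs. (r, length xs) \<in> L \<longrightarrow> (fact_code r xs \<in> M \<longleftrightarrow> fact_code r (map \<pi> xs) \<in> N)))"

definition iso_body :: "language \<Rightarrow> nat \<Rightarrow> nat \<Rightarrow> fm" where
  "iso_body L s t = (let z = s + t + 1 in And (bij_fm z)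
     (BigAnd (\<lambda>m. case prod_decode m of (r, k) \<Rightarrow>
        if (r, k) \<in> L then preserve_fm r k s t z else Truth)))"

lemma iso_fm_eq: "iso_fm L s t = ExS (s + t + 1) (iso_body L s t)"
  by (simp add: iso_fm_def iso_body_def Let_def)

lemma sat_iso_body:
  fixes X :: "nat \<Rightarrow> nat set"
  shows "sat e X (iso_body L s t) \<longleftrightarrow> iso_code L (X s) (X t) (X (s + t + 1))"
proof -
  let ?z = "s + t + 1"
  have all: "(\<forall>m. Q (prod_decode m)) \<longleftrightarrow> (\<forall>r k. Q (r, k))" for Q
    by (metis prod_encode_inverse surj_pair)
  have "sat e X (iso_body L s t) \<longleftrightarrow> sat e X (bij_fm ?z) \<and>
      (\<forall>r k. (r, k) \<in> L \<longrightarrow> sat e X (preserve_fm r k s t ?z))"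
    unfolding iso_body_def Let_def sat.simps
      all[of "\<lambda>p. sat e X (case p of (r, k) \<Rightarrow> if (r, k) \<in> L then preserve_fm r k s t ?z else Truth)"]
    by auto
  also have "\<dots> \<longleftrightarrow> (\<exists>\<pi>. bij \<pi> \<and> (\<forall>a b. pair a b \<in> X ?z \<longleftrightarrow> b = \<pi> a) \<and>
      (\<forall>r k. (r, k) \<in> L \<longrightarrow> sat e X (preserve_fm r k s t ?z)))"
    by (auto simp: sat_bij)
  also have "\<dots> \<longleftrightarrow> iso_code L (X s) (X t) (X ?z)"
    unfolding iso_code_def
  proof (intro iff_exI conj_cong refl)
    fix \<pi> :: "nat \<Rightarrow> nat" assume \<pi>: "\<forall>a b. pair a b \<in> X ?z \<longleftrightarrow> b = \<pi> a"
    have ys: "(length ys = length xs \<and> (\<forall>i<length xs. ys ! i = \<pi> (xs ! i))) \<longleftrightarrow> ys = map \<pi> xs" for xs ys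
      by (auto intro: nth_equalityI)
    have "sat e X (preserve_fm r k s t ?z) \<longleftrightarrow> (\<forall>xs. length xs = k \<longrightarrow>
        (fact_code r xs \<in> X s \<longleftrightarrow> fact_code r (map \<pi> xs) \<in> X t))" for r k
      unfolding sat_preserve \<pi>[rule_format] using ys by metis
    then show "(\<forall>r k. (r, k) \<in> L \<longrightarrow> sat e X (preserve_fm r k s t ?z)) \<longleftrightarrow>
        (\<forall>r xs. (r, length xs) \<in> L \<longrightarrow> (fact_code r xs \<in> X s \<longleftrightarrow> fact_code r (map \<pi> xs) \<in> X t))"
      by auto
  qed
  finally show ?thesis .
qed

lemma no_set_quant_connectives [simp]:
  "no_set_quant (Imp \<phi> \<psi>) \<longleftrightarrow> no_set_quant \<phi> \<and> no_set_quant \<psi>"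
  "no_set_quant (Iff \<phi> \<psi>) \<longleftrightarrow> no_set_quant \<phi> \<and> no_set_quant \<psi>"
  "no_set_quant (ExN i \<phi>) \<longleftrightarrow> no_set_quant \<phi>"
  "no_set_quant Truth"
  by (auto simp: Imp_def Iff_def ExN_def Truth_def)

lemma no_set_quant_foldr:
  "no_set_quant (foldr AllN vs \<phi>) \<longleftrightarrow> no_set_quant \<phi>"
  "(\<And>i. no_set_quant (f i)) \<Longrightarrow> no_set_quant (foldr (\<lambda>i. And (f i)) vs Truth)"
  by (induction vs) auto

lemma no_set_quant_iso_body: "no_set_quant (iso_body L s t)"
  by (auto simp: iso_body_def Let_def bij_fm_def preserve_fm_def no_set_quant_foldr split: prod.split)

lemma no_set_quant_lfm: "no_set_quant (lfm_fm s \<phi>)"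
  by (induction \<phi>) auto

lemma no_set_quant_Mod: "no_set_quant (Mod_fm T s)"
  by (auto simp: Mod_fm_def no_set_quant_lfm)

lemma no_set_quant_rename: "no_set_quant \<phi> \<Longrightarrow> no_set_quant (rename f \<phi>)"
  by (induction \<phi>) auto

text \<open>Formulas with numerals, negation and countable conjunctions but without set quantifiers
  define precisely the Borel sets of sequences of reals.\<close>

definition borel :: "((nat \<Rightarrow> nat set) \<Rightarrow> bool) \<Rightarrow> bool" where
  "borel R \<longleftrightarrow> (\<exists>\<phi>. no_set_quant \<phi> \<and> (\<forall>X. sat (\<lambda>_. 0) X \<phi> \<longleftrightarrow> R X))"

context forcing_poset
begin

text \<open>Every name needed for an existential quantifier is the image of given names under a Borel function.\<close>

lemma borel_image_name:
  assumes F: "\<And>n. borel (\<lambda>X. n \<in> F X)" and A: "names A"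
  shows "\<exists>B \<Phi>. (\<forall>n. B n \<subseteq> P) \<and> countable \<Phi> \<and>
    (\<forall>G. decided G \<Phi> \<longrightarrow> G \<subseteq> P \<longrightarrow> eval_name G B = F (\<lambda>i. eval_name G (A i)))"
proof -
  obtain \<theta> where \<theta>: "\<And>n. no_set_quant (\<theta> n)" "\<And>n X. sat (\<lambda>_. 0) X (\<theta> n) \<longleftrightarrow> n \<in> F X"
    using F unfolding borel_def by metis
  define B where "B = borel_name \<theta> (\<lambda>_. 0) A"
  define \<Phi> where "\<Phi> = range (\<lambda>n. (\<theta> n, (\<lambda>_. 0) :: nat \<Rightarrow> nat, A))"
  have "eval_name G B = F (\<lambda>i. eval_name G (A i))" if "decided G \<Phi>" "G \<subseteq> P" for G
    unfolding B_def eval_borel_name[OF that eq_refl[OF \<Phi>_def[symmetric]] \<theta>(1) A] by (simp add: \<theta>(2))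
  then show ?thesis
    by (intro exI[of _ B] exI[of _ \<Phi>]) (simp add: B_def \<Phi>_def borel_name_subset)
qed

text \<open>Reduces forcing to implications between reals of V. Every hypothesis carries its own
  assignment of names; \<Delta> lists what has to be decided for names built by
  \<open>borel_image_name\<close> to evaluate as intended.\<close>

lemma forces_consequence:
  assumes p: "p \<in> P" and A: "names A" and \<psi>: "no_set_quant \<psi>" and hyps: "countable Hyps" and \<Delta>: "countable \<Delta>"
    and Hyps: "\<And>\<phi> A. (\<phi>, A) \<in> Hyps \<Longrightarrow> no_set_quant \<phi> \<and> names A \<and> forces P le p e A \<phi>"
    and sat: "\<And>G. G \<subseteq> P \<Longrightarrow> decided G \<Delta> \<Longrightarrow> (\<And>\<phi> A. (\<phi>, A) \<in> Hyps \<Longrightarrow> sat e (\<lambda>i. eval_name G (A i)) \<phi>) \<Longrightarrow>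
       sat e (\<lambda>i. eval_name G (A i)) \<psi>"
  shows "forces P le p e A \<psi>"
proof (rule forces_generic[OF p \<psi> A])
  show "countable (\<Delta> \<union> (\<lambda>(\<phi>, A). (\<phi>, e, A)) ` Hyps)" using hyps \<Delta> by simp
  fix G assume G: "p \<in> G" "G \<subseteq> P" "decided G (\<Delta> \<union> (\<lambda>(\<phi>, A). (\<phi>, e, A)) ` Hyps)"
  show "sat e (\<lambda>i. eval_name G (A i)) \<psi>"
  proof (rule sat)
    show "decided G \<Delta>" using G(3) unfolding decided_def by blast
    fix \<phi> A assume h: "(\<phi>, A) \<in> Hyps"
    then have "(\<phi>, e, A) \<in> \<Delta> \<union> (\<lambda>(\<phi>, A). (\<phi>, e, A)) ` Hyps" by force
    from decidedD[OF G(3) this] Hyps[OF h] G(1)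
    show "sat e (\<lambda>i. eval_name G (A i)) \<phi>" by blast
  qed (rule G(2))
qed

lemma eval_name_upd:
  "(\<lambda>i. eval_name G ((A(k := B)) i)) = (\<lambda>i. eval_name G (A i))(k := eval_name G B)"
  by (auto simp: fun_eq_iff)

lemma forces_upd_dummy:
  assumes p: "p \<in> P" and A: "names A" and B: "\<And>n. B n \<subseteq> P" and \<psi>: "no_set_quant \<psi>"
    and dummy: "\<And>X B. sat e (X(k := B)) \<psi> \<longleftrightarrow> sat e X \<psi>"
  shows "forces P le p e (A(k := B)) \<psi> \<longleftrightarrow> forces P le p e A \<psi>"
proof -
  have dummy': "sat e (\<lambda>i. eval_name G ((A(k := B)) i)) \<psi> \<longleftrightarrow> sat e (\<lambda>i. eval_name G (A i)) \<psi>" for G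
    unfolding eval_name_upd by (rule dummy)
  have AB: "names (A(k := B))" by (rule names_upd[OF A B])
  have trans: "forces P le p e A' \<psi>" if "forces P le p e A'' \<psi>" "names A'" "names A''"
    and eq: "\<And>G. sat e (\<lambda>i. eval_name G (A'' i)) \<psi> \<Longrightarrow> sat e (\<lambda>i. eval_name G (A' i)) \<psi>" for A' A''
  proof (rule forces_consequence[OF p that(2) \<psi>, of "{(\<psi>, A'')}" "{}"])
    fix G assume s: "\<And>\<phi> A'. (\<phi>, A') \<in> {(\<psi>, A'')} \<Longrightarrow> sat e (\<lambda>i. eval_name G (A' i)) \<phi>"
    show "sat e (\<lambda>i. eval_name G (A' i)) \<psi>" by (rule eq[OF s[OF insertI1]])
  qed (use that \<psi> in auto)
  show ?thesis using trans A AB dummy' by blast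
qed

text \<open>Needed because the two definitions of the reduction are an arithmetical formula padded
  with set quantifiers that bind nothing.\<close>

lemma forces_quantifier_dummy:
  assumes p: "p \<in> P" and A: "names A"
    and iff: "\<And>q B. q \<in> P \<Longrightarrow> (\<And>n. B n \<subseteq> P) \<Longrightarrow> forces P le q e (A(k := B)) \<chi> \<longleftrightarrow> forces P le q e A \<psi>"
  shows "forces P le p e A (ExS k \<chi>) \<longleftrightarrow> forces P le p e A \<psi>"
    and "forces P le p e A (AllS k \<chi>) \<longleftrightarrow> forces P le p e A \<psi>"
proof -
  have Ak: "A k n \<subseteq> P" for n using A by (auto simp: names_def)
  show "forces P le p e A (ExS k \<chi>) \<longleftrightarrow> forces P le p e A \<psi>"
  proof
    assume ex: "forces P le p e A (ExS k \<chi>)"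
    show "forces P le p e A \<psi>"
    proof (rule forces_dense[OF p])
      fix q assume q: "q \<in> P" "le q p"
      from forces_ExS_D[OF ex p q] iff show "\<exists>r\<in>P. le r q \<and> forces P le r e A \<psi>" by blast
    qed
  next
    assume "forces P le p e A \<psi>"
    then have "forces P le p e (A(k := A k)) \<chi>" unfolding iff[OF p Ak] .
    then show "forces P le p e A (ExS k \<chi>)" by (rule forces_ExS_I[OF p Ak])
  qed
  show "forces P le p e A (AllS k \<chi>) \<longleftrightarrow> forces P le p e A \<psi>"
    unfolding forces.simps using iff[OF p] Ak by blast
qed

text \<open>Densely often the premise is witnessed by a name B; the Borel function K turns it into a
  name C for a witness of the conclusion. That K works has to be known for reals of V only.\<close>

lemma forces_Imp_ExS:
  assumes q: "q \<in> P" and A: "names A" and fo: "no_set_quant \<phi>" "no_set_quant \<phi>'"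
    and Hs: "countable Hs" "\<And>\<chi>. \<chi> \<in> Hs \<Longrightarrow> no_set_quant \<chi> \<and> forces P le q (\<lambda>_. 0) A \<chi>"
    and K: "\<And>n. borel (\<lambda>X. n \<in> K X)"
    and imp: "\<And>X B. (\<And>\<chi>. \<chi> \<in> Hs \<Longrightarrow> sat (\<lambda>_. 0) X \<chi>) \<Longrightarrow> sat (\<lambda>_. 0) (X(k := B)) \<phi> \<Longrightarrow>
      sat (\<lambda>_. 0) (X(l := K (X(k := B)))) \<phi>'"
  shows "forces P le q (\<lambda>_. 0) A (Imp (ExS k \<phi>) (ExS l \<phi>'))"
proof (rule forces_Imp[OF q])
  let ?e = "\<lambda>_ :: nat. 0 :: nat"
  fix r assume r: "r \<in> P" "le r q" and ex: "forces P le r ?e A (ExS k \<phi>)"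
  show "forces P le r ?e A (ExS l \<phi>')"
  proof (rule forces_dense[OF r(1)])
    fix r' assume r': "r' \<in> P" "le r' r"
    from forces_ExS_D[OF ex r(1) r'] obtain t B where
      t: "t \<in> P" "le t r'" and B: "\<forall>n. B n \<subseteq> P" "forces P le t ?e (A(k := B)) \<phi>" by blast
    have tq: "le t q" using le_trans[OF t(1) r(1) q _ r(2)] le_trans[OF t(1) r'(1) r(1) t(2) r'(2)] by blast
    have AB: "names (A(k := B))" using A B(1) by (simp add: names_upd)
    obtain C \<Delta> where C: "\<forall>n. C n \<subseteq> P" "countable \<Delta>"
      "\<forall>G. decided G \<Delta> \<longrightarrow> G \<subseteq> P \<longrightarrow> eval_name G C = K (\<lambda>i. eval_name G ((A(k := B)) i))"
      using borel_image_name[OF K AB] by blast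
    have AC: "names (A(l := C))" using A C(1) by (simp add: names_upd)
    have "forces P le t ?e (A(l := C)) \<phi>'"
    proof (rule forces_consequence[OF t(1) AC fo(2), of "insert (\<phi>, A(k := B)) (Hs \<times> {A})" \<Delta>])
      fix G assume G: "G \<subseteq> P" "decided G \<Delta>"
        and s: "\<And>\<chi> A'. (\<chi>, A') \<in> insert (\<phi>, A(k := B)) (Hs \<times> {A}) \<Longrightarrow> sat ?e (\<lambda>i. eval_name G (A' i)) \<chi>"
      have eC: "eval_name G C = K ((\<lambda>i. eval_name G (A i))(k := eval_name G B))"
        using C(3) G unfolding eval_name_upd by blast
      show "sat ?e (\<lambda>i. eval_name G ((A(l := C)) i)) \<phi>'"
        unfolding eval_name_upd eC
        by (rule imp, rule s) (use s[OF insertI1] in \<open>simp_all only: eval_name_upd insert_iff mem_Sigma_iff simp_thms\<close>)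
    next
      fix \<chi> A' assume "(\<chi>, A') \<in> insert (\<phi>, A(k := B)) (Hs \<times> {A})"
      then show "no_set_quant \<chi> \<and> names A' \<and> forces P le t ?e A' \<chi>"
        using Hs(2) forces_mono[OF _ q t(1) tq] A AB B(2) fo(1) by blast
    qed (use Hs(1) C(2) in simp_all)
    then have "forces P le t ?e A (ExS l \<phi>')"
      using C(1) by (intro forces_ExS_I[OF t(1), of C]) auto
    then show "\<exists>t\<in>P. le t r' \<and> forces P le t ?e A (ExS l \<phi>')" using t by blast
  qed
qed

lemma forced_reduction:
  fixes f :: "nat set \<Rightarrow> nat set" and F H :: "(nat \<Rightarrow> nat set) \<Rightarrow> nat set"
  assumes lfree: "lfree (snd \<Phi>) = {}" "lfree (snd \<Psi>) = {}"
    and \<psi>: "no_set_quant \<psi>" "\<And>e X. sat e X \<psi> \<longleftrightarrow> X 1 = f (X 0)"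
    and Mod: "\<And>M. M \<in> Mod \<Phi> \<Longrightarrow> f M \<in> Mod \<Psi>"
    and borel: "\<And>n. borel (\<lambda>X. n \<in> f (X 0))" "\<And>n. borel (\<lambda>X. n \<in> F X)" "\<And>n. borel (\<lambda>X. n \<in> H X)"
    and F: "\<And>X. X 0 \<in> Mod \<Phi> \<Longrightarrow> X 2 \<in> Mod \<Phi> \<Longrightarrow> iso_code (fst \<Phi>) (X 0) (X 2) (X 3) \<Longrightarrow>
      iso_code (fst \<Psi>) (f (X 0)) (f (X 2)) (F X)"
    and H: "\<And>X. X 0 \<in> Mod \<Phi> \<Longrightarrow> X 2 \<in> Mod \<Phi> \<Longrightarrow> iso_code (fst \<Psi>) (f (X 0)) (f (X 2)) (X 5) \<Longrightarrow>
      iso_code (fst \<Phi>) (X 0) (X 2) (H X)"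
  shows "forced P le (reduction_fm \<Phi> \<Psi> (AllS 2 (ExS 3 \<psi>)) (ExS 2 (AllS 3 \<psi>)))"
proof -
  let ?\<rho> = "\<lambda>i j n. if n = 0 then i else if n = 1 then j else n + i + j :: nat"
  let ?e = "\<lambda>_ :: nat. 0 :: nat"
  define R where "R i j = rename (?\<rho> i j) \<psi>" for i j
  define \<sigma> where "\<sigma> = AllS 2 (ExS 3 \<psi>)"
  define \<tau> where "\<tau> = ExS 2 (AllS 3 \<psi>)"
  have at_xy: "at_xy \<sigma> i j = AllS (2 + i + j) (ExS (3 + i + j) (R i j))"
    "at_xy \<tau> i j = ExS (2 + i + j) (AllS (3 + i + j) (R i j))" for i j
    by (simp_all add: at_xy_def ExS_def R_def \<sigma>_def \<tau>_def)
  have fo: "no_set_quant (R i j)" for i j unfolding R_def by (rule no_set_quant_rename[OF \<psi>(1)])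
  have sat: "sat e X (R i j) \<longleftrightarrow> X j = f (X i)" if "i \<noteq> j" for e X i j
  proof -
    have "inj (?\<rho> i j)" using that by (auto simp: inj_def)
    then show ?thesis by (simp add: sat_rename \<psi>(2) R_def)
  qed
  \<comment> \<open>Both set quantifiers in \<sigma> and \<tau> are dummies, so each formula is
    forced exactly when its matrix \<open>R i j\<close> is.\<close>
  have gr: "forces P le p e A (at_xy \<sigma> i j) \<longleftrightarrow> forces P le p e A (R i j)"
    "forces P le p e A (at_xy \<tau> i j) \<longleftrightarrow> forces P le p e A (R i j)"
    if pA: "p \<in> P" "names A" and ij: "i \<noteq> j" for p e A i j
  proof -
    have d: "forces P le q e (A'(k := B)) (R i j) \<longleftrightarrow> forces P le q e A' (R i j)"
      if "q \<in> P" "names A'" "\<And>n. B n \<subseteq> P" "k \<ge> 2 + i + j" for q A' k B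
      by (rule forces_upd_dummy[OF that(1-3) fo]) (use that(4) in \<open>simp add: sat[OF ij]\<close>)
    have inner: "forces P le q e (A(k := B)) (ExS l (R i j)) \<longleftrightarrow> forces P le q e A (R i j)"
      "forces P le q e (A(k := B)) (AllS l (R i j)) \<longleftrightarrow> forces P le q e A (R i j)"
      if q: "q \<in> P" and B: "\<And>n. B n \<subseteq> P" and kl: "k \<ge> 2 + i + j" "l \<ge> 2 + i + j" for q B k l
    proof -
      have AB: "names (A(k := B))" by (rule names_upd[OF pA(2) B])
      note quant = forces_quantifier_dummy[OF q AB d[OF _ AB _ kl(2)]]
      show "forces P le q e (A(k := B)) (ExS l (R i j)) \<longleftrightarrow> forces P le q e A (R i j)"
        "forces P le q e (A(k := B)) (AllS l (R i j)) \<longleftrightarrow> forces P le q e A (R i j)"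
        by (simp_all only: quant d[OF q pA(2) B kl(1)])
    qed
    show "forces P le p e A (at_xy \<sigma> i j) \<longleftrightarrow> forces P le p e A (R i j)"
      "forces P le p e A (at_xy \<tau> i j) \<longleftrightarrow> forces P le p e A (R i j)"
      unfolding at_xy
      by (rule forces_quantifier_dummy(2)[OF pA inner(1)] forces_quantifier_dummy(1)[OF pA inner(2)]; assumption?; simp)+
  qed
  note M\<Phi> = sat_Mod_fm[OF lfree(1)] and M\<Psi> = sat_Mod_fm[OF lfree(2)]
  \<comment> \<open>The variable bound in \<open>iso_fm\<close> is s + t + 1, hence 3 and 5 here.
    Variable 3 also stands for y'; the clash is harmless because \<open>F\<close> and
    \<open>H\<close> speak of \<open>f (X 2)\<close> in place of y'.\<close>
  have iso02: "iso_fm L 0 2 = ExS 3 (iso_body L 0 2)" and iso13: "iso_fm L 1 3 = ExS 5 (iso_body L 1 3)" for L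
    using iso_fm_eq[of L 0 2] iso_fm_eq[of L 1 3] by (simp_all add: numeral_eq_Suc)
  have 1: "forces P le p ?e A (Imp (And (Mod_fm \<Phi> 0) (Mod_fm \<Psi> 1))
      (Iff (at_xy \<sigma> 0 1) (at_xy \<tau> 0 1)))"
    if p: "p \<in> P" and A: "names A" for p A
  proof (rule forces_Imp[OF p])
    fix q assume q: "q \<in> P"
    have "forces P le q ?e A (Imp (at_xy \<sigma> 0 1) (at_xy \<tau> 0 1))"
      "forces P le q ?e A (Imp (at_xy \<tau> 0 1) (at_xy \<sigma> 0 1))"
      by (rule forces_Imp[OF q], simp only: gr[OF _ A zero_neq_one])+
    then show "forces P le q ?e A (Iff (at_xy \<sigma> 0 1) (at_xy \<tau> 0 1))"
      by (simp add: Iff_def)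
  qed
  have 2: "forces P le p ?e A (Imp (Mod_fm \<Phi> 0) (ExS 1 (And (Mod_fm \<Psi> 1) (at_xy \<sigma> 0 1))))"
    if p: "p \<in> P" and A: "names A" for p A
  proof (rule forces_Imp[OF p])
    fix q assume q: "q \<in> P" and hyp: "forces P le q ?e A (Mod_fm \<Phi> 0)"
    obtain B \<Delta> where B: "\<forall>n. B n \<subseteq> P" "countable \<Delta>"
      "\<forall>G. decided G \<Delta> \<longrightarrow> G \<subseteq> P \<longrightarrow> eval_name G B = f (eval_name G (A 0))"
      using borel_image_name[OF borel(1) A] by blast
    have A': "names (A(1 := B))" using A B(1) by (simp add: names_upd)
    have "forces P le q ?e (A(1 := B)) (And (Mod_fm \<Psi> 1) (R 0 1))"
    proof (rule forces_consequence[OF q A', of _ "{(Mod_fm \<Phi> 0, A)}" \<Delta>])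
      fix G assume G: "G \<subseteq> P" "decided G \<Delta>"
        and s: "\<And>\<phi> A'. (\<phi>, A') \<in> {(Mod_fm \<Phi> 0, A)} \<Longrightarrow> sat ?e (\<lambda>i. eval_name G (A' i)) \<phi>"
      have "eval_name G (A 0) \<in> Mod \<Phi>" using s[OF insertI1] by (simp add: M\<Phi>)
      moreover have "eval_name G B = f (eval_name G (A 0))" using B(3) G by blast
      ultimately show "sat ?e (\<lambda>i. eval_name G ((A(1 := B)) i)) (And (Mod_fm \<Psi> 1) (R 0 1))"
        using Mod by (simp add: M\<Psi> sat[OF zero_neq_one] del: One_nat_def)
    qed (use hyp A B fo in \<open>auto simp: no_set_quant_Mod\<close>)
    then have "forces P le q ?e (A(1 := B)) (And (Mod_fm \<Psi> 1) (at_xy \<sigma> 0 1))"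
      unfolding forces.simps gr(1)[OF q A' zero_neq_one] .
    then show "forces P le q ?e A (ExS 1 (And (Mod_fm \<Psi> 1) (at_xy \<sigma> 0 1)))"
      using B(1) by (intro forces_ExS_I[OF q, of B]) auto
  qed
  have 3: "forces P le p ?e A (Imp
      (And (Mod_fm \<Phi> 0) (And (And (Mod_fm \<Psi> 1) (at_xy \<sigma> 0 1)) (And (Mod_fm \<Psi> 3) (at_xy \<sigma> 0 3))))
      (same_set_fm 1 3))"
    if p: "p \<in> P" and A: "names A" for p A
  proof (rule forces_Imp[OF p])
    fix q assume q: "q \<in> P" and hyp: "forces P le q ?e A (And (Mod_fm \<Phi> 0)
      (And (And (Mod_fm \<Psi> 1) (at_xy \<sigma> 0 1)) (And (Mod_fm \<Psi> 3) (at_xy \<sigma> 0 3))))"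
    have 03: "(0::nat) \<noteq> 3" by simp
    have h: "forces P le q ?e A (R 0 1)" "forces P le q ?e A (R 0 3)"
      using hyp unfolding forces.simps gr(1)[OF q A zero_neq_one] gr(1)[OF q A 03] by blast+
    show "forces P le q ?e A (same_set_fm 1 3)"
    proof (rule forces_consequence[OF q A, of _ "{(R 0 1, A), (R 0 3, A)}" "{}"])
      fix G assume s: "\<And>\<phi> A'. (\<phi>, A') \<in> {(R 0 1, A), (R 0 3, A)} \<Longrightarrow>
          sat ?e (\<lambda>i. eval_name G (A' i)) \<phi>"
      have "eval_name G (A 1) = f (eval_name G (A 0))" "eval_name G (A 3) = f (eval_name G (A 0))"
        using s[OF insertI1, unfolded sat[OF zero_neq_one]]
          s[OF insertI2[OF singletonI], unfolded sat[OF 03]] .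
      then show "sat ?e (\<lambda>i. eval_name G (A i)) (same_set_fm 1 3)" by (simp add: same_set_fm_def)
    qed (use h A fo in \<open>auto simp: same_set_fm_def\<close>)
  qed
  have 4: "forces P le p ?e A (Imp
      (And (And (Mod_fm \<Phi> 0) (And (Mod_fm \<Psi> 1) (at_xy \<sigma> 0 1)))
           (And (Mod_fm \<Phi> 2) (And (Mod_fm \<Psi> 3) (at_xy \<sigma> 2 3))))
      (Iff (iso_fm (fst \<Phi>) 0 2) (iso_fm (fst \<Psi>) 1 3)))"
    if p: "p \<in> P" and A: "names A" for p A
  proof (rule forces_Imp[OF p])
    fix q assume q: "q \<in> P" and hyp: "forces P le q ?e A
      (And (And (Mod_fm \<Phi> 0) (And (Mod_fm \<Psi> 1) (at_xy \<sigma> 0 1)))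
           (And (Mod_fm \<Phi> 2) (And (Mod_fm \<Psi> 3) (at_xy \<sigma> 2 3))))"
    have 23: "(2::nat) \<noteq> 3" by simp
    let ?Hs = "{Mod_fm \<Phi> 0, Mod_fm \<Phi> 2, R 0 1, R 2 3}"
    have h: "no_set_quant \<phi> \<and> forces P le q ?e A \<phi>" if "\<phi> \<in> ?Hs" for \<phi>
      using hyp that fo no_set_quant_Mod unfolding forces.simps gr(1)[OF q A zero_neq_one] gr(1)[OF q A 23] by blast
    have Hs: "countable ?Hs" by simp
    have sats: "X 0 \<in> Mod \<Phi> \<and> X 2 \<in> Mod \<Phi> \<and> X 1 = f (X 0) \<and> X 3 = f (X 2)"
      if "\<And>\<phi>. \<phi> \<in> ?Hs \<Longrightarrow> sat ?e X \<phi>" for X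
      using that[of "Mod_fm \<Phi> 0"] that[of "Mod_fm \<Phi> 2"] that[of "R 0 1"] that[of "R 2 3"]
      unfolding M\<Phi> sat[OF zero_neq_one] sat[OF 23] by blast
    have forward: "forces P le q ?e A (Imp (iso_fm (fst \<Phi>) 0 2) (iso_fm (fst \<Psi>) 1 3))"
      unfolding iso02 iso13
    proof (rule forces_Imp_ExS[OF q A no_set_quant_iso_body no_set_quant_iso_body Hs h borel(2)])
      fix X B assume s: "\<And>\<chi>. \<chi> \<in> ?Hs \<Longrightarrow> sat ?e X \<chi>" and iso: "sat ?e (X(3 := B)) (iso_body (fst \<Phi>) 0 2)"
      show "sat ?e (X(5 := F (X(3 := B)))) (iso_body (fst \<Psi>) 1 3)"
        using F[of "X(3 := B)"] sats[OF s] iso by (simp add: sat_iso_body)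
    qed
    have backward: "forces P le q ?e A (Imp (iso_fm (fst \<Psi>) 1 3) (iso_fm (fst \<Phi>) 0 2))"
      unfolding iso02 iso13
    proof (rule forces_Imp_ExS[OF q A no_set_quant_iso_body no_set_quant_iso_body Hs h borel(3)])
      fix X B assume s: "\<And>\<chi>. \<chi> \<in> ?Hs \<Longrightarrow> sat ?e X \<chi>" and iso: "sat ?e (X(5 := B)) (iso_body (fst \<Psi>) 1 3)"
      show "sat ?e (X(3 := H (X(5 := B)))) (iso_body (fst \<Phi>) 0 2)"
        using H[of "X(5 := B)"] sats[OF s] iso by (simp add: sat_iso_body)
    qed
    show "forces P le q ?e A (Iff (iso_fm (fst \<Phi>) 0 2) (iso_fm (fst \<Psi>) 1 3))"
      using forward backward by (simp add: Iff_def)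
  qed
  have names0: "names (\<lambda>_ _. {})" by (simp add: names_def)
  show ?thesis
    unfolding forced_def
  proof
    fix p assume p: "p \<in> P"
    show "forces P le p ?e (\<lambda>_ _. {}) (reduction_fm \<Phi> \<Psi> (AllS 2 (ExS 3 \<psi>)) (ExS 2 (AllS 3 \<psi>)))"
      unfolding \<sigma>_def[symmetric] \<tau>_def[symmetric] reduction_fm_def forces.simps(4,7)
      by (intro conjI allI impI 1[OF p] 2[OF p] 3[OF p] 4[OF p] names_upd names0) blast+
  qed
qed

end

section \<open>The reduction\<close>

lemma elem_in: "elem M i \<in> gr (edge_rel M)"
  using bij_elem[of M] by (auto simp: bij_betw_def)

lemma elem_eq_iff [simp]: "elem M i = elem M j \<longleftrightarrow> i = j"
  using bij_elem[of M] by (auto simp: bij_betw_def inj_def)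

lemma ex_elem: "v \<in> gr (edge_rel M) \<Longrightarrow> \<exists>i. elem M i = v"
  using bij_elem[of M] unfolding bij_betw_def by (metis imageE)

definition index :: "nat set \<Rightarrow> vec \<Rightarrow> nat" where
  "index M v = inv_into UNIV (elem M) v"

lemma elem_index: "v \<in> gr (edge_rel M) \<Longrightarrow> elem M (index M v) = v"
  using ex_elem[of v M] unfolding index_def by (metis f_inv_into_f rangeI)

lemma index_elem [simp]: "index M (elem M i) = i"
  by (simp add: index_def inj_def)

lemma fact_in_group_of:
  "fact_code 0 [i, j, k] \<in> group_of M \<longleftrightarrow> (\<lambda>b. elem M i b + elem M j b) = elem M k"
  by (auto simp: fact_code_def group_of_def fun_eq_iff)

lemma group_of_TFAG: "group_of M \<in> Mod TFAG"
proof -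
  define add where "add i j = index M (\<lambda>b. elem M i b + elem M j b)" for i j
  define z where "z = index M (\<lambda>b. 0)"
  have add: "elem M (add i j) = (\<lambda>b. elem M i b + elem M j b)" for i j
    unfolding add_def by (intro elem_index gr_add elem_in)
  have z: "elem M z = (\<lambda>b. 0)"
    unfolding z_def by (intro elem_index gr_0)
  have mult: "elem M (((\<lambda>x. add x a) ^^ n) z) = (\<lambda>b. of_nat n * elem M a b)" for n a
    by (induction n) (simp_all add: z add algebra_simps)
  have eq: "i = j \<longleftrightarrow> elem M i = elem M j" for i j by simp
  have neg: "\<exists>b. add a b = z" for a
  proof -
    have "(\<lambda>b. - elem M a b) \<in> gr (edge_rel M)"
      using gr_mult_Ints[of "-1" "elem M a", OF _ elem_in] by simp
    then obtain b where "elem M b = (\<lambda>b. - elem M a b)" using ex_elem by blast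
    then show ?thesis unfolding eq add z by (intro exI[of _ b]) simp
  qed
  have tf: "a = z" if "((\<lambda>x. add x a) ^^ Suc n) z = z" for n a
  proof -
    have "(\<lambda>b. of_nat (Suc n) * elem M a b) = (\<lambda>b. 0)"
      using that mult[of "Suc n" a] z by metis
    then have "of_nat (Suc n) * elem M a b = 0" for b by metis
    then have "elem M a b = 0" for b by (metis mult_eq_0_iff of_nat_eq_0_iff nat.distinct(1))
    then show ?thesis unfolding eq z by blast
  qed
  have set_eq: "group_of M = {fact_code 0 [a, b, add a b] | a b. True}"
  proof (intro set_eqI iffI)
    fix m assume m: "m \<in> group_of M"
    then obtain i j k where "m = fact_code 0 [i, j, k]" unfolding group_of_def fact_code_def by blast
    with m have "elem M (add i j) = elem M k" by (simp add: fact_in_group_of add)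
    then show "m \<in> {fact_code 0 [a, b, add a b] | a b. True}" using \<open>m = _\<close> by auto
  next
    fix m assume "m \<in> {fact_code 0 [a, b, add a b] | a b. True}"
    then show "m \<in> group_of M" by (auto simp: fact_in_group_of add)
  qed
  show ?thesis
    unfolding TFAG_char
    by (rule exI[of _ add], rule exI[of _ z], intro conjI allI impI)
      (simp_all only: neg tf set_eq, simp_all add: eq add z algebra_simps del: elem_eq_iff)
qed

text \<open>Passes between permutations of the universe of the copied groups and isomorphisms of the
  vector groups, along the bijection \<open>elem\<close>.\<close>

lemma iso_code_group_of:
  "iso_code (fst TFAG) (group_of M) (group_of N) z \<longleftrightarrow>
   (\<exists>T T'. group_iso (edge_rel M) (edge_rel N) T T' \<and>
      (\<forall>i j. pair i j \<in> z \<longleftrightarrow> T (elem M i) = elem N j))" (is "?L \<longleftrightarrow> ?R")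
proof -
  have len3: "(\<forall>xs. length xs = 3 \<longrightarrow> Q xs) \<longleftrightarrow> (\<forall>i j k. Q [i, j, k])" for Q :: "nat list \<Rightarrow> bool"
    by (auto simp: length_Suc_conv numeral_3_eq_3)
  have L: "?L \<longleftrightarrow> (\<exists>\<pi>. bij \<pi> \<and> (\<forall>i j. pair i j \<in> z \<longleftrightarrow> j = \<pi> i) \<and>
      (\<forall>i j k. (\<lambda>b. elem M i b + elem M j b) = elem M k \<longleftrightarrow>
         (\<lambda>b. elem N (\<pi> i) b + elem N (\<pi> j) b) = elem N (\<pi> k)))"
    using len3[of "\<lambda>xs. fact_code 0 xs \<in> group_of M \<longleftrightarrow> fact_code 0 (map \<pi> xs) \<in> group_of N" for \<pi>]
    unfolding iso_code_def by (simp add: TFAG_def fact_in_group_of)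
  show ?thesis
    unfolding L
  proof (rule iffI; elim exE conjE)
    fix \<pi> assume bij: "bij \<pi>" and z: "\<forall>i j. pair i j \<in> z \<longleftrightarrow> j = \<pi> i"
      and add: "\<forall>i j k. (\<lambda>b. elem M i b + elem M j b) = elem M k \<longleftrightarrow>
         (\<lambda>b. elem N (\<pi> i) b + elem N (\<pi> j) b) = elem N (\<pi> k)"
    define T where "T v = elem N (\<pi> (index M v))" for v
    define T' where "T' v = elem M (inv_into UNIV \<pi> (index N v))" for v
    have p: "\<pi> (inv_into UNIV \<pi> i) = i" "inv_into UNIV \<pi> (\<pi> i) = i" for i
      using bij by (simp_all add: bij_is_surj surj_f_inv_f bij_is_inj)
    have TT: "T (elem M i) = elem N (\<pi> i)" for i by (simp add: T_def)
    have TT': "T' (elem N (\<pi> i)) = elem M i" for i by (simp add: T'_def p)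
    have rM: "\<exists>i. v = elem M i" if "v \<in> gr (edge_rel M)" for v using ex_elem[OF that] by metis
    have rN: "\<exists>i. v = elem N (\<pi> i)" if "v \<in> gr (edge_rel N)" for v using ex_elem[OF that] p(1) by metis
    have sum: "\<exists>k. (\<lambda>b. elem M i b + elem M j b) = elem M k \<and>
      (\<lambda>b. elem N (\<pi> i) b + elem N (\<pi> j) b) = elem N (\<pi> k)" for i j
      using rM[OF gr_add[OF elem_in elem_in]] add by blast
    have "group_iso (edge_rel M) (edge_rel N) T T'"
    proof
      show "T v \<in> gr (edge_rel N)" for v unfolding T_def by (rule elem_in)
      show "T' v \<in> gr (edge_rel M)" for v unfolding T'_def by (rule elem_in)
      show "T' (T v) = v" if "v \<in> gr (edge_rel M)" for v using rM[OF that] TT TT' by metis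
      show "T (T' v) = v" if "v \<in> gr (edge_rel N)" for v using rN[OF that] TT TT' by metis
    next
      fix u v assume "u \<in> gr (edge_rel M)" "v \<in> gr (edge_rel M)"
      then obtain i j where "u = elem M i" "v = elem M j" using rM by blast
      then show "T (\<lambda>b. u b + v b) = (\<lambda>b. T u b + T v b)" using sum[of i j] by (auto simp: TT)
    next
      fix u v assume "u \<in> gr (edge_rel N)" "v \<in> gr (edge_rel N)"
      then obtain i j where "u = elem N (\<pi> i)" "v = elem N (\<pi> j)" using rN by blast
      then show "T' (\<lambda>b. u b + v b) = (\<lambda>b. T' u b + T' v b)" using sum[of i j] by (auto simp: TT')
    qed
    moreover have "\<forall>i j. pair i j \<in> z \<longleftrightarrow> T (elem M i) = elem N j"
      by (auto simp: TT z)
    ultimately show ?R by blast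
  next
    fix T T' assume iso: "group_iso (edge_rel M) (edge_rel N) T T'"
      and z: "\<forall>i j. pair i j \<in> z \<longleftrightarrow> T (elem M i) = elem N j"
    interpret group_iso "edge_rel M" "edge_rel N" T T' by (rule iso)
    define \<pi> where "\<pi> i = index N (T (elem M i))" for i
    have p: "elem N (\<pi> i) = T (elem M i)" for i unfolding \<pi>_def by (intro elem_index T_in elem_in)
    have inj: "i = j" if "T (elem M i) = T (elem M j)" for i j
      using that T'_T[OF elem_in] by (metis elem_eq_iff)
    have "inj \<pi>" by (rule injI, rule inj) (metis p)
    moreover have "surj \<pi>"
    proof (rule surjI)
      fix j
      have "T' (elem N j) \<in> gr (edge_rel M)" by (intro T'_in elem_in)
      then show "\<pi> (index M (T' (elem N j))) = j" unfolding \<pi>_def by (simp add: elem_index T_T' elem_in)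
    qed
    ultimately have "bij \<pi>" by (simp add: bij_def)
    moreover have "pair i j \<in> z \<longleftrightarrow> j = \<pi> i" for i j
      unfolding z[rule_format] p[symmetric] by auto
    moreover have "(\<lambda>b. elem M i b + elem M j b) = elem M k \<longleftrightarrow>
         (\<lambda>b. elem N (\<pi> i) b + elem N (\<pi> j) b) = elem N (\<pi> k)" for i j k
    proof -
      have "(\<lambda>b. elem N (\<pi> i) b + elem N (\<pi> j) b) = T (\<lambda>b. elem M i b + elem M j b)"
        unfolding p by (rule T_add[symmetric]) (rule elem_in)+
      moreover have "T (\<lambda>b. elem M i b + elem M j b) = T (elem M k) \<longleftrightarrow> (\<lambda>b. elem M i b + elem M j b) = elem M k"
        using T'_T[OF gr_add[OF elem_in elem_in]] T'_T[OF elem_in] by metis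
      ultimately show ?thesis unfolding p by metis
    qed
    ultimately show "\<exists>\<pi>. bij \<pi> \<and> (\<forall>i j. pair i j \<in> z \<longleftrightarrow> j = \<pi> i) \<and>
      (\<forall>i j k. (\<lambda>b. elem M i b + elem M j b) = elem M k \<longleftrightarrow>
         (\<lambda>b. elem N (\<pi> i) b + elem N (\<pi> j) b) = elem N (\<pi> k))" by blast
  qed
qed

lemma edge_rel_iff: "edge_rel M a b \<longleftrightarrow> fact_code 0 [a, b] \<in> M"
  by (simp add: edge_rel_def fact_code_def)

lemma iso_code_Graphs:
  "iso_code (fst Graphs) M N z \<longleftrightarrow> (\<exists>\<pi>. bij \<pi> \<and> (\<forall>a b. pair a b \<in> z \<longleftrightarrow> b = \<pi> a) \<and>
     (\<forall>a b. edge_rel M a b \<longleftrightarrow> edge_rel N (\<pi> a) (\<pi> b)))"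
proof -
  have len2: "(\<forall>xs. length xs = 2 \<longrightarrow> Q xs) \<longleftrightarrow> (\<forall>i j. Q [i, j])" for Q :: "nat list \<Rightarrow> bool"
    by (auto simp: length_Suc_conv numeral_2_eq_2)
  show ?thesis
    using len2[of "\<lambda>xs. fact_code 0 xs \<in> M \<longleftrightarrow> fact_code 0 (map \<pi> xs) \<in> N" for \<pi>]
    unfolding iso_code_def by (simp add: Graphs_def edge_rel_iff)
qed

lemma irrefl_Graphs: "M \<in> Mod Graphs \<Longrightarrow> \<not> edge_rel M a a"
  unfolding Graphs_char by (auto simp: edge_rel_iff fact_code_def irreflp_def)

text \<open>This is \<open>eps_rel\<close> for the isomorphism coded by z, with k a code of
  \<open>Ep a b\<close> and l a code of its image.\<close>

definition graph_iso_code :: "nat set \<Rightarrow> nat set \<Rightarrow> nat set \<Rightarrow> nat set" where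
  "graph_iso_code M N z = {n. \<exists>a c b d i j k l. n = pair a c \<and> a \<noteq> b \<and> c \<noteq> d \<and>
     k = enumerate (codes M) i \<and> cvec k = ebas (Ep a b) \<and> pair i j \<in> z \<and>
     l = enumerate (codes N) j \<and> cvec l (Ep c d) \<noteq> 0}"

lemma graph_iso_code:
  assumes M: "M \<in> Mod Graphs" and N: "N \<in> Mod Graphs"
    and z: "iso_code (fst TFAG) (group_of M) (group_of N) z"
  shows "iso_code (fst Graphs) M N (graph_iso_code M N z)"
proof -
  obtain T T' where iso: "group_iso (edge_rel M) (edge_rel N) T T'"
    and z: "\<And>i j. pair i j \<in> z \<longleftrightarrow> T (elem M i) = elem N j"
    using z unfolding iso_code_group_of by blast
  interpret group_iso "edge_rel M" "edge_rel N" T T' by (rule iso)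
  obtain f where f: "bij f" "\<And>a b. a \<noteq> b \<Longrightarrow> edge_rel M a b = edge_rel N (f a) (f b)"
    "\<And>a c. eps_rel a c \<longleftrightarrow> c = f a" using graph_iso by blast
  have "pair a c \<in> graph_iso_code M N z \<longleftrightarrow> eps_rel a c" for a c
  proof -
    have "pair a c \<in> graph_iso_code M N z \<longleftrightarrow>
        (\<exists>b d. a \<noteq> b \<and> c \<noteq> d \<and> (\<exists>i j. elem M i = ebas (Ep a b) \<and> T (elem M i) = elem N j \<and> elem N j (Ep c d) \<noteq> 0))"
      unfolding graph_iso_code_def elem_def[symmetric] z by (auto simp: elem_def)
    also have "\<dots> \<longleftrightarrow> eps_rel a c"
    proof -
      have "(\<exists>i j. elem M i = ebas (Ep a b) \<and> T (elem M i) = elem N j \<and> elem N j (Ep c d) \<noteq> 0) \<longleftrightarrow>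
          T (ebas (Ep a b)) (Ep c d) \<noteq> 0" for b d
        using ex_elem[OF gr_ebas] ex_elem[OF T_in[OF gr_ebas]] by metis
      then show ?thesis unfolding eps_rel_def by simp
    qed
    finally show ?thesis .
  qed
  then have "pair a c \<in> graph_iso_code M N z \<longleftrightarrow> c = f a" for a c using f(3) by blast
  \<comment> \<open>\<open>graph_iso\<close> says nothing about the diagonal, where neither graph
    has an edge.\<close>
  moreover have "edge_rel M a b \<longleftrightarrow> edge_rel N (f a) (f b)" for a b
    using f(2)[of a b] irrefl_Graphs[OF M] irrefl_Graphs[OF N] by (cases "a = b") auto
  ultimately show ?thesis unfolding iso_code_Graphs using f(1) by blast
qed

text \<open>The image of a vector under \<open>tmap\<close> depends on finitely many values of the permutation and its inverse
  only, so quantifying over finite lists keeps this Borel in z.\<close>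

definition group_iso_code :: "nat set \<Rightarrow> nat set \<Rightarrow> nat set \<Rightarrow> nat set" where
  "group_iso_code M N z = {n. \<exists>i j k l ps qs. n = pair i j \<and>
     k = enumerate (codes M) i \<and> l = enumerate (codes N) j \<and>
     (\<forall>a. a < clen k \<longrightarrow> pair a (ps ! a) \<in> z \<and> pair (qs ! a) a \<in> z) \<and>
     tmap (nth ps) (approx (nth ps) (nth qs)) (cvec k) = cvec l}"

lemma approx_cong:
  "(\<And>a. a < n \<Longrightarrow> \<pi> a = \<rho> a \<and> \<pi>' a = \<rho>' a) \<Longrightarrow> approx \<pi> \<pi>' n = approx \<rho> \<rho>' n"
  unfolding approx_def by (intro arg_cong[of _ _ Eps] ext) auto

text \<open>The code of a basis element dominates its level and its numbers, and bad levels of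
  \<open>Ep a b\<close> are at most max a b. So every word used has level below
  \<open>clen c\<close>, and no value of the permutations beyond that matters.\<close>

lemma tmap_cong:
  assumes "\<And>a. a < clen c \<Longrightarrow> \<pi> a = \<rho> a \<and> \<pi>' a = \<rho>' a"
  shows "tmap \<pi> (approx \<pi> \<pi>') (cvec c) = tmap \<rho> (approx \<rho> \<rho>') (cvec c)"
proof -
  have ap: "approx \<pi> \<pi>' n = approx \<rho> \<rho>' n" if "n < clen c" for n
    by (rule approx_cong) (use that assms in auto)
  have "tau \<pi> (approx \<pi> \<pi>') i = tau \<rho> (approx \<rho> \<rho>') i" if i: "cvec c i \<noteq> 0" for i
  proof (cases i)
    case (Al n w)
    have "n \<le> bas_code i" unfolding Al by (simp, meson le_prod_encode_1 le_prod_encode_2 le_trans)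
    then show ?thesis using ap[of n] cvec_nonzero[OF i] by (simp add: Al)
  next
    case (Al' n w)
    have "n \<le> bas_code i" unfolding Al' by (simp, meson le_prod_encode_1 le_prod_encode_2 le_trans)
    then show ?thesis using ap[of n] cvec_nonzero[OF i] by (simp add: Al')
  next
    case (Ep a b)
    have "a \<le> bas_code i" "b \<le> bas_code i"
      unfolding Ep by (simp, meson le_prod_encode_1 le_prod_encode_2 le_trans)+
    then have ab: "a < clen c" "b < clen c" using cvec_nonzero[OF i] by auto
    have m: "approx \<pi> \<pi>' m = approx \<rho> \<rho>' m" if "m \<le> max a b" for m
      by (rule ap) (use that ab in auto)
    have p: "\<pi> a = \<rho> a" "\<pi> b = \<rho> b" using assms ab by blast+
    have bad: "bad \<pi> (approx \<pi> \<pi>') a b = bad \<rho> (approx \<rho> \<rho>') a b"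
      unfolding bad_def p using m by (intro Collect_cong) auto
    show ?thesis
      unfolding Ep tau.simps bad p
      by (intro ext arg_cong2[of _ _ _ _ "(+)"] if_cong sum.cong refl) (auto simp: bad_def m)
  qed
  then show ?thesis unfolding tmap_def by (intro ext sum.cong refl) simp
qed

lemma group_iso_code:
  assumes z: "iso_code (fst Graphs) M N z"
  shows "iso_code (fst TFAG) (group_of M) (group_of N) (group_iso_code M N z)"
proof -
  obtain \<pi> where \<pi>: "bij \<pi>" "\<And>a b. pair a b \<in> z \<longleftrightarrow> b = \<pi> a"
    "\<And>a b. edge_rel M a b \<longleftrightarrow> edge_rel N (\<pi> a) (\<pi> b)"
    using z unfolding iso_code_Graphs by blast
  define \<pi>' where "\<pi>' = inv_into UNIV \<pi>"
  have inv: "\<pi>' (\<pi> a) = a" "\<pi> (\<pi>' a) = a" for a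
    using \<pi>(1) by (simp_all add: \<pi>'_def bij_is_surj surj_f_inv_f bij_is_inj)
  interpret graph_perm "edge_rel M" "edge_rel N" \<pi> \<pi>' "approx \<pi> \<pi>'"
    by (rule graph_perm_approx) (simp_all add: inv \<pi>(3))
  have "pair i j \<in> group_iso_code M N z \<longleftrightarrow> tmap \<pi> (approx \<pi> \<pi>') (elem M i) = elem N j" for i j
  proof -
    let ?k = "enumerate (codes M) i"
    have loc: "tmap (nth ps) (approx (nth ps) (nth qs)) (cvec ?k) = tmap \<pi> (approx \<pi> \<pi>') (cvec ?k)"
      if "\<forall>a. a < clen ?k \<longrightarrow> pair a (ps ! a) \<in> z \<and> pair (qs ! a) a \<in> z" for ps qs
      by (rule tmap_cong) (use that \<pi>(2) inv in metis)
    have "\<exists>ps qs. \<forall>a. a < clen ?k \<longrightarrow> pair a (ps ! a) \<in> z \<and> pair (qs ! a) a \<in> z"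
      by (rule exI[of _ "map \<pi> [0..<clen ?k]"], rule exI[of _ "map \<pi>' [0..<clen ?k]"])
        (simp add: \<pi>(2) inv)
    moreover have "pair i j \<in> group_iso_code M N z \<longleftrightarrow>
        (\<exists>ps qs. (\<forall>a. a < clen ?k \<longrightarrow> pair a (ps ! a) \<in> z \<and> pair (qs ! a) a \<in> z) \<and>
          tmap (nth ps) (approx (nth ps) (nth qs)) (cvec ?k) = elem N j)"
      unfolding group_iso_code_def elem_def by auto
    ultimately show ?thesis
      unfolding elem_def[of M] using loc by metis
  qed
  with group_iso show ?thesis unfolding iso_code_group_of by blast
qed

section \<open>Borel definability of the translations\<close>

lemma borel_mem: "borel (\<lambda>X. n \<in> X i)"
  unfolding borel_def by (rule exI[of _ "Mem (numeral_tm n) i"]) simp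

lemma borel_const: "borel (\<lambda>X. Q)"
  unfolding borel_def by (rule exI[of _ "if Q then Truth else Neg Truth"]) (simp add: Truth_def)

lemma borel_not: "borel R \<Longrightarrow> borel (\<lambda>X. \<not> R X)"
  unfolding borel_def by (elim exE, rule_tac x = "Neg \<phi>" in exI) simp

lemma borel_conj: "borel R \<Longrightarrow> borel S \<Longrightarrow> borel (\<lambda>X. R X \<and> S X)"
  unfolding borel_def by (elim exE, rule_tac x = "And \<phi> \<phi>'" in exI) simp

lemma borel_disj: "borel R \<Longrightarrow> borel S \<Longrightarrow> borel (\<lambda>X. R X \<or> S X)"
  using borel_not[OF borel_conj[OF borel_not borel_not], of R S] by simp

lemma borel_imp: "borel R \<Longrightarrow> borel S \<Longrightarrow> borel (\<lambda>X. R X \<longrightarrow> S X)"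
  unfolding imp_conv_disj by (rule borel_disj[OF borel_not])

lemma borel_all:
  fixes R :: "'a :: countable \<Rightarrow> (nat \<Rightarrow> nat set) \<Rightarrow> bool"
  assumes "\<And>a. borel (R a)" shows "borel (\<lambda>X. \<forall>a. R a X)"
proof -
  obtain \<phi> where \<phi>: "\<And>a. no_set_quant (\<phi> a)" "\<And>a X. sat (\<lambda>_. 0) X (\<phi> a) \<longleftrightarrow> R a X"
    using assms unfolding borel_def by metis
  have "(\<forall>a. R a X) \<longleftrightarrow> (\<forall>m. R (from_nat m) X)" for X by (metis from_nat_to_nat)
  then show ?thesis
    unfolding borel_def by (intro exI[of _ "BigAnd (\<lambda>m. \<phi> (from_nat m))"]) (simp add: \<phi>)
qed

lemma borel_ex:
  fixes R :: "'a :: countable \<Rightarrow> (nat \<Rightarrow> nat set) \<Rightarrow> bool"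
  assumes "\<And>a. borel (R a)" shows "borel (\<lambda>X. \<exists>a. R a X)"
  using borel_not[OF borel_all[OF borel_not[OF assms]]] by simp

lemmas borel_intros = borel_mem borel_not borel_conj borel_disj borel_imp borel_all borel_ex

lemma borel_gr: "borel (\<lambda>X. cvec c \<in> gr (edge_rel (X i)))"
  unfolding gr_iff edge_rel_def by (intro borel_intros borel_const)

lemma borel_codes: "borel (\<lambda>X. c \<in> codes (X i))"
  unfolding codes_iff by (intro borel_intros borel_gr borel_const)

lemma borel_enum_codes: "borel (\<lambda>X. c = enumerate (codes (X i)) n)"
proof (induction n arbitrary: c)
  case 0
  have "c = enumerate (codes M) 0 \<longleftrightarrow> c \<in> codes M \<and> (\<forall>m. m \<in> codes M \<longrightarrow> c \<le> m)" for M
    unfolding enumerate_0 using infinite_codes[of M] infinite_imp_nonempty[of "codes M"]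
    by (metis (mono_tags) LeastI Least_le ex_in_conv le_antisym)
  then show ?case by (auto intro!: borel_intros borel_codes borel_const)
next
  case (Suc n)
  have "c = enumerate (codes M) (Suc n) \<longleftrightarrow> (\<exists>a. a = enumerate (codes M) n \<and>
      c \<in> codes M \<and> a < c \<and> (\<forall>m. m \<in> codes M \<longrightarrow> a < m \<longrightarrow> c \<le> m))" for M
    using enumerate_Suc''[OF infinite_codes[of M], of n] enumerate_in_set[OF infinite_codes[of M], of "Suc n"]
      enumerate_step[OF infinite_codes[of M], of n]
    by (metis (mono_tags, lifting) Least_le le_antisym)
  then show ?case by (simp only:) (intro borel_intros borel_codes borel_const Suc)
qed

lemma borel_group_of: "borel (\<lambda>X. n \<in> group_of (X i))"
proof -
  have "n \<in> group_of M \<longleftrightarrow> (\<exists>i j k a b c. n = pair 0 (list_encode [i, j, k]) \<and>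
      a = enumerate (codes M) i \<and> b = enumerate (codes M) j \<and> c = enumerate (codes M) k \<and> cadd a b c)" for M
    unfolding group_of_def elem_def cadd_def by auto
  then show ?thesis by (simp only:) (intro borel_intros borel_enum_codes borel_const)
qed

lemma borel_graph_iso_code: "borel (\<lambda>X. n \<in> graph_iso_code (X i) (X j) (X k))"
  unfolding graph_iso_code_def mem_Collect_eq by (intro borel_intros borel_enum_codes borel_const)

text \<open>Once the numbers and the two finite lists are fixed, the equation for
  \<open>tmap\<close> no longer involves \<open>X\<close>. It is covered by
  \<open>borel_const\<close>, in spite of the choice operators inside.\<close>

lemma borel_group_iso_code: "borel (\<lambda>X. n \<in> group_iso_code (X i) (X j) (X k))"
  unfolding group_iso_code_def mem_Collect_eq by (intro borel_intros borel_enum_codes borel_const)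

lemma isomorphic_iff_iso_code: "isomorphic L M N \<longleftrightarrow> (\<exists>z. iso_code L M N z)"
proof
  assume "isomorphic L M N"
  then obtain \<pi> where "bij \<pi>" "\<forall>r xs. (r, length xs) \<in> L \<longrightarrow> (fact_code r xs \<in> M \<longleftrightarrow> fact_code r (map \<pi> xs) \<in> N)"
    unfolding isomorphic_def by blast
  then show "\<exists>z. iso_code L M N z"
    by (intro exI[of _ "{pair a (\<pi> a) | a. True}"]) (auto simp: iso_code_def)
qed (auto simp: iso_code_def isomorphic_def)

lemma isomorphic_group_of:
  assumes "M \<in> Mod Graphs" "N \<in> Mod Graphs"
  shows "isomorphic (fst Graphs) M N \<longleftrightarrow> isomorphic (fst TFAG) (group_of M) (group_of N)"
  unfolding isomorphic_iff_iso_code using graph_iso_code[OF assms] group_iso_code by blast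

theorem mainTheorem10:
  fixes E :: "'v \<Rightarrow> 'v \<Rightarrow> bool"
  assumes "zfc_universe E"
    and "\<not> (\<exists>M. transitive_model_kappa_omega E M)"
  shows "aDelta12_reducible E Graphs TFAG"
proof -
  obtain \<psi> where \<psi>: "arithmetical \<psi>" "free_num \<psi> = {}" "free_set \<psi> \<subseteq> {0, 1}"
    "\<And>e X. sat e X \<psi> \<longleftrightarrow> X 1 = group_of (X 0)"
    using group_of_definable by blast
  \<comment> \<open>The graph of the reduction is arithmetical; dummy set quantifiers bring it into
    both required forms.\<close>
  define \<sigma> where "\<sigma> = AllS 2 (ExS 3 \<psi>)"
  define \<tau> where "\<tau> = ExS 2 (AllS 3 \<psi>)"
  have 1: "Pi12 \<sigma>" "Sigma12 \<tau>" unfolding Pi12_def Sigma12_def \<sigma>_def \<tau>_def using \<psi>(1) by blast+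
  have 2: "formula_in_x_y \<sigma>" "formula_in_x_y \<tau>"
    using \<psi>(2,3) by (auto simp: formula_in_x_y_def \<sigma>_def \<tau>_def ExS_def)
  have 3: "\<exists>f. (\<forall>M\<in>Mod Graphs. f M \<in> Mod TFAG) \<and>
      (\<forall>M\<in>Mod Graphs. \<forall>N\<in>Mod TFAG. (f M = N \<longleftrightarrow> sat2 \<sigma> M N) \<and> (f M = N \<longleftrightarrow> sat2 \<tau> M N)) \<and>
      (\<forall>M\<in>Mod Graphs. \<forall>N\<in>Mod Graphs.
         isomorphic (fst Graphs) M N \<longleftrightarrow> isomorphic (fst TFAG) (f M) (f N))"
  proof -
    have "sat2 \<sigma> M N \<longleftrightarrow> N = group_of M" "sat2 \<tau> M N \<longleftrightarrow> N = group_of M" for M N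
      by (simp_all add: sat2_def \<sigma>_def \<tau>_def \<psi>(4))
    then show ?thesis
      by (intro exI[of _ group_of] conjI ballI group_of_TFAG isomorphic_group_of) auto
  qed
  have 4: "forced (members E P) le (reduction_fm Graphs TFAG \<sigma> \<tau>)"
    if "forcing_notion (members E P) le" for P le
  proof -
    interpret forcing_poset "members E P" le using that by unfold_locales
    show ?thesis
      unfolding \<sigma>_def \<tau>_def
      by (rule forced_reduction[where f = group_of and F = "\<lambda>X. group_iso_code (X 0) (X 2) (X 3)"
            and H = "\<lambda>X. graph_iso_code (X 0) (X 2) (X 5)"])
        (simp_all add: lfree_Graphs lfree_TFAG arithmetical_no_set_quant \<psi>(1,4) group_of_TFAG
          borel_group_of borel_graph_iso_code borel_group_iso_code group_iso_code graph_iso_code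
          del: One_nat_def)
  qed
  show ?thesis
    unfolding aDelta12_reducible_def
    by (rule exI[of _ \<sigma>], rule exI[of _ \<tau>], intro conjI allI impI 1 2 3 4)
qed

end
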